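(* Let $\nu\in\{2,4,8\}$. Then the imaginary axis $\Re(s)=0$ is a natural boundary of $\zeta_{\sqrt{+^2}}(s;\nu)$: for every point $it_0$ ($t_0\in\mathbb{R}$) and every open disc $D$ centered at $it_0$, there is no meromorphic function on $\{\Re(s)>0\}\cup D$ that coincides with $\zeta_{\sqrt{+^2}}(s;\nu)$ on $\Re(s)>0$.
   Context: For $\mathbf{x}\in\mathbb{R}^{\nu}$, $|\mathbf{x}|$ is the Euclidean norm. A vector $\mathbf{p}\in\mathbb{Z}^{\nu}\setminus\{\mathbf{0}\}$ is primitive if $\gcd\mathbf{p}=1$ (gcd of the absolute values of its nonzero entries). For $\Re(s)>0$, \[ \zeta_{\sqrt{+^2}}(s;\nu)=\prod_{\mathbf{p}\in\mathbb{Z}^{\nu},\ \gcd\mathbf{p}=1}\bigl(1-e^{-s|\mathbf{p}|}\bigr)^{-1}, \] the product over all primitive vectors (including both $\mathbf{p}$ and $-\mathbf{p}$); it converges absolutely and defines a holomorphic function on $\Re(s)>0$. *)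

theory Defs
  imports "HOL-Complex_Analysis.Complex_Analysis"
begin

definition primitive_vecs :: "nat \<Rightarrow> (nat \<Rightarrow> int) set" where
  "primitive_vecs \<nu> = {p. (\<forall>i\<ge>\<nu>. p i = 0) \<and> Gcd (p ` {..<\<nu>}) = 1}"

definition vec_norm :: "nat \<Rightarrow> (nat \<Rightarrow> int) \<Rightarrow> real" where
  "vec_norm \<nu> p = sqrt (\<Sum>i<\<nu>. (real_of_int (p i))\<^sup>2)"

text \<open>The (absolutely convergent, hence unconditional) infinite product over all
  primitive vectors, defined as the limit of the finite partial products along
  the net of finite subsets.\<close>

definition zeta_sqrt :: "nat \<Rightarrow> complex \<Rightarrow> complex" where
  "zeta_sqrt \<nu> s = Lim (finite_subsets_at_top (primitive_vecs \<nu>))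
     (\<lambda>F. \<Prod>p\<in>F. inverse (1 - exp (- s * complex_of_real (vec_norm \<nu> p))))"

end

theory Submission
  imports Defs "HOL-Real_Asymp.Real_Asymp"
begin

text \<open>With \<open>W s = (\<Sum>x\<in>\<int>\<^sup>\<nu>. exp (- s |x|))\<close> one has \<open>log \<zeta>(s) = (\<Sum>m\<ge>1. c m * (W (m s) - 1))\<close>, where
  \<open>c m = (1/m) * (\<Prod>p | m. 1 - p)\<close>. Poisson summation gives
  \<open>W s = \<kappa> s (\<Sum>\<xi>. (s\<^sup>2 + 4 \<pi>\<^sup>2 |\<xi>|\<^sup>2) powr (- (\<nu> + 1) / 2))\<close>, so as \<open>\<sigma>\<close> decreases to \<open>0\<close> the product of
  \<open>\<sigma> powr ((\<nu> + 1) / 2)\<close> and \<open>log \<zeta>(\<sigma> + 2 \<pi> i \<tau>)\<close> tends to a nonzero multiple of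
  \<open>C \<tau> = (\<Sum>m. c m * m powr (- \<nu>) * r (m\<^sup>2 \<tau>\<^sup>2))\<close>, \<open>r\<close> counting representations as a sum of \<open>\<nu>\<close>
  squares; the interchange of limits only needs a bound for \<open>r\<close> that beats the trivial one by a
  power. A meromorphic continuation allows only logarithmic growth, hence forces \<open>C \<tau> = 0\<close> for all
  \<open>\<tau>\<close> in some interval. But for coprime \<open>j, q\<close> the vanishing of \<open>C (j/q)\<close> depends on \<open>q\<close> only through its set of
  prime divisors; thus \<open>C\<close> would vanish, for suitable \<open>L\<close> and \<open>Q\<close>, at points attached to \<open>f L\<close> for every \<open>f\<close> coprime to
  \<open>Q\<close>, and a Moebius-type inversion over \<open>f\<close> turns this into a vanishing sum of
  nonnegative terms, one of which is positive.\<close>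

section \<open>Representations as sums of squares\<close>

text \<open>The power saving matters because the trivial bound r(n) = O(n^((nu - 1)/2)) is exactly
  critical: both the series C and the error sum over spheres near the critical radius would then be
  compared with the harmonic series. Saving n^(1/6) replaces the exponent -1 by -4/3 and -7/6
  respectively. The saving is produced in dimension two, where few lattice points lie on a short
  arc, and is carried upwards by slicing. Rational \<tau> = j/q makes the critical radius tractable:
  m^2 \<tau>^2 is an integer only if q divides m, and otherwise stays at distance at least 1/q^2
  from the integers. A continuation controls only the modulus of zeta, that is, the real part of its
  logarithm; hence the phase of the limit must not be purely imaginary, which is where the residue
  of nu modulo 4 enters. The theta function is reached through a finite trigonometric identity with
  unevaluated constants, and exp (- s |x|) through a mixture of Gaussians, so that no Fourier
  transform in several variables has to be computed.\<close>

definition int_lattice :: "nat \<Rightarrow> (nat \<Rightarrow> int) set" where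
  "int_lattice \<nu> = {x. \<forall>i\<ge>\<nu>. x i = 0}"

text \<open>Valued in \<open>nat\<close>, so that spheres are indexed by natural numbers and every
  radial lattice sum becomes a series in \<open>n\<close> weighted by \<open>rep\<close>.\<close>

definition sq_norm :: "nat \<Rightarrow> (nat \<Rightarrow> int) \<Rightarrow> nat" where
  "sq_norm \<nu> x = nat (\<Sum>i<\<nu>. (x i)\<^sup>2)"

definition rep :: "nat \<Rightarrow> nat \<Rightarrow> nat" where
  "rep \<nu> n = card {x \<in> int_lattice \<nu>. sq_norm \<nu> x = n}"

lemma vec_norm_conv_sq_norm: "vec_norm \<nu> x = sqrt (real (sq_norm \<nu> x))"
  unfolding vec_norm_def sq_norm_def by (simp add: sum_nonneg)

text \<open>Slicing by the last coordinate \<open>k\<close>: clearing it leaves a vector one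
  dimension lower, of squared norm n - k^2. The truncated subtraction is harmless because k^2 \<le>
  n is part of the index set.\<close>

lemma rep_sphere_Suc:
  "{x \<in> int_lattice (Suc \<nu>). sq_norm (Suc \<nu>) x = n} \<subseteq>
   (\<lambda>(k, x). x(\<nu> := k)) ` (SIGMA k:{k. k\<^sup>2 \<le> int n}. {x \<in> int_lattice \<nu>. sq_norm \<nu> x = n - nat (k\<^sup>2)})"
proof
  fix x assume x: "x \<in> {x \<in> int_lattice (Suc \<nu>). sq_norm (Suc \<nu>) x = n}"
  define S where "S = (\<Sum>i<\<nu>. (x i)\<^sup>2)"
  have S0: "S \<ge> 0" unfolding S_def by (simp add: sum_nonneg)
  have n: "int n = S + (x \<nu>)\<^sup>2" using x S0 by (auto simp: sq_norm_def S_def)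
  have *: "(\<Sum>i<\<nu>. ((x(\<nu> := 0)) i)\<^sup>2) = S" unfolding S_def by (intro sum.cong) auto
  have "x(\<nu> := 0) \<in> {y \<in> int_lattice \<nu>. sq_norm \<nu> y = n - nat ((x \<nu>)\<^sup>2)}"
    using x n S0 by (auto simp: int_lattice_def sq_norm_def * nat_add_distrib simp flip: S_def)
  moreover have "(x \<nu>)\<^sup>2 \<le> int n" using n S0 by simp
  ultimately show "x \<in> (\<lambda>(k, x). x(\<nu> := k)) ` (SIGMA k:{k. k\<^sup>2 \<le> int n}. {x \<in> int_lattice \<nu>. sq_norm \<nu> x = n - nat (k\<^sup>2)})"
    by (intro image_eqI[where x = "(x \<nu>, x(\<nu> := 0))"]) auto
qed

lemma int_sq_le_bound:
  fixes k :: int assumes "k\<^sup>2 \<le> int n" shows "real_of_int \<bar>k\<bar> \<le> sqrt (real n)"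
proof -
  have "(real_of_int k)\<^sup>2 \<le> real n" using assms by (metis of_int_le_iff of_int_of_nat_eq of_int_power)
  thus ?thesis using real_le_rsqrt[of "\<bar>real_of_int k\<bar>" "real n"] by simp
qed

lemma int_sq_le_subset: "{k::int. k\<^sup>2 \<le> int n} \<subseteq> {-\<lfloor>sqrt n\<rfloor>..\<lfloor>sqrt n\<rfloor>}"
proof
  fix k :: int assume "k \<in> {k. k\<^sup>2 \<le> int n}"
  hence "real_of_int \<bar>k\<bar> \<le> sqrt (real n)" using int_sq_le_bound by auto
  hence "\<bar>k\<bar> \<le> \<lfloor>sqrt n\<rfloor>" by linarith
  thus "k \<in> {-\<lfloor>sqrt n\<rfloor>..\<lfloor>sqrt n\<rfloor>}" by auto
qed

lemma finite_int_sq_le: "finite {k::int. k\<^sup>2 \<le> int n}"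
  by (rule finite_subset[OF int_sq_le_subset]) auto

lemma card_int_sq_le: "real (card {k::int. k\<^sup>2 \<le> int n}) \<le> 2 * sqrt n + 1"
proof -
  have "card {k::int. k\<^sup>2 \<le> int n} \<le> card {-\<lfloor>sqrt n\<rfloor>..\<lfloor>sqrt n\<rfloor>}"
    by (rule card_mono[OF _ int_sq_le_subset]) auto
  also have "\<dots> = nat (2 * \<lfloor>sqrt n\<rfloor> + 1)" by simp
  finally have "real (card {k::int. k\<^sup>2 \<le> int n}) \<le> real (nat (2 * \<lfloor>sqrt n\<rfloor> + 1))" by linarith
  also have "\<dots> = 2 * real_of_int \<lfloor>sqrt n\<rfloor> + 1" by (subst of_nat_nat) auto
  also have "\<dots> \<le> 2 * sqrt n + 1" by simp
  finally show ?thesis .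
qed

lemma finite_sphere: "finite {x \<in> int_lattice \<nu>. sq_norm \<nu> x = n}"
proof (induction \<nu> arbitrary: n)
  case 0
  have "{x \<in> int_lattice 0. sq_norm 0 x = n} \<subseteq> {\<lambda>_. 0}" by (auto simp: int_lattice_def)
  thus ?case using finite_subset by blast
next
  case (Suc \<nu>)
  show ?case
    by (rule finite_subset[OF rep_sphere_Suc finite_imageI])
       (intro finite_SigmaI finite_int_sq_le Suc.IH)
qed

lemma rep_Suc_le: "rep (Suc \<nu>) n \<le> (\<Sum>k\<in>{k. k\<^sup>2 \<le> int n}. rep \<nu> (n - nat (k\<^sup>2)))"
proof -
  let ?S = "SIGMA k:{k. k\<^sup>2 \<le> int n}. {x \<in> int_lattice \<nu>. sq_norm \<nu> x = n - nat (k\<^sup>2)}"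
  have fin: "finite ?S" by (intro finite_SigmaI finite_int_sq_le finite_sphere)
  have "rep (Suc \<nu>) n \<le> card ((\<lambda>(k, x). x(\<nu> := k)) ` ?S)"
    unfolding rep_def by (rule card_mono[OF _ rep_sphere_Suc]) (use fin in auto)
  also have "\<dots> \<le> card ?S" by (rule card_image_le[OF fin])
  also have "\<dots> = (\<Sum>k\<in>{k. k\<^sup>2 \<le> int n}. rep \<nu> (n - nat (k\<^sup>2)))"
    unfolding rep_def by (rule card_SigmaI) (use finite_int_sq_le finite_sphere in auto)
  finally show ?thesis .
qed

text \<open>Three lattice points on an arc: the determinant \<open>D\<close> of their differences is a nonzero integer,
  which forces the arc to have length at least of order \<open>n\<^bsup>1/6\<^esup>\<close>.\<close>

lemma three_points_on_arc:
  fixes x1 x2 x3 y1 y2 y3 n :: int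
  assumes n: "n > 0"
    and p1: "x1^2 + y1^2 = n" and p2: "x2^2 + y2^2 = n" and p3: "x3^2 + y3^2 = n"
    and a1: "\<bar>x1\<bar> \<le> y1" and a2: "\<bar>x2\<bar> \<le> y2" and a3: "\<bar>x3\<bar> \<le> y3"
    and lt: "x1 < x2" "x2 < x3"
  shows "(x3 - x1)^6 > n"
proof -
  define u w v z D where "u = x2 - x1" "w = x3 - x2" "v = y2 - y1" "z = y3 - y2" "D = u * z - w * v"
  note defs = this
  \<comment> \<open>Chords of the quarter circle |x| <= y have slope at most 1 in absolute
    value.\<close>
  have slope: "\<bar>b2 - b1\<bar> \<le> a2 - a1"
    if "a1^2 + b1^2 = n" "a2^2 + b2^2 = n" "\<bar>a1\<bar> \<le> b1" "\<bar>a2\<bar> \<le> b2" "a1 < a2" for a1 a2 b1 b2 :: int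
  proof -
    have e: "(a2 - a1) * (a1 + a2) = - (b2 - b1) * (b1 + b2)"
      using that(1,2) by (simp add: power2_eq_square algebra_simps)
    have pos: "b1 + b2 > 0" using that by linarith
    have "\<bar>b2 - b1\<bar> * (b1 + b2) = \<bar>(a2 - a1) * (a1 + a2)\<bar>" unfolding e using pos by (simp add: abs_mult)
    also have "\<dots> = (a2 - a1) * \<bar>a1 + a2\<bar>" using that by (simp add: abs_mult)
    also have "\<dots> \<le> (a2 - a1) * (b1 + b2)" using that by (intro mult_left_mono) auto
    finally show ?thesis using pos by simp
  qed
  have upos: "u > 0" "w > 0" using lt by (auto simp: defs)
  have ypos: "y1 > 0" "y2 > 0" "y3 > 0"
  proof -
    have "y > 0" if "x^2 + y^2 = n" "\<bar>x\<bar> \<le> y" for x y :: int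
      using that n by (cases "y = 0") auto
    thus "y1 > 0" "y2 > 0" "y3 > 0" using assms by blast+
  qed
  have slope13: "\<bar>v + z\<bar> \<le> u + w"
    using slope[OF p1 p3 a1 a3] lt by (simp add: defs)
  \<comment> \<open>\<open>D\<close> is the cross product of the two successive chords. The chord
    equations u (x1 + x2) = - v (y1 + y2) and w (x2 + x3) = - z (y2 + y3) exhibit it as a quotient
    whose numerator is at most 4 u w (u + w) y2 and whose denominator is at least y2 (y1 + y2 +
    y3).\<close>
  have key: "D * ((y1 + y2) * (y2 + y3) + u * w) = 2 * u * w * (x2 * (v + z) - y2 * (u + w))"
  proof -
    have e1: "u * (x1 + x2) = - v * (y1 + y2)" using p1 p2 by (simp add: defs power2_eq_square algebra_simps)
    have e2: "w * (x2 + x3) = - z * (y2 + y3)" using p2 p3 by (simp add: defs power2_eq_square algebra_simps)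
    have "D * ((y1 + y2) * (y2 + y3)) = u * (z * (y2 + y3)) * (y1 + y2) - w * (v * (y1 + y2)) * (y2 + y3)"
      by (simp add: defs algebra_simps)
    also have "z * (y2 + y3) = - w * (x2 + x3)" using e2 by simp
    also have "v * (y1 + y2) = - u * (x1 + x2)" using e1 by simp
    finally show ?thesis by (simp add: defs algebra_simps)
  qed
  \<comment> \<open>Collinearity would give the outer chord slope 1 or -1, which puts both of its
    end points on the same corner of the quarter circle.\<close>
  have D0: "D \<noteq> 0"
  proof
    assume "D = 0"
    hence "x2 * (v + z) = y2 * (u + w)" using key upos by simp
    hence "\<bar>x2\<bar> * \<bar>v + z\<bar> = y2 * (u + w)" using ypos upos by (metis abs_mult abs_of_pos add_pos_pos mult_pos_pos)
    moreover have "\<bar>x2\<bar> * \<bar>v + z\<bar> \<le> y2 * \<bar>v + z\<bar>" using a2 by (intro mult_right_mono) auto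
    ultimately have "y2 * (u + w) \<le> y2 * \<bar>v + z\<bar>" by simp
    hence eq: "\<bar>v + z\<bar> = u + w" using slope13 ypos by simp
    have vz: "v + z = y3 - y1" "u + w = x3 - x1" by (auto simp: defs)
    have "(x3 - x1) * (x1 + x3) = - (y3 - y1) * (y1 + y3)"
      using p1 p3 by (simp add: power2_eq_square algebra_simps)
    hence "\<bar>(x3 - x1)\<bar> * \<bar>x1 + x3\<bar> = \<bar>y3 - y1\<bar> * (y1 + y3)"
      using ypos by (metis abs_minus_cancel abs_mult abs_of_pos add_pos_pos)
    hence s: "\<bar>x1 + x3\<bar> = y1 + y3" using eq vz lt by auto
    hence "x1 = y1 \<and> x3 = y3 \<or> x1 = -y1 \<and> x3 = -y3" using a1 a3 by linarith
    hence "2 * x1^2 = n \<and> 2 * x3^2 = n" "x1 > 0 \<and> x3 > 0 \<or> x1 < 0 \<and> x3 < 0"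
      using p1 p3 ypos by (auto simp: power2_eq_square)
    hence "x1^2 = x3^2" by simp
    hence "x1 = x3 \<or> x1 = -x3" by (simp add: power2_eq_iff)
    thus False using lt \<open>x1 > 0 \<and> x3 > 0 \<or> x1 < 0 \<and> x3 < 0\<close> by linarith
  qed
  have "\<bar>x2 * (v + z) - y2 * (u + w)\<bar> \<le> \<bar>x2\<bar> * \<bar>v + z\<bar> + y2 * (u + w)"
    using ypos upos abs_triangle_ineq4[of "x2 * (v + z)" "y2 * (u + w)"] by (simp add: abs_mult)
  also have "\<bar>x2\<bar> * \<bar>v + z\<bar> \<le> y2 * (u + w)"
    using a2 slope13 ypos by (intro mult_mono) auto
  finally have b: "\<bar>x2 * (v + z) - y2 * (u + w)\<bar> \<le> 2 * y2 * (u + w)" by simp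
  have "\<bar>D\<bar> * (y2 * (y1 + y2 + y3)) \<le> \<bar>D\<bar> * ((y1 + y2) * (y2 + y3) + u * w)"
    using ypos upos by (intro mult_left_mono) (auto simp: algebra_simps)
  also have "\<dots> = \<bar>D * ((y1 + y2) * (y2 + y3) + u * w)\<bar>"
    using ypos upos by (simp add: abs_mult)
  also have "\<dots> = 2 * u * w * \<bar>x2 * (v + z) - y2 * (u + w)\<bar>"
    unfolding key using upos by (simp add: abs_mult)
  also have "\<dots> \<le> 2 * u * w * (2 * y2 * (u + w))"
    using b upos by (intro mult_left_mono) auto
  also have "\<dots> = y2 * (4 * u * w * (u + w))" by simp
  finally have "y2 * (\<bar>D\<bar> * (y1 + y2 + y3)) \<le> y2 * (4 * u * w * (u + w))" by (simp add: algebra_simps)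
  hence "\<bar>D\<bar> * (y1 + y2 + y3) \<le> 4 * u * w * (u + w)" using ypos by simp
  moreover have "y1 + y2 + y3 \<le> \<bar>D\<bar> * (y1 + y2 + y3)" using D0 ypos by simp
  \<comment> \<open>AM-GM bounds the right-hand side by (x3 - x1)^3, while |D| >= 1 bounds the
    left-hand side below by y1 + y2 + y3. The sixth power arises by squaring, since n is less than
    the square of y1 + y2 + y3.\<close>
  moreover have "4 * u * w \<le> (u + w)^2" using zero_le_power2[of "u - w"] by (simp add: power2_eq_square algebra_simps)
  hence "4 * u * w * (u + w) \<le> (u + w)^2 * (u + w)" using upos by (intro mult_right_mono) auto
  ultimately have "y1 + y2 + y3 \<le> (u + w)^3" by (simp add: power2_eq_square power3_eq_cube)
  hence "(y1 + y2 + y3)^2 \<le> ((u + w)^3)^2" using ypos by (intro power_mono) auto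
  also have "\<dots> = (x3 - x1)^6" by (simp add: defs flip: power_mult)
  finally have "(y1 + y2 + y3)^2 \<le> (x3 - x1)^6" .
  moreover have "n < (y1 + y2 + y3)^2"
  proof -
    have "x1^2 \<le> y1^2" "x2^2 \<le> y2^2" using a1 a2 by (meson abs_le_square_iff abs_ge_self order_trans)+
    hence "n \<le> 2 * y1^2" "n \<le> 2 * y2^2" using p1 p2 by auto
    moreover have "(y1 + y2 + y3)^2 > y1^2 + y2^2" using ypos
      by (simp add: power2_eq_square algebra_simps add_pos_pos)
    ultimately show ?thesis by linarith
  qed
  ultimately show ?thesis by linarith
qed

lemma card_le_two_if_no_three:
  fixes X :: "int set"
  assumes "finite X" "\<And>a b c. a \<in> X \<Longrightarrow> b \<in> X \<Longrightarrow> c \<in> X \<Longrightarrow> a < b \<Longrightarrow> b < c \<Longrightarrow> False"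
  shows "card X \<le> 2"
proof (rule ccontr)
  assume "\<not> card X \<le> 2"
  hence "3 \<le> card X" by simp
  then obtain Y where "Y \<subseteq> X" "card Y = 3" by (meson obtain_subset_with_card_n)
  then obtain a b c where "Y = {a, b, c}" "a \<noteq> b" "b \<noteq> c" "a \<noteq> c" by (auto simp: card_3_iff)
  hence "a \<in> X" "b \<in> X" "c \<in> X" using \<open>Y \<subseteq> X\<close> by auto
  thus False using assms(2) \<open>a \<noteq> b\<close> \<open>b \<noteq> c\<close> \<open>a \<noteq> c\<close> by (metis linorder_neqE)
qed

text \<open>An abscissa determines the point on the arc, and the abscissas lie in an interval of
  length 2 sqrt n. Cut into blocks of length about n^(1/6), it has at most two of them per block by
  \<open>three_points_on_arc\<close>, hence about 4 n^(1/2 - 1/6) in all.\<close>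

lemma card_arc_le:
  assumes n: "n > 0"
  shows "finite {(x::int, y::int). x^2 + y^2 = int n \<and> \<bar>x\<bar> \<le> y}"
    and "real (card {(x::int, y::int). x^2 + y^2 = int n \<and> \<bar>x\<bar> \<le> y}) \<le> 10 * real n powr (1/3)"
proof -
  define A where "A = {(x::int, y::int). x^2 + y^2 = int n \<and> \<bar>x\<bar> \<le> y}"
  define X where "X = fst ` A"
  have inj: "inj_on fst A"
  proof (rule inj_onI)
    fix p q assume "p \<in> A" "q \<in> A" "fst p = fst q"
    then obtain x y y' where "p = (x, y)" "q = (x, y')" "x^2 + y^2 = int n" "x^2 + y'^2 = int n" "\<bar>x\<bar> \<le> y" "\<bar>x\<bar> \<le> y'"
      unfolding A_def by auto
    moreover from this have "y^2 = y'^2" by linarith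
    hence "\<bar>y\<bar> = \<bar>y'\<bar>" using power2_eq_iff by (metis abs_minus_cancel)
    ultimately show "p = q" by auto
  qed
  have Xsub: "X \<subseteq> {k. k\<^sup>2 \<le> int n}" unfolding X_def A_def by (auto) (smt (verit) zero_le_power2)
  have finX: "finite X" by (rule finite_subset[OF Xsub finite_int_sq_le])
  thus "finite {(x::int, y::int). x^2 + y^2 = int n \<and> \<bar>x\<bar> \<le> y}"
    using inj by (simp add: X_def A_def[symmetric] finite_image_iff)
  \<comment> \<open>Integers with the same quotient by \<open>L\<close> differ by at most L - 1, and
    it is L - 1 whose sixth power is at most n.\<close>
  define L :: int where "L = \<lfloor>real n powr (1/6)\<rfloor> + 1"
  have L1: "L \<ge> 1" unfolding L_def by simp
  have Lge: "real n powr (1/6) \<le> L" unfolding L_def by linarith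
  have Lle: "real_of_int (L - 1) ^ 6 \<le> real n"
  proof -
    have "real_of_int (L - 1) \<le> real n powr (1/6)" unfolding L_def by simp
    moreover have "real_of_int (L - 1) \<ge> 0" using L1 by simp
    ultimately have "real_of_int (L - 1) ^ 6 \<le> (real n powr (1/6)) ^ 6" by (intro power_mono) auto
    also have "\<dots> = real n" using n by (simp add: powr_power)
    finally show ?thesis .
  qed
  have fib: "card {x \<in> X. x div L = j} \<le> 2" for j
  proof (rule card_le_two_if_no_three)
    show "finite {x \<in> X. x div L = j}" using finX by simp
    fix a b c assume abc: "a \<in> {x \<in> X. x div L = j}" "b \<in> {x \<in> X. x div L = j}" "c \<in> {x \<in> X. x div L = j}" "a < b" "b < c"
    then obtain a' b' c' where "(a, a') \<in> A" "(b, b') \<in> A" "(c, c') \<in> A" unfolding X_def by force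
    hence "(c - a)^6 > int n" using n abc(4,5)
      by (intro three_points_on_arc[of "int n" a a' b b' c c']) (auto simp: A_def)
    moreover have "c - a \<le> L - 1"
    proof -
      have "a div L = j" "c div L = j" using abc by auto
      moreover have "a mod L \<ge> 0" "c mod L < L" using L1 by simp_all
      moreover have "a = L * (a div L) + a mod L" "c = L * (c div L) + c mod L" by simp_all
      ultimately show ?thesis by (smt (verit))
    qed
    hence "(c - a)^6 \<le> (L - 1)^6" using abc by (intro power_mono) auto
    ultimately have "int n < (L - 1)^6" by simp
    hence "real n < real_of_int (L - 1) ^ 6" by (metis of_int_less_iff of_int_of_nat_eq of_int_power)
    thus False using Lle by simp
  qed
  let ?B = "{\<lfloor>- sqrt n / L\<rfloor>..\<lfloor>sqrt n / L\<rfloor>}"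
  have img: "(\<lambda>x. x div L) ` X \<subseteq> ?B"
  proof
    fix j assume "j \<in> (\<lambda>x. x div L) ` X"
    then obtain x where x: "x \<in> X" "j = x div L" by auto
    have "real_of_int \<bar>x\<bar> \<le> sqrt n" using x(1) Xsub int_sq_le_bound by auto
    hence le: "- sqrt n \<le> x" "x \<le> sqrt n" by linarith+
    have j: "j = \<lfloor>real_of_int x / real_of_int L\<rfloor>" using x by (simp add: floor_divide_of_int_eq)
    have "- sqrt n / L \<le> x / L" "x / L \<le> sqrt n / L" using L1 le by (intro divide_right_mono; simp)+
    thus "j \<in> ?B" unfolding j by (auto intro!: floor_mono)
  qed
  have "card X \<le> (\<Sum>j\<in>(\<lambda>x. x div L) ` X. card {x \<in> X. x div L = j})"
    by (subst card_eq_sum, subst sum.image_gen[OF finX, of _ "\<lambda>x. x div L"]) simp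
  also have "\<dots> \<le> (\<Sum>j\<in>(\<lambda>x. x div L) ` X. 2)" by (intro sum_mono fib)
  also have "\<dots> = card ((\<lambda>x. x div L) ` X) * 2" by simp
  also have "\<dots> \<le> card ?B * 2" by (intro mult_right_mono card_mono img) auto
  finally have "real (card X) \<le> 2 * real (card ?B)" by linarith
  also have "real (card ?B) \<le> 2 * sqrt n / L + 2"
  proof -
    have "0 \<le> sqrt n / L" using L1 by simp
    hence "\<lfloor>- sqrt n / L\<rfloor> \<le> 0" "0 \<le> \<lfloor>sqrt n / L\<rfloor>" by (simp_all add: floor_le_iff)
    moreover have "card ?B = nat (\<lfloor>sqrt n / L\<rfloor> + 1 - \<lfloor>- sqrt n / L\<rfloor>)" by simp
    ultimately have "int (card ?B) = \<lfloor>sqrt n / L\<rfloor> - \<lfloor>- sqrt n / L\<rfloor> + 1" by linarith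
    hence "real (card ?B) = real_of_int \<lfloor>sqrt n / L\<rfloor> - real_of_int \<lfloor>- sqrt n / L\<rfloor> + 1" by linarith
    moreover have "real_of_int \<lfloor>sqrt n / L\<rfloor> \<le> sqrt n / L" "real_of_int \<lfloor>- sqrt n / L\<rfloor> \<ge> - sqrt n / L - 1" by linarith+
    moreover have "2 * sqrt n / L = 2 * (sqrt n / L)" "- sqrt n / L = - (sqrt n / L)" by simp_all
    ultimately show ?thesis by linarith
  qed
  also have "2 * sqrt n / L \<le> 2 * sqrt n / real n powr (1/6)"
    using Lge n L1 by (intro divide_left_mono mult_pos_pos) auto
  also have "\<dots> = 2 * real n powr (1/3)"
    using n powr_diff[of "real n" "1/2" "1/6"] by (simp add: powr_half_sqrt)
  finally have "real (card X) \<le> 4 * real n powr (1/3) + 4" by simp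
  moreover have "real n powr (1/3) \<ge> 1" using n by (simp add: ge_one_powr_ge_zero)
  ultimately have "real (card X) \<le> 10 * real n powr (1/3)" by linarith
  moreover have "card X = card A" unfolding X_def using inj by (rule card_image)
  ultimately show "real (card {(x::int, y::int). x^2 + y^2 = int n \<and> \<bar>x\<bar> \<le> y}) \<le> 10 * real n powr (1/3)"
    by (simp add: A_def)
qed

text \<open>Four images of the arc |x| <= y under swap and sign change cover the circle, whence 40 =
  4 * 10. The shift n + 1 keeps the bound valid at n = 0, where \<open>rep\<close> is 1 but the
  power of n would be 0.\<close>

lemma rep_2_le: "real (rep 2 n) \<le> 40 * (real n + 1) powr (1/3)"
proof -
  define A where "A = {(x::int, y::int). x^2 + y^2 = int n \<and> \<bar>x\<bar> \<le> y}"
  define vec :: "int \<Rightarrow> int \<Rightarrow> nat \<Rightarrow> int" where "vec = (\<lambda>a b i. if i = 0 then a else if i = 1 then b else 0)"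
  have sub: "{x \<in> int_lattice 2. sq_norm 2 x = n} \<subseteq>
      (\<lambda>(x, y). vec x y) ` A \<union> (\<lambda>(x, y). vec x (-y)) ` A \<union> (\<lambda>(x, y). vec y x) ` A \<union> (\<lambda>(x, y). vec (-y) x) ` A"
  proof
    fix p assume p: "p \<in> {x \<in> int_lattice 2. sq_norm 2 x = n}"
    have e: "(p 0)^2 + (p 1)^2 = int n"
      using p by (auto simp: sq_norm_def numeral_2_eq_2)
    have pv: "p = vec (p 0) (p 1)"
      using p by (auto simp: int_lattice_def vec_def fun_eq_iff numeral_2_eq_2 not_less_eq_eq)
    consider "\<bar>p 0\<bar> \<le> p 1" | "\<bar>p 0\<bar> \<le> - p 1" | "\<bar>p 1\<bar> \<le> p 0" | "\<bar>p 1\<bar> \<le> - p 0" by linarith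
    thus "p \<in> (\<lambda>(x, y). vec x y) ` A \<union> (\<lambda>(x, y). vec x (-y)) ` A \<union> (\<lambda>(x, y). vec y x) ` A \<union> (\<lambda>(x, y). vec (-y) x) ` A"
    proof cases
      case 1 hence "(p 0, p 1) \<in> A" using e by (auto simp: A_def)
      thus ?thesis using pv by (intro UnI1) (rule image_eqI, auto)
    next
      case 2 hence "(p 0, - p 1) \<in> A" using e by (auto simp: A_def)
      moreover have "p = (\<lambda>(x, y). vec x (-y)) (p 0, - p 1)" using pv by simp
      ultimately show ?thesis by blast
    next
      case 3 hence "(p 1, p 0) \<in> A" using e by (auto simp: A_def)
      moreover have "p = (\<lambda>(x, y). vec y x) (p 1, p 0)" using pv by simp
      ultimately show ?thesis by blast
    next
      case 4 hence "(p 1, - p 0) \<in> A" using e by (auto simp: A_def)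
      moreover have "p = (\<lambda>(x, y). vec (-y) x) (p 1, - p 0)" using pv by simp
      ultimately show ?thesis by blast
    qed
  qed
  have fin: "finite A" and cA: "real (card A) \<le> 10 * (real n + 1) powr (1/3)"
  proof -
    show "finite A"
    proof (cases "n = 0")
      case True
      hence "A \<subseteq> {(0,0)}" unfolding A_def by auto
      thus ?thesis using finite_subset by blast
    qed (use card_arc_le[of n] in \<open>simp add: A_def\<close>)
    show "real (card A) \<le> 10 * (real n + 1) powr (1/3)"
    proof (cases "n = 0")
      case True
      hence "A \<subseteq> {(0,0)}" unfolding A_def by auto
      hence "card A \<le> 1" using card_mono[of "{(0::int,0::int)}" A] by simp
      thus ?thesis using True by simp
    next
      case False
      hence "real (card A) \<le> 10 * real n powr (1/3)" using card_arc_le(2)[of n] by (simp add: A_def)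
      also have "\<dots> \<le> 10 * (real n + 1) powr (1/3)" by (intro mult_left_mono powr_mono2) auto
      finally show ?thesis .
    qed
  qed
  have "rep 2 n \<le> card ((\<lambda>(x, y). vec x y) ` A \<union> (\<lambda>(x, y). vec x (-y)) ` A \<union> (\<lambda>(x, y). vec y x) ` A \<union> (\<lambda>(x, y). vec (-y) x) ` A)"
    unfolding rep_def by (rule card_mono[OF _ sub]) (use fin in auto)
  also have "\<dots> \<le> card ((\<lambda>(x, y). vec x y) ` A) + card ((\<lambda>(x, y). vec x (-y)) ` A) + card ((\<lambda>(x, y). vec y x) ` A) + card ((\<lambda>(x, y). vec (-y) x) ` A)"
    by (meson add_mono card_Un_le order_refl order_trans)
  also have "\<dots> \<le> card A + card A + card A + card A" by (intro add_mono card_image_le fin)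
  finally show ?thesis using cA by linarith
qed

text \<open>Each slicing step has O(n^(1/2)) slices and so raises the exponent by 1/2. Starting from
  1/3 in dimension two preserves the saving of 1/6 over (nu - 1)/2, the exponent that slicing alone
  would give.\<close>

lemma rep_le:
  assumes "\<nu> \<ge> 2"
  shows "\<exists>C>0. \<forall>n. real (rep \<nu> n) \<le> C * (real n + 1) powr (real \<nu> / 2 - 2/3)"
  using assms
proof (induction \<nu> rule: dec_induct)
  case base
  show ?case by (intro exI[of _ 40]) (use rep_2_le in auto)
next
  case (step \<nu>)
  then obtain C where C: "C > 0" "\<And>n. real (rep \<nu> n) \<le> C * (real n + 1) powr (real \<nu> / 2 - 2/3)" by auto
  have "real (rep (Suc \<nu>) n) \<le> 3 * C * (real n + 1) powr (real (Suc \<nu>) / 2 - 2/3)" for n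
  proof -
    have "real (rep (Suc \<nu>) n) \<le> (\<Sum>k\<in>{k. k\<^sup>2 \<le> int n}. real (rep \<nu> (n - nat (k\<^sup>2))))"
      using rep_Suc_le[of \<nu> n] by (metis of_nat_le_iff of_nat_sum)
    also have "\<dots> \<le> (\<Sum>k\<in>{k. k\<^sup>2 \<le> int n}. C * (real n + 1) powr (real \<nu> / 2 - 2/3))"
    proof (intro sum_mono)
      fix k :: int
      have "real (rep \<nu> (n - nat (k\<^sup>2))) \<le> C * (real (n - nat (k\<^sup>2)) + 1) powr (real \<nu> / 2 - 2/3)" by (rule C)
      also have "\<dots> \<le> C * (real n + 1) powr (real \<nu> / 2 - 2/3)"
        using C step by (intro mult_left_mono powr_mono2) auto
      finally show "real (rep \<nu> (n - nat (k\<^sup>2))) \<le> C * (real n + 1) powr (real \<nu> / 2 - 2/3)" .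
    qed
    also have "\<dots> = real (card {k::int. k\<^sup>2 \<le> int n}) * (C * (real n + 1) powr (real \<nu> / 2 - 2/3))" by simp
    also have "\<dots> \<le> (3 * (real n + 1) powr (1/2)) * (C * (real n + 1) powr (real \<nu> / 2 - 2/3))"
    proof (intro mult_right_mono)
      have "sqrt n \<le> sqrt (real n + 1)" "1 \<le> sqrt (real n + 1)" by auto
      thus "real (card {k::int. k\<^sup>2 \<le> int n}) \<le> 3 * (real n + 1) powr (1/2)"
        using card_int_sq_le[of n] powr_half_sqrt[of "real n + 1"] by linarith
    qed (use C in auto)
    also have "\<dots> = 3 * C * ((real n + 1) powr (1/2) * (real n + 1) powr (real \<nu> / 2 - 2/3))" by simp
    also have "(real n + 1) powr (1/2) * (real n + 1) powr (real \<nu> / 2 - 2/3) = (real n + 1) powr (real (Suc \<nu>) / 2 - 2/3)"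
      by (subst powr_add[symmetric]) (simp add: field_simps)
    finally show ?thesis .
  qed
  thus ?case using C by (intro exI[of _ "3 * C"]) auto
qed

section \<open>The theta transformation\<close>

lemma two_cos_power:
  "of_real ((2 * cos x) ^ (2 * m)) = (\<Sum>i\<le>2*m. of_nat ((2*m) choose i) * cis (2 * (real i - real m) * x))"
proof -
  have "complex_of_real (2 * cos x) = cis x + cis (-x)"
    by (simp add: complex_eq_iff)
  hence "of_real ((2 * cos x) ^ (2 * m)) = (cis x + cis (-x)) ^ (2 * m)" by (metis of_real_power)
  also have "\<dots> = (\<Sum>i\<le>2*m. of_nat ((2*m) choose i) * cis x ^ i * cis (-x) ^ (2 * m - i))"
    by (rule binomial_ring)
  also have "\<dots> = (\<Sum>i\<le>2*m. of_nat ((2*m) choose i) * cis (2 * (real i - real m) * x))"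
  proof (intro sum.cong refl)
    fix i assume "i \<in> {..2*m}"
    hence "real i * x + real (2 * m - i) * (-x) = 2 * (real i - real m) * x"
      by (simp add: of_nat_diff algebra_simps)
    thus "of_nat ((2*m) choose i) * cis x ^ i * cis (-x) ^ (2 * m - i) =
        (of_nat ((2*m) choose i) * cis (2 * (real i - real m) * x) :: complex)"
      by (simp add: Complex.DeMoivre cis_mult mult.assoc)
  qed
  finally show ?thesis .
qed

lemma sum_roots_of_unity:
  assumes l: "l > 0"
  shows "(\<Sum>j<l. cis (2 * pi * real_of_int d / real l * real j)) = (if int l dvd d then of_nat l else 0)"
proof -
  define w where "w = cis (2 * pi * real_of_int d / real l)"
  have wj: "cis (2 * pi * real_of_int d / real l * real j) = w ^ j" for j
    unfolding w_def by (simp add: Complex.DeMoivre mult_ac)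
  have wl: "w ^ l = 1"
  proof -
    have "w ^ l = cis (2 * pi * real_of_int d)" unfolding w_def using l by (simp add: Complex.DeMoivre)
    also have "\<dots> = 1" by (simp add: cis_multiple_2pi)
    finally show ?thesis .
  qed
  have w1: "w = 1 \<longleftrightarrow> int l dvd d"
  proof
    assume "w = 1"
    hence "cos (2 * pi * real_of_int d / real l) = 1" unfolding w_def by (simp add: complex_eq_iff)
    then obtain n :: int where "2 * pi * real_of_int d / real l = of_int n * 2 * pi"
      using cos_one_2pi_int by auto
    hence "real_of_int d = of_int n * real l" using l by (simp add: field_simps)
    hence "d = n * int l" by (metis of_int_eq_iff of_int_mult of_int_of_nat_eq)
    thus "int l dvd d" by simp
  next
    assume "int l dvd d"
    then obtain n where "d = int l * n" by auto
    hence "2 * pi * real_of_int d / real l = 2 * pi * real_of_int n" using l by simp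
    thus "w = 1" unfolding w_def by (simp only:) (simp add: cis_multiple_2pi)
  qed
  show ?thesis
  proof (cases "int l dvd d")
    case True
    thus ?thesis using w1 wj by simp
  next
    case False
    hence "w \<noteq> 1" using w1 by simp
    hence "(\<Sum>j<l. w ^ j) = 0" using geometric_sum[of w l] wl by simp
    thus ?thesis using False wj by simp
  qed
qed

text \<open>Orthogonality of the l-th roots of unity selects from the binomial expansion the indices
  congruent to m modulo l.\<close>

lemma sum_cos_power:
  assumes l: "l > 0"
  shows "(\<Sum>j<l. (2 * cos (pi * real j / real l)) ^ (2 * m)) =
         real l * (\<Sum>i\<in>{i. i \<le> 2*m \<and> int l dvd (int i - int m)}. real ((2*m) choose i))"
proof -
  have "complex_of_real (\<Sum>j<l. (2 * cos (pi * real j / real l)) ^ (2 * m)) =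
     (\<Sum>j<l. \<Sum>i\<le>2*m. of_nat ((2*m) choose i) * cis (2 * (real i - real m) * (pi * real j / real l)))"
    unfolding of_real_sum two_cos_power ..
  also have "\<dots> = (\<Sum>i\<le>2*m. of_nat ((2*m) choose i) * (\<Sum>j<l. cis (2 * pi * real_of_int (int i - int m) / real l * real j)))"
    by (subst sum.swap) (simp add: sum_distrib_left mult_ac)
  also have "\<dots> = (\<Sum>i\<le>2*m. if int l dvd (int i - int m) then of_nat l * of_nat ((2*m) choose i) else 0)"
    by (subst sum_roots_of_unity[OF l]) (intro sum.cong, auto)
  also have "\<dots> = (\<Sum>i\<in>{i\<in>{..2*m}. int l dvd (int i - int m)}. of_nat l * of_nat ((2*m) choose i))"
    by (subst sum.inter_filter) auto
  also have "\<dots> = complex_of_real (real l * (\<Sum>i\<in>{i. i \<le> 2*m \<and> int l dvd (int i - int m)}. real ((2*m) choose i)))"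
    by (simp add: sum_distrib_left)
  finally show ?thesis by (simp only: of_real_eq_iff)
qed

text \<open>Indices above and below m are paired by the symmetry i -> 2 m - i. The sum over k may
  run up to m because the binomial coefficients with k l > m vanish.\<close>

lemma sum_choose_multiples:
  assumes l: "l > 0"
  shows "(\<Sum>i\<in>{i. i \<le> 2*m \<and> int l dvd (int i - int m)}. real ((2*m) choose i)) =
     real ((2*m) choose m) + 2 * (\<Sum>k=1..m. real ((2*m) choose (m + k * l)))"
proof -
  let ?A = "{i. i \<le> 2*m \<and> int l dvd (int i - int m)}"
  define U where "U = {i. m < i \<and> i \<le> 2*m \<and> int l dvd (int i - int m)}"
  define V where "V = {i. i < m \<and> int l dvd (int i - int m)}"
  have fin: "finite U" "finite V" unfolding U_def V_def by (auto intro: finite_subset[of _ "{..2*m}"])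
  have "?A = insert m (U \<union> V)" unfolding U_def V_def by auto
  hence "(\<Sum>i\<in>?A. real ((2*m) choose i)) = (\<Sum>i\<in>insert m (U \<union> V). real ((2*m) choose i))" by simp
  also have "\<dots> = real ((2*m) choose m) + (\<Sum>i\<in>U \<union> V. real ((2*m) choose i))"
    by (rule sum.insert) (use fin in \<open>auto simp: U_def V_def\<close>)
  also have "(\<Sum>i\<in>U \<union> V. real ((2*m) choose i)) = (\<Sum>i\<in>U. real ((2*m) choose i)) + (\<Sum>i\<in>V. real ((2*m) choose i))"
    by (rule sum.union_disjoint) (use fin in \<open>auto simp: U_def V_def\<close>)
  also have "(\<Sum>i\<in>V. real ((2*m) choose i)) = (\<Sum>i\<in>U. real ((2*m) choose i))"
  proof (rule sum.reindex_bij_witness[of _ "\<lambda>i. 2*m - i" "\<lambda>i. 2*m - i"])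
    fix i assume i: "i \<in> V"
    hence e: "int (2 * m - i) - int m = - (int i - int m)" unfolding V_def by auto
    show "2 * m - i \<in> U" using i unfolding U_def mem_Collect_eq e dvd_minus_iff by (auto simp: V_def)
  next
    fix i assume i: "i \<in> U"
    hence e: "int (2 * m - i) - int m = - (int i - int m)" unfolding U_def by auto
    show "2 * m - i \<in> V" using i unfolding V_def mem_Collect_eq e dvd_minus_iff by (auto simp: U_def)
  next
    fix i assume "i \<in> V"
    thus "real ((2*m) choose (2*m - i)) = real ((2*m) choose i)"
      by (subst binomial_symmetric) (auto simp: V_def)
  qed (auto simp: U_def V_def)
  also have "(\<Sum>i\<in>U. real ((2*m) choose i)) = (\<Sum>k\<in>{k\<in>{1..m}. k * l \<le> m}. real ((2*m) choose (m + k * l)))"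
  proof (rule sum.reindex_bij_witness[of _ "\<lambda>k. m + k * l" "\<lambda>i. (i - m) div l"])
    fix i assume i: "i \<in> U"
    then obtain k where k: "int i - int m = int l * k" unfolding U_def by auto
    moreover have "int l * k > 0" using i k unfolding U_def by auto
    hence "k > 0" using l by (simp add: zero_less_mult_iff)
    then obtain k' where "k = int k'" "k' > 0" using zero_less_imp_eq_int by metis
    ultimately have "int i = int (m + l * k')" by simp
    hence ik: "i = m + l * k'" by linarith
    show "m + (i - m) div l * l = i" using ik l by simp
    have "l * k' \<le> m" using i ik by (simp add: U_def)
    moreover have "k' \<le> l * k'" using l by simp
    ultimately have "k' \<le> m" by linarith
    thus "(i - m) div l \<in> {k\<in>{1..m}. k * l \<le> m}" using ik l \<open>k' > 0\<close> \<open>l * k' \<le> m\<close> by (auto simp: mult_ac)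
    show "real ((2*m) choose (m + (i - m) div l * l)) = real ((2*m) choose i)" using ik l by (simp add: mult.commute)
  qed (use l in \<open>auto simp: U_def\<close>)
  also have "\<dots> = (\<Sum>k=1..m. real ((2*m) choose (m + k * l)))"
    by (rule sum.mono_neutral_left) (auto simp: binomial_eq_0)
  finally show ?thesis by simp
qed

text \<open>For odd l the reflection j -> l - j has no fixed point among 1, ..., l - 1, so the sum
  is twice its half with j <= h, where all angles stay below pi / 2.\<close>

lemma sum_cos_power_fold:
  assumes l: "l = 2 * h + 1"
  shows "(\<Sum>j<l. (cos (pi * real j / real l)) ^ (2 * m)) = 1 + 2 * (\<Sum>j=1..h. (cos (pi * real j / real l)) ^ (2 * m))"
proof -
  define f where "f = (\<lambda>j::nat. (cos (pi * real j / real l)) ^ (2 * m))"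
  have "{..<l} = insert 0 ({1..h} \<union> {h+1..2*h})" unfolding l by auto
  hence "(\<Sum>j<l. f j) = (\<Sum>j\<in>insert 0 ({1..h} \<union> {h+1..2*h}). f j)" by simp
  also have "\<dots> = f 0 + (\<Sum>j\<in>{1..h} \<union> {h+1..2*h}. f j)" by (rule sum.insert) auto
  also have "(\<Sum>j\<in>{1..h} \<union> {h+1..2*h}. f j) = (\<Sum>j\<in>{1..h}. f j) + (\<Sum>j\<in>{h+1..2*h}. f j)"
    by (rule sum.union_disjoint) auto
  also have "(\<Sum>j\<in>{h+1..2*h}. f j) = (\<Sum>j\<in>{1..h}. f j)"
  proof (rule sum.reindex_bij_witness[of _ "\<lambda>j. l - j" "\<lambda>j. l - j"])
    fix j assume "j \<in> {h+1..2*h}"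
    hence j: "j \<le> l" by (auto simp: l)
    have "pi * real (l - j) / real l = pi - pi * real j / real l"
      using j by (simp add: l of_nat_diff field_simps)
    thus "f (l - j) = f j" unfolding f_def by (simp add: power_mult)
  qed (auto simp: l)
  also have "f 0 = 1" by (simp add: f_def)
  finally show ?thesis by (simp add: f_def)
qed

text \<open>A finite form of the theta functional equation: for m about t l^2 and l tending to
  infinity, the cosine powers tend to exp (- pi^2 j^2 t) and the binomial coefficients, divided by
  the central one, to exp (- k^2 / t).\<close>

lemma polya_identity:
  assumes l: "l = 2 * h + 1"
  shows "1 + 2 * (\<Sum>j=1..h. (cos (pi * real j / real l)) ^ (2 * m)) =
     real l / 4 ^ m * (real ((2*m) choose m) + 2 * (\<Sum>k=1..m. real ((2*m) choose (m + k * l))))"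
proof -
  have l0: "l > 0" by (simp add: l)
  have "4 ^ m * (\<Sum>j<l. (cos (pi * real j / real l)) ^ (2 * m)) = (\<Sum>j<l. (2 * cos (pi * real j / real l)) ^ (2 * m))"
    by (simp add: power_mult_distrib sum_distrib_left power_mult)
  also have "\<dots> = real l * (real ((2*m) choose m) + 2 * (\<Sum>k=1..m. real ((2*m) choose (m + k * l))))"
    unfolding sum_cos_power[OF l0] sum_choose_multiples[OF l0] ..
  finally show ?thesis unfolding sum_cos_power_fold[OF l] by (simp add: field_simps)
qed

section \<open>Gaussian approximation of binomial coefficients\<close>

lemma binomial_ratio_step:
  assumes "d < m"
  shows "real ((2*m) choose (m + Suc d)) = real ((2*m) choose (m + d)) * ((real m - real d) / (real m + real d + 1))"
proof -
  have "Suc (m + d) * ((2*m) choose Suc (m + d)) = (2 * m - (m + d)) * ((2*m) choose (m + d))"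
    by (metis binomial_absorb_comp binomial_absorption mult.commute)
  hence "real (Suc (m + d)) * real ((2*m) choose Suc (m + d)) = real (2 * m - (m + d)) * real ((2*m) choose (m + d))"
    by (metis of_nat_mult)
  moreover have "real (2 * m - (m + d)) = real m - real d" using assms by (simp add: of_nat_diff)
  ultimately show ?thesis by (simp add: field_simps)
qed

text \<open>The coefficient is reached from the central one through the ratios 1 - (2 d + 1)/(m + d
  + 1) <= exp (- (2 d + 1)/(m + e)), and the odd numbers add up to a square. The fixed
  \<open>e\<close> gives all factors a common denominator.\<close>

lemma binomial_ratio_upper:
  assumes "d \<le> e" "e \<le> m"
  shows "real ((2*m) choose (m + d)) \<le> real ((2*m) choose m) * exp (- (real d)\<^sup>2 / (real m + real e))"
  using assms(1)
proof (induction d)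
  case (Suc d)
  have *: "(real m - real d) / (real m + real d + 1) \<le> exp (- (2 * real d + 1) / (real m + real e))"
  proof -
    have "(real m - real d) / (real m + real d + 1) = 1 + - ((2 * real d + 1) / (real m + real d + 1))"
      by (simp add: field_simps)
    also have "\<dots> \<le> exp (- ((2 * real d + 1) / (real m + real d + 1)))" by (rule exp_ge_add_one_self)
    also have "\<dots> \<le> exp (- ((2 * real d + 1) / (real m + real e)))"
      using Suc assms by (simp) (intro divide_left_mono mult_pos_pos, auto)
    finally show ?thesis by (simp only: minus_divide_left)
  qed
  have "real ((2*m) choose (m + Suc d)) = real ((2*m) choose (m + d)) * ((real m - real d) / (real m + real d + 1))"
    using Suc assms by (intro binomial_ratio_step) auto
  also have "\<dots> \<le> (real ((2*m) choose m) * exp (- (real d)\<^sup>2 / (real m + real e))) * exp (- (2 * real d + 1) / (real m + real e))"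
    using Suc assms * by (intro mult_mono) auto
  also have "\<dots> = real ((2*m) choose m) * exp (- (real d)\<^sup>2 / (real m + real e) + - (2 * real d + 1) / (real m + real e))"
    by (simp only: exp_add mult.assoc)
  also have "- (real d)\<^sup>2 / (real m + real e) + - (2 * real d + 1) / (real m + real e) = - (real (Suc d))\<^sup>2 / (real m + real e)"
    by (simp add: add_divide_distrib[symmetric] power2_eq_square algebra_simps)
  finally show ?case .
qed auto

text \<open>The inequality 1 + x <= exp x is applied to the reciprocal ratios 1 + (2 d + 1)/(m - d).
  In each step d is at most e - 1, so m - d is at least m - e + 1; this is the origin of the extra
  1.\<close>

lemma binomial_ratio_lower:
  assumes "d \<le> e" "e \<le> m"
  shows "real ((2*m) choose (m + d)) \<ge> real ((2*m) choose m) * exp (- (real d)\<^sup>2 / (real m - real e + 1))"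
  using assms(1)
proof (induction d)
  case (Suc d)
  have *: "(real m - real d) / (real m + real d + 1) \<ge> exp (- (2 * real d + 1) / (real m - real e + 1))"
  proof -
    have "(real m + real d + 1) / (real m - real d) = 1 + (2 * real d + 1) / (real m - real d)"
      using Suc assms by (simp add: field_simps)
    also have "\<dots> \<le> exp ((2 * real d + 1) / (real m - real d))" by (rule exp_ge_add_one_self)
    also have "\<dots> \<le> exp ((2 * real d + 1) / (real m - real e + 1))"
      using Suc assms by (simp) (intro divide_left_mono mult_pos_pos, auto)
    finally have "inverse (exp ((2 * real d + 1) / (real m - real e + 1))) \<le> inverse ((real m + real d + 1) / (real m - real d))"
      using Suc assms by (intro le_imp_inverse_le) auto
    thus ?thesis by (simp only: exp_minus minus_divide_left[symmetric] inverse_divide)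
  qed
  have "real ((2*m) choose m) * exp (- (real (Suc d))\<^sup>2 / (real m - real e + 1)) =
      real ((2*m) choose m) * exp (- (real d)\<^sup>2 / (real m - real e + 1) + - (2 * real d + 1) / (real m - real e + 1))"
    by (simp add: add_divide_distrib[symmetric] power2_eq_square algebra_simps)
  also have "\<dots> = (real ((2*m) choose m) * exp (- (real d)\<^sup>2 / (real m - real e + 1))) * exp (- (2 * real d + 1) / (real m - real e + 1))"
    by (simp only: exp_add mult.assoc)
  also have "\<dots> \<le> real ((2*m) choose (m + d)) * ((real m - real d) / (real m + real d + 1))"
    using Suc assms * by (intro mult_mono) auto
  also have "\<dots> = real ((2*m) choose (m + Suc d))"
    using Suc assms by (intro binomial_ratio_step[symmetric]) auto
  finally show ?case .
qed auto

text \<open>The scaled sequence increases by comparison of consecutive ratios, and is bounded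
  because (2 m + 1) (a m)^2 decreases from 1. Its limit is 1 / sqrt pi, but only positivity is
  recorded, and the constant stays implicit in all that follows.\<close>

lemma central_binomial_limit:
  "\<exists>K>0. (\<lambda>m. sqrt (real m) * real ((2*m) choose m) / 4 ^ m) \<longlonglongrightarrow> K"
proof -
  define a where "a = (\<lambda>m. real ((2*m) choose m) / 4 ^ m)"
  have step: "a (Suc m) = a m * ((2 * real m + 1) / (2 * real m + 2))" for m
  proof -
    have "Suc m * ((2 * Suc m) choose Suc m) = (2 * Suc m) * ((2 * m + 1) choose m)"
    proof -
      have e: "2 * Suc m = Suc (2 * m + 1)" by simp
      show ?thesis unfolding e using Suc_times_binomial_eq[of "2 * m + 1" m] by (simp only: mult.commute)
    qed
    moreover have "Suc m * ((2 * m + 1) choose m) = (2 * m + 1) * ((2 * m) choose m)"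
    proof -
      have "2 * m + 1 - m = Suc m" "2 * m + 1 - 1 = 2 * m" by simp_all
      thus ?thesis using binomial_absorb_comp[of "2 * m + 1" m] by (simp only:)
    qed
    ultimately have "Suc m * (Suc m * ((2 * Suc m) choose Suc m)) = (2 * Suc m) * ((2 * m + 1) * ((2 * m) choose m))"
      by (metis mult.left_commute)
    hence "real (Suc m) * (real (Suc m) * real ((2 * Suc m) choose Suc m)) = (2 * real (Suc m)) * ((2 * real m + 1) * real ((2 * m) choose m))"
      by (metis (no_types, opaque_lifting) of_nat_1 of_nat_add of_nat_mult of_nat_numeral)
    hence "real (Suc m) * real ((2 * Suc m) choose Suc m) = 2 * ((2 * real m + 1) * real ((2 * m) choose m))"
      by (metis (no_types, opaque_lifting) mult.assoc mult.left_commute mult_cancel_left of_nat_0 of_nat_eq_iff nat.distinct(1))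
    moreover define X Y where "X = real ((2 * Suc m) choose Suc m)" and "Y = real ((2 * m) choose m)"
    ultimately have X: "X = 2 * ((2 * real m + 1) * Y) / real (Suc m)" by (simp only:) (simp add: field_simps)
    have a: "a (Suc m) = X / (4 * 4 ^ m)" "a m = Y / 4 ^ m" by (simp_all only: a_def X_def Y_def power_Suc)
    have "2 * real m + 2 = 2 * real (Suc m)" by simp
    moreover have "2 * (z * Y) / S / (4 * P) = Y / P * (z / (2 * S))" for z S P :: real by simp
    ultimately show ?thesis unfolding a X by (simp only:)
  qed
  have apos: "a m > 0" for m unfolding a_def by simp
  define b where "b = (\<lambda>m. sqrt (real m) * a m)"
  have inc: "incseq b"
  proof (rule incseq_SucI)
    fix m
    have "sqrt (real m) \<le> sqrt (real (Suc m)) * ((2 * real m + 1) / (2 * real m + 2))"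
    proof (rule power2_le_imp_le)
      have "real m * (2 * real m + 2)^2 \<le> real (Suc m) * (2 * real m + 1)^2"
        by (simp add: power2_eq_square algebra_simps)
      hence "real m \<le> real (Suc m) * ((2 * real m + 1)^2 / (2 * real m + 2)^2)"
        by (simp add: field_simps)
      thus "(sqrt (real m))\<^sup>2 \<le> (sqrt (real (Suc m)) * ((2 * real m + 1) / (2 * real m + 2)))\<^sup>2"
        by (simp only: power_mult_distrib power_divide real_sqrt_pow2 of_nat_0_le_iff)
    qed simp
    hence "sqrt (real m) * a m \<le> sqrt (real (Suc m)) * ((2 * real m + 1) / (2 * real m + 2)) * a m"
      using apos[of m] by (intro mult_right_mono) auto
    thus "b m \<le> b (Suc m)" unfolding b_def step by (simp add: mult_ac)
  qed
  have bd: "(2 * real m + 1) * (a m)^2 \<le> 1" for m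
  proof (induction m)
    case (Suc m)
    have "(2 * real (Suc m) + 1) * (a (Suc m))^2 = ((2 * real m + 3) * (2 * real m + 1) / (2 * real m + 2)^2) * ((2 * real m + 1) * (a m)^2)"
      unfolding step by (simp add: power2_eq_square field_simps)
    also have "\<dots> \<le> 1 * 1"
    proof (rule mult_mono[OF _ Suc.IH])
      show "(2 * real m + 3) * (2 * real m + 1) / (2 * real m + 2)^2 \<le> 1"
      proof -
        have "(2 * real m + 3) * (2 * real m + 1) \<le> 1 * (2 * real m + 2)^2"
          by (simp add: power2_eq_square algebra_simps)
        thus ?thesis by (subst pos_divide_le_eq) auto
      qed
    qed auto
    finally show ?case by simp
  qed (simp add: a_def)
  have "b m \<le> 1" for m
  proof -
    have "(b m)^2 = real m * (a m)^2" unfolding b_def by (simp add: power_mult_distrib)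
    also have "\<dots> \<le> (2 * real m + 1) * (a m)^2" by (intro mult_right_mono) auto
    also have "\<dots> \<le> 1\<^sup>2" using bd by simp
    finally show ?thesis by (rule power2_le_imp_le) simp
  qed
  then obtain K where K: "b \<longlonglongrightarrow> K" using incseq_convergent[OF inc, of 1] by blast
  have "b 1 \<le> K" using incseq_le[OF inc K] .
  moreover have "b 1 > 0" unfolding b_def using apos[of 1] by simp
  ultimately show ?thesis using K by (intro exI[of _ K]) (auto simp: b_def a_def)
qed


text \<open>Taylor expansion of order four with x^4 <= 4 x^2 on the interval: 1/3 = 1/2 - 4/24. The
  bound holds all the way up to pi / 2, as a summable majorant requires.\<close>

lemma cos_le_exp:
  assumes "0 \<le> x" "x \<le> pi / 2"
  shows "cos x \<le> exp (- x\<^sup>2 / 3)"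
proof -
  obtain u where u: "cos x = (\<Sum>m<4. cos_coeff m * x ^ m) + (cos (u + 1/2 * real 4 * pi) / fact 4) * x ^ 4"
    using Maclaurin_cos_expansion[of x 4] by auto
  have "(\<Sum>m<4. cos_coeff m * x ^ m) = 1 - x\<^sup>2 / 2"
  proof -
    have "{..<4::nat} = {0, 1, 2, 3}" by auto
    thus ?thesis by (simp add: cos_coeff_def)
  qed
  moreover have "(cos (u + 1/2 * real 4 * pi) / fact 4) * x ^ 4 \<le> 1 / 24 * x ^ 4"
    by (intro mult_right_mono) (auto simp: fact_numeral)
  moreover have "x ^ 4 \<le> 4 * x\<^sup>2"
  proof -
    have "x \<le> 2" using assms pi_less_4 by linarith
    hence "x\<^sup>2 \<le> 2\<^sup>2" using assms by (intro power_mono) auto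
    hence "x\<^sup>2 * x\<^sup>2 \<le> 4 * x\<^sup>2" by (intro mult_right_mono) auto
    thus ?thesis by (simp add: power_add[symmetric])
  qed
  ultimately have "cos x \<le> 1 + - x\<^sup>2 / 3" using u by linarith
  also have "\<dots> \<le> exp (- x\<^sup>2 / 3)" by (rule exp_ge_add_one_self)
  finally show ?thesis .
qed

section \<open>Passage to the limit in the finite identity\<close>

lemma tendsto_suminf_dominated:
  fixes a :: "nat \<Rightarrow> _ \<Rightarrow> 'a :: {real_normed_algebra, banach}"
  assumes "\<And>k. ((\<lambda>n. a k n) \<longlongrightarrow> b k) F" "\<forall>\<^sub>F n in F. \<forall>k. norm (a k n) \<le> M k" "summable M" "F \<noteq> bot"
  shows "((\<lambda>n. \<Sum>k. a k n) \<longlongrightarrow> suminf b) F"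
proof -
  have "\<forall>\<^sub>F (k, n) in at_top \<times>\<^sub>F F. norm (a k n) \<le> M k"
    unfolding eventually_prod_filter using assms(2)
    by (intro exI[of _ "\<lambda>_. True"] exI[of _ "\<lambda>n. \<forall>k. norm (a k n) \<le> M k"]) auto
  from tannerys_theorem[of a b F M, OF assms(1) this assms(3,4)] show ?thesis by blast
qed

lemma suminf_if_Suc_le:
  fixes f :: "nat \<Rightarrow> real"
  shows "(\<Sum>j. if Suc j \<le> h then f (Suc j) else 0) = (\<Sum>j=1..h. f j)"
proof -
  have "(\<Sum>j. if Suc j \<le> h then f (Suc j) else 0) = (\<Sum>j<h. if Suc j \<le> h then f (Suc j) else 0)"
    by (rule suminf_finite) auto
  also have "\<dots> = (\<Sum>j<h. f (Suc j))" by (intro sum.cong) auto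
  also have "\<dots> = (\<Sum>j=1..h. f j)" by (simp add: sum.atLeast1_atMost_eq)
  finally show ?thesis .
qed

text \<open>With l = 2 h + 1 and m about t l^2, both sides of \<open>polya_identity\<close> converge
  term by term under geometric majorants, so Tannery's theorem gives the limit; the prefactor l /
  4^m times the central binomial coefficient tends to K / sqrt t.\<close>

lemma theta_transformation:
  "\<exists>K>0. \<forall>t>0. 1 + 2 * (\<Sum>j. exp (- pi\<^sup>2 * (real (Suc j))\<^sup>2 * t)) =
                 K / sqrt t * (1 + 2 * (\<Sum>k. exp (- (real (Suc k))\<^sup>2 / t)))"
proof -
  obtain K where K: "K > 0" "(\<lambda>m. sqrt (real m) * real ((2*m) choose m) / 4 ^ m) \<longlonglongrightarrow> K"
    using central_binomial_limit by blast
  have "1 + 2 * (\<Sum>j. exp (- pi\<^sup>2 * (real (Suc j))\<^sup>2 * t)) = K / sqrt t * (1 + 2 * (\<Sum>k. exp (- (real (Suc k))\<^sup>2 / t)))"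
    if t: "t > 0" for t :: real
  proof -
    define l :: "nat \<Rightarrow> nat" where "l = (\<lambda>h. 2 * h + 1)"
    \<comment> \<open>The ceiling gives m >= t l^2, used in the majorant for the cosines, and m <= t
      l^2 + 1, used in the one for the binomial coefficients.\<close>
    define m :: "nat \<Rightarrow> nat" where "m = (\<lambda>h. nat \<lceil>t * (real (l h))\<^sup>2\<rceil>)"
    have l1: "real (l h) \<ge> 1" for h unfolding l_def by simp
    have m_ge: "t * (real (l h))\<^sup>2 \<le> real (m h)" for h unfolding m_def by linarith
    have m_le: "real (m h) \<le> t * (real (l h))\<^sup>2 + 1" for h
    proof -
      have "0 \<le> t * (real (l h))\<^sup>2" using t by simp
      thus ?thesis unfolding m_def by linarith
    qed
    have l_lim: "filterlim (\<lambda>h. real (l h)) at_top at_top" unfolding l_def by real_asymp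
    have m_lim: "filterlim m at_top at_top"
    proof -
      have "filterlim (\<lambda>h. t * (real (l h))\<^sup>2) at_top at_top" unfolding l_def using t by real_asymp
      hence "filterlim (\<lambda>h. real (m h)) at_top at_top"
        by (rule filterlim_at_top_mono) (use m_ge in auto)
      thus ?thesis using filterlim_sequentially_iff_filterlim_real by blast
    qed
    have ml2: "(\<lambda>h. real (m h) / (real (l h))\<^sup>2) \<longlonglongrightarrow> t"
    proof (rule tendsto_sandwich)
      show "\<forall>\<^sub>F h in sequentially. t \<le> real (m h) / (real (l h))\<^sup>2"
      proof (intro always_eventually allI)
        fix h show "t \<le> real (m h) / (real (l h))\<^sup>2" using m_ge[of h] l1[of h] by (simp add: pos_le_divide_eq)
      qed
      show "\<forall>\<^sub>F h in sequentially. real (m h) / (real (l h))\<^sup>2 \<le> t + 1 / (real (l h))\<^sup>2"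
      proof (intro always_eventually allI)
        fix h show "real (m h) / (real (l h))\<^sup>2 \<le> t + 1 / (real (l h))\<^sup>2" using m_le[of h] l1[of h] by (simp add: field_simps)
      qed
      show "(\<lambda>h. t + 1 / (real (l h))\<^sup>2) \<longlonglongrightarrow> t" unfolding l_def by real_asymp
    qed auto
    define a where "a = (\<lambda>j h. if Suc j \<le> h then cos (pi * real (Suc j) / real (l h)) ^ (2 * m h) else 0)"
    have A: "(\<lambda>h. suminf (\<lambda>j. a j h)) \<longlonglongrightarrow> (\<Sum>j. exp (- pi\<^sup>2 * (real (Suc j))\<^sup>2 * t))"
    proof -
      have lim: "(\<lambda>h. a j h) \<longlonglongrightarrow> exp (- pi\<^sup>2 * (real (Suc j))\<^sup>2 * t)" for j
      proof -
        define c where "c = pi * real (Suc j)"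
        \<comment> \<open>l^2 ln (cos (c / l)) tends to - c^2 / 2; multiplied by 2 m / l^2 it
          becomes the exponent.\<close>
        have "(\<lambda>h. 2 * (real (l h))\<^sup>2 * ln (cos (c / real (l h)))) \<longlonglongrightarrow> - (c * c)"
          unfolding l_def by real_asymp
        hence "(\<lambda>h. exp ((real (m h) / (real (l h))\<^sup>2) * (2 * (real (l h))\<^sup>2 * ln (cos (c / real (l h)))))) \<longlonglongrightarrow> exp (t * - (c * c))"
          by (intro tendsto_intros ml2)
        moreover have "\<forall>\<^sub>F h in sequentially. exp ((real (m h) / (real (l h))\<^sup>2) * (2 * (real (l h))\<^sup>2 * ln (cos (c / real (l h))))) = a j h"
          using eventually_ge_at_top[of "Suc j"]
        proof eventually_elim
          case (elim h)
          have "real (Suc j) / real (l h) < 1 / 2" using elim by (simp add: l_def field_simps)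
          from mult_strict_left_mono[OF this pi_gt_zero] have "c / real (l h) < pi / 2" by (simp add: c_def)
          moreover have "0 < c / real (l h)" using l1[of h] by (simp add: c_def)
          ultimately have pos: "cos (c / real (l h)) > 0" by (intro cos_gt_zero_pi) auto
          have "(real (m h) / (real (l h))\<^sup>2) * (2 * (real (l h))\<^sup>2 * ln (cos (c / real (l h)))) = real (2 * m h) * ln (cos (c / real (l h)))"
            using l1[of h] by simp
          hence "exp ((real (m h) / (real (l h))\<^sup>2) * (2 * (real (l h))\<^sup>2 * ln (cos (c / real (l h))))) = cos (c / real (l h)) ^ (2 * m h)"
            using pos by (simp only: exp_of_nat_mult exp_ln)
          thus ?case using elim by (simp add: a_def c_def)
        qed
        ultimately have "(\<lambda>h. a j h) \<longlonglongrightarrow> exp (t * - (c * c))" by (rule Lim_transform_eventually)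
        thus ?thesis by (simp add: c_def power2_eq_square mult_ac)
      qed
      \<comment> \<open>With j counted from 1, the exponent 2 m x^2 / 3 is at least (2/3) pi^2 t
        j^2, and pi >= 3 together with j <= j^2 leaves 6 t j.\<close>
      have bound: "norm (a j h) \<le> exp (- (6 * t)) ^ Suc j" for j h
      proof (cases "Suc j \<le> h")
        case True
        define x where "x = pi * real (Suc j) / real (l h)"
        have "real (Suc j) / real (l h) \<le> 1 / 2" using True by (simp add: l_def field_simps)
        from mult_left_mono[OF this, of pi] have x: "0 \<le> x" "x \<le> pi / 2" by (simp_all add: x_def)
        have c0: "cos x \<ge> 0" using x by (intro cos_ge_zero) auto
        have "a j h = cos x ^ (2 * m h)" using True by (simp add: a_def x_def)
        also have "\<dots> \<le> exp (- x\<^sup>2 / 3) ^ (2 * m h)" by (intro power_mono cos_le_exp x c0)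
        also have "\<dots> = exp (real (2 * m h) * (- x\<^sup>2 / 3))" by (simp only: exp_of_nat_mult)
        also have "\<dots> \<le> exp (real (Suc j) * (- (6 * t)))"
        proof -
          have "pi\<^sup>2 \<ge> 3\<^sup>2" using pi_gt3 by (intro power_mono) auto
          have "real (Suc j) * 1 \<le> real (Suc j) * real (Suc j)" by (intro mult_left_mono) auto
          hence "9 * t * real (Suc j) \<le> pi\<^sup>2 * t * (real (Suc j))\<^sup>2"
            using t \<open>pi\<^sup>2 \<ge> 3\<^sup>2\<close> by (intro mult_mono) (auto simp: power2_eq_square)
          also have "\<dots> = t * (real (l h))\<^sup>2 * x\<^sup>2" using l1[of h] by (simp add: x_def power_divide power_mult_distrib)
          also have "\<dots> \<le> real (m h) * x\<^sup>2" by (intro mult_right_mono m_ge) auto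
          finally show ?thesis by (simp add: algebra_simps)
        qed
        also have "\<dots> = exp (- (6 * t)) ^ Suc j" by (simp only: exp_of_nat_mult)
        finally show ?thesis using True c0 by (simp add: a_def x_def)
      qed (simp add: a_def)
      have "summable (\<lambda>j. exp (- (6 * t)) ^ Suc j)"
        using t by (intro summable_ignore_initial_segment[where k = 1, simplified] summable_geometric summable_mult) auto
      thus ?thesis
        by (intro tendsto_suminf_dominated[where M = "\<lambda>j. exp (- (6 * t)) ^ Suc j"] lim always_eventually allI bound) auto
    qed
    define b where "b = (\<lambda>k h. real ((2 * m h) choose (m h + Suc k * l h)) / real ((2 * m h) choose m h))"
    have B: "(\<lambda>h. suminf (\<lambda>k. b k h)) \<longlonglongrightarrow> (\<Sum>k. exp (- (real (Suc k))\<^sup>2 / t))"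
    proof -
      have lim: "(\<lambda>h. b k h) \<longlonglongrightarrow> exp (- (real (Suc k))\<^sup>2 / t)" for k
      proof -
        define d where "d = (\<lambda>h. Suc k * l h)"
        have ev: "\<forall>\<^sub>F h in sequentially. d h \<le> m h"
        proof -
          have "\<forall>\<^sub>F h in sequentially. real (Suc k) / t \<le> real (l h)" using l_lim by (simp add: filterlim_at_top)
          thus ?thesis
          proof eventually_elim
            case (elim h)
            hence "real (Suc k) \<le> t * real (l h)" using t by (simp add: field_simps)
            hence "real (Suc k) * real (l h) \<le> t * real (l h) * real (l h)" by (intro mult_right_mono) auto
            also have "\<dots> \<le> real (m h)" using m_ge[of h] by (simp add: power2_eq_square mult_ac)
            finally have "real (d h) \<le> real (m h)" unfolding d_def of_nat_mult .
            thus ?case by simp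
          qed
        qed
        have dl: "real (d h) = real (Suc k) * real (l h)" for h by (simp only: d_def of_nat_mult)
        have up: "(\<lambda>h. exp (- ((real (Suc k))\<^sup>2 / (real (m h) / (real (l h))\<^sup>2 + real (Suc k) / real (l h))))) \<longlonglongrightarrow> exp (- ((real (Suc k))\<^sup>2 / (t + 0)))"
          using t l_lim by (intro tendsto_intros ml2 tendsto_divide_0[OF tendsto_const] filterlim_at_top_imp_at_infinity) auto
        have lo: "(\<lambda>h. exp (- ((real (Suc k))\<^sup>2 / (real (m h) / (real (l h))\<^sup>2 - real (Suc k) / real (l h) + 1 / (real (l h))\<^sup>2)))) \<longlonglongrightarrow> exp (- ((real (Suc k))\<^sup>2 / (t - 0 + 0)))"
        proof -
          have "(\<lambda>h. 1 / (real (l h))\<^sup>2) \<longlonglongrightarrow> 0" unfolding l_def by real_asymp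
          thus ?thesis
            using t l_lim by (intro tendsto_intros ml2 tendsto_divide_0[OF tendsto_const] filterlim_at_top_imp_at_infinity) auto
        qed
        show ?thesis
        proof (rule tendsto_sandwich)
          show "\<forall>\<^sub>F h in sequentially. exp (- ((real (Suc k))\<^sup>2 / (real (m h) / (real (l h))\<^sup>2 - (real (Suc k)) / real (l h) + 1 / (real (l h))\<^sup>2))) \<le> b k h"
            using ev
          proof eventually_elim
            case (elim h)
            have l0: "real (l h) > 0" using l1[of h] by simp
            have "(real (Suc k))\<^sup>2 / (real (m h) / (real (l h))\<^sup>2 - (real (Suc k)) / real (l h) + 1 / (real (l h))\<^sup>2) =
                (real (d h))\<^sup>2 / (real (m h) - real (d h) + 1)"
            proof -
              have "real (m h) / (real (l h))\<^sup>2 - (real (Suc k)) / real (l h) + 1 / (real (l h))\<^sup>2 = (real (m h) - real (d h) + 1) / (real (l h))\<^sup>2"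
                using l0 by (simp add: dl power2_eq_square field_simps del: of_nat_Suc)
              thus ?thesis by (simp add: dl power_mult_distrib del: of_nat_Suc)
            qed
            thus ?case using binomial_ratio_lower[of "d h" "d h" "m h"] elim
              by (simp add: b_def d_def pos_le_divide_eq mult.commute del: of_nat_Suc mult_Suc)
          qed
          show "\<forall>\<^sub>F h in sequentially. b k h \<le> exp (- ((real (Suc k))\<^sup>2 / (real (m h) / (real (l h))\<^sup>2 + (real (Suc k)) / real (l h))))"
            using ev
          proof eventually_elim
            case (elim h)
            have l0: "real (l h) > 0" using l1[of h] by simp
            have "(real (Suc k))\<^sup>2 / (real (m h) / (real (l h))\<^sup>2 + (real (Suc k)) / real (l h)) =
                (real (d h))\<^sup>2 / (real (m h) + real (d h))"
            proof -
              have "real (m h) / (real (l h))\<^sup>2 + (real (Suc k)) / real (l h) = (real (m h) + real (d h)) / (real (l h))\<^sup>2"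
                using l0 by (simp add: dl power2_eq_square field_simps del: of_nat_Suc)
              thus ?thesis by (simp add: dl power_mult_distrib del: of_nat_Suc)
            qed
            thus ?case using binomial_ratio_upper[of "d h" "d h" "m h"] elim
              by (simp add: b_def d_def pos_divide_le_eq mult.commute del: of_nat_Suc mult_Suc)
          qed
          show "(\<lambda>h. exp (- ((real (Suc k))\<^sup>2 / (real (m h) / (real (l h))\<^sup>2 - (real (Suc k)) / real (l h) + 1 / (real (l h))\<^sup>2)))) \<longlonglongrightarrow> exp (- (real (Suc k))\<^sup>2 / t)"
            using lo by (simp del: of_nat_Suc)
          show "(\<lambda>h. exp (- ((real (Suc k))\<^sup>2 / (real (m h) / (real (l h))\<^sup>2 + (real (Suc k)) / real (l h))))) \<longlonglongrightarrow> exp (- (real (Suc k))\<^sup>2 / t)"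
            using up by (simp del: of_nat_Suc)
        qed
      qed
      \<comment> \<open>With k counted from 1, d = k l and m <= (t + 1) l^2 give d^2 / (2 m) >= k^2
        / (2 (t + 1)) >= k / (2 (t + 1)).\<close>
      have bound: "norm (b k h) \<le> exp (- 1 / (2 * (t + 1))) ^ Suc k" for k h
      proof (cases "Suc k * l h \<le> m h")
        case True
        define d where "d = Suc k * l h"
        have "b k h \<le> exp (- (real d)\<^sup>2 / (real (m h) + real (m h)))"
          using binomial_ratio_upper[of d "m h" "m h"] True by (simp add: b_def d_def pos_divide_le_eq mult.commute del: of_nat_Suc mult_Suc)
        also have "\<dots> \<le> exp (real (Suc k) * (- 1 / (2 * (t + 1))))"
        proof -
          have "1 \<le> (real (l h))\<^sup>2" using l1[of h] by simp
          hence mm: "real (m h) \<le> (t + 1) * (real (l h))\<^sup>2" using m_le[of h] by (simp add: algebra_simps)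
          have "d > 0" using l1[of h] by (simp add: d_def)
          hence m0: "real (m h) > 0" using True unfolding d_def by linarith
          have "real (Suc k) * 1 \<le> real (Suc k) * real (Suc k)" by (intro mult_left_mono) auto
          hence "real (Suc k) / (2 * (t + 1)) \<le> (real (Suc k))\<^sup>2 / (2 * (t + 1))"
            using t by (intro divide_right_mono) (auto simp: power2_eq_square)
          also have "\<dots> = (real d)\<^sup>2 / (2 * ((t + 1) * (real (l h))\<^sup>2))"
            using l1[of h] by (simp add: d_def power_mult_distrib del: of_nat_Suc mult_Suc)
          also have "\<dots> \<le> (real d)\<^sup>2 / (2 * real (m h))"
            using mm m0 t l1[of h] by (intro divide_left_mono mult_pos_pos) auto
          finally show ?thesis by simp
        qed
        also have "\<dots> = exp (- 1 / (2 * (t + 1))) ^ Suc k" by (simp only: exp_of_nat_mult)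
        finally show ?thesis by (simp add: b_def)
      qed (simp add: b_def binomial_eq_0)
      have "summable (\<lambda>k. exp (- 1 / (2 * (t + 1))) ^ Suc k)"
        using t by (intro summable_ignore_initial_segment[where k = 1, simplified] summable_geometric summable_mult) auto
      thus ?thesis
        by (intro tendsto_suminf_dominated[where M = "\<lambda>k. exp (- 1 / (2 * (t + 1))) ^ Suc k"] lim always_eventually allI bound) auto
    qed
    have C: "(\<lambda>h. real (l h) / 4 ^ m h * real ((2 * m h) choose m h)) \<longlonglongrightarrow> K / sqrt t"
    proof -
      \<comment> \<open>The prefactor is the normalised central binomial coefficient divided by sqrt
        (m / l^2).\<close>
      have "(\<lambda>h. (sqrt (real (m h)) * real ((2 * m h) choose m h) / 4 ^ m h) * inverse (sqrt (real (m h) / (real (l h))\<^sup>2))) \<longlonglongrightarrow> K * inverse (sqrt t)"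
        using t by (intro tendsto_intros ml2 filterlim_compose[OF K(2) m_lim]) auto
      moreover have "\<forall>\<^sub>F h in sequentially. (sqrt (real (m h)) * real ((2 * m h) choose m h) / 4 ^ m h) * inverse (sqrt (real (m h) / (real (l h))\<^sup>2))
           = real (l h) / 4 ^ m h * real ((2 * m h) choose m h)"
      proof (intro always_eventually allI)
        fix h
        have "real (m h) > 0" using m_ge[of h] t l1[of h] by (smt (verit) mult_pos_pos zero_less_power)
        thus "(sqrt (real (m h)) * real ((2 * m h) choose m h) / 4 ^ m h) * inverse (sqrt (real (m h) / (real (l h))\<^sup>2))
           = real (l h) / 4 ^ m h * real ((2 * m h) choose m h)" using l1[of h] by (simp add: real_sqrt_divide field_simps)
      qed
      ultimately have "(\<lambda>h. real (l h) / 4 ^ m h * real ((2 * m h) choose m h)) \<longlonglongrightarrow> K * inverse (sqrt t)"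
        by (rule Lim_transform_eventually)
      thus ?thesis by (simp add: divide_inverse)
    qed
    have eq: "1 + 2 * suminf (\<lambda>j. a j h) = (real (l h) / 4 ^ m h * real ((2 * m h) choose m h)) * (1 + 2 * suminf (\<lambda>k. b k h))" for h
    proof -
      have "suminf (\<lambda>j. a j h) = (\<Sum>j=1..h. cos (pi * real j / real (l h)) ^ (2 * m h))"
        unfolding a_def by (rule suminf_if_Suc_le)
      moreover have "suminf (\<lambda>k. b k h) = (\<Sum>k=1..m h. real ((2 * m h) choose (m h + k * l h)) / real ((2 * m h) choose m h))"
      proof -
        have "b k h = (if Suc k \<le> m h then real ((2 * m h) choose (m h + Suc k * l h)) / real ((2 * m h) choose m h) else 0)" for k
        proof (cases "Suc k \<le> m h")
          case False
          hence "m h < Suc k" by simp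
          also have "Suc k \<le> Suc k * l h" by (simp add: l_def)
          finally have "2 * m h < m h + Suc k * l h" by (simp only: mult_2 add_less_cancel_left)
          thus ?thesis using False by (simp add: b_def binomial_eq_0 del: mult_Suc)
        qed (simp add: b_def)
        thus ?thesis using suminf_if_Suc_le[of "m h" "\<lambda>k. real ((2 * m h) choose (m h + k * l h)) / real ((2 * m h) choose m h)"] by simp
      qed
      moreover have "real ((2 * m h) choose m h) > 0" by simp
      ultimately show ?thesis using polya_identity[of "l h" h "m h"]
        by (simp add: l_def[THEN fun_cong] sum_divide_distrib[symmetric] field_simps)
    qed
    have "(\<lambda>h. 1 + 2 * suminf (\<lambda>j. a j h)) \<longlonglongrightarrow> 1 + 2 * (\<Sum>j. exp (- pi\<^sup>2 * (real (Suc j))\<^sup>2 * t))"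
      by (intro tendsto_intros A)
    moreover have "(\<lambda>h. 1 + 2 * suminf (\<lambda>j. a j h)) \<longlonglongrightarrow> K / sqrt t * (1 + 2 * (\<Sum>k. exp (- (real (Suc k))\<^sup>2 / t)))"
      unfolding eq by (intro tendsto_intros B C)
    ultimately show ?thesis by (rule LIMSEQ_unique)
  qed
  thus ?thesis using K(1) by blast
qed

section \<open>Lattice sums\<close>

text \<open>Absolute summability allows grouping into spheres. The unordered form is kept because it
  is the one that can be matched with the product over primitive vectors.\<close>

lemma has_sum_lattice_radial:
  fixes g :: "nat \<Rightarrow> 'a :: {banach, real_normed_field}"
  assumes sm: "summable (\<lambda>n. real (rep \<nu> n) * norm (g n))"
  shows "((\<lambda>x. g (sq_norm \<nu> x)) has_sum (\<Sum>n. of_nat (rep \<nu> n) * g n)) (int_lattice \<nu>)"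
proof -
  let ?S = "\<lambda>n. {x \<in> int_lattice \<nu>. sq_norm \<nu> x = n}"
  have abs: "(\<lambda>x. norm (g (sq_norm \<nu> x))) summable_on int_lattice \<nu>"
  proof (rule nonneg_bdd_above_summable_on)
    show "bdd_above (sum (\<lambda>x. norm (g (sq_norm \<nu> x))) ` {F. F \<subseteq> int_lattice \<nu> \<and> finite F})"
    proof (rule bdd_aboveI2)
      fix F assume "F \<in> {F. F \<subseteq> int_lattice \<nu> \<and> finite F}"
      hence F: "F \<subseteq> int_lattice \<nu>" "finite F" by auto
      have "(\<Sum>x\<in>F. norm (g (sq_norm \<nu> x))) = (\<Sum>n\<in>sq_norm \<nu> ` F. \<Sum>x\<in>{x\<in>F. sq_norm \<nu> x = n}. norm (g (sq_norm \<nu> x)))"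
        using F(2) by (rule sum.image_gen)
      also have "\<dots> = (\<Sum>n\<in>sq_norm \<nu> ` F. real (card {x\<in>F. sq_norm \<nu> x = n}) * norm (g n))"
        by (intro sum.cong) auto
      also have "\<dots> \<le> (\<Sum>n\<in>sq_norm \<nu> ` F. real (rep \<nu> n) * norm (g n))"
        unfolding rep_def using F finite_sphere
        by (intro sum_mono mult_right_mono) (auto intro!: card_mono)
      also have "\<dots> \<le> (\<Sum>n. real (rep \<nu> n) * norm (g n))"
        using F by (intro sum_le_suminf sm) auto
      finally show "(\<Sum>x\<in>F. norm (g (sq_norm \<nu> x))) \<le> (\<Sum>n. real (rep \<nu> n) * norm (g n))" .
    qed
  qed auto
  have inj: "bij_betw snd (Sigma UNIV ?S) (int_lattice \<nu>)"
    by (rule bij_betwI[of _ _ _ "\<lambda>x. (sq_norm \<nu> x, x)"]) auto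
  have "((\<lambda>(n, x). g (sq_norm \<nu> x)) has_sum (\<Sum>n. of_nat (rep \<nu> n) * g n)) (Sigma UNIV ?S)"
  proof (rule has_sum_SigmaI)
    fix n :: nat
    have "(\<Sum>x\<in>?S n. g (sq_norm \<nu> x)) = of_nat (rep \<nu> n) * g n"
      unfolding rep_def by simp
    thus "((\<lambda>y. case (n, y) of (n, x) \<Rightarrow> g (sq_norm \<nu> x)) has_sum of_nat (rep \<nu> n) * g n) (?S n)"
      using has_sum_finite[OF finite_sphere, of "\<lambda>x. g (sq_norm \<nu> x)" \<nu> n] by (simp only: case_prod_conv)
  next
    have s: "summable (\<lambda>n. norm (of_nat (rep \<nu> n) * g n))" using sm by (simp add: norm_mult)
    show "((\<lambda>n. of_nat (rep \<nu> n) * g n) has_sum (\<Sum>n. of_nat (rep \<nu> n) * g n)) UNIV"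
      by (rule norm_summable_imp_has_sum[OF s summable_sums[OF summable_norm_cancel[OF s]]])
  next
    have "(\<lambda>x. g (sq_norm \<nu> x)) summable_on int_lattice \<nu>" using abs by (rule abs_summable_summable)
    hence "(\<lambda>p. g (sq_norm \<nu> (snd p))) summable_on Sigma UNIV ?S"
      by (subst summable_on_reindex_bij_betw[OF inj])
    thus "(\<lambda>(n, x). g (sq_norm \<nu> x)) summable_on Sigma UNIV ?S" by (simp add: case_prod_unfold)
  qed
  hence "((\<lambda>p. g (sq_norm \<nu> (snd p))) has_sum (\<Sum>n. of_nat (rep \<nu> n) * g n)) (Sigma UNIV ?S)"
    by (simp add: case_prod_unfold)
  thus "((\<lambda>x. g (sq_norm \<nu> x)) has_sum (\<Sum>n. of_nat (rep \<nu> n) * g n)) (int_lattice \<nu>)"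
    by (subst (asm) has_sum_reindex_bij_betw[OF inj])
qed

lemma summable_rep_exp_sqrt:
  assumes "\<nu> \<ge> 2" "s > 0"
  shows "summable (\<lambda>n. real (rep \<nu> n) * exp (- s * sqrt (real n)))"
proof -
  obtain C where C: "C > 0" "\<And>n. real (rep \<nu> n) \<le> C * (real n + 1) powr (real \<nu> / 2 - 2/3)"
    using rep_le[OF assms(1)] by auto
  have "summable (\<lambda>n. (real n + 1) powr real \<nu> * exp (- s * sqrt (real n)))"
  proof (rule summable_comparison_test_bigo)
    show "summable (\<lambda>n. norm (1 / real n ^ 2))" by (simp add: inverse_power_summable flip: inverse_eq_divide)
    show "(\<lambda>n. (real n + 1) powr real \<nu> * exp (- s * sqrt (real n))) \<in> O(\<lambda>n. 1 / real n ^ 2)"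
      using assms by real_asymp
  qed
  hence "summable (\<lambda>n. C * ((real n + 1) powr real \<nu> * exp (- s * sqrt (real n))))" by (rule summable_mult)
  thus ?thesis
  proof (rule summable_comparison_test')
    fix n :: nat
    have "(real n + 1) powr (real \<nu> / 2 - 2/3) \<le> (real n + 1) powr real \<nu>" by (intro powr_mono) auto
    hence "C * (real n + 1) powr (real \<nu> / 2 - 2/3) \<le> C * (real n + 1) powr real \<nu>" using C by simp
    with C(2)[of n] have "real (rep \<nu> n) \<le> C * (real n + 1) powr real \<nu>" by linarith
    hence "real (rep \<nu> n) * exp (- s * sqrt (real n)) \<le> C * (real n + 1) powr real \<nu> * exp (- s * sqrt (real n))"
      by (intro mult_right_mono) auto
    thus "norm (real (rep \<nu> n) * exp (- s * sqrt (real n))) \<le> C * ((real n + 1) powr real \<nu> * exp (- s * sqrt (real n)))"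
      by (simp add: mult.assoc)
  qed
qed

lemma summable_rep_exp:
  assumes "\<nu> \<ge> 2" "s > 0"
  shows "summable (\<lambda>n. real (rep \<nu> n) * exp (- s * real n))"
proof (rule summable_comparison_test'[OF summable_rep_exp_sqrt[OF assms]])
  fix n :: nat
  have "sqrt (real n) \<le> real n"
    by (cases "n = 0") (auto intro!: real_le_lsqrt simp: power2_eq_square)
  hence "exp (- s * real n) \<le> exp (- s * sqrt (real n))" using assms by simp
  thus "norm (real (rep \<nu> n) * exp (- s * real n)) \<le> real (rep \<nu> n) * exp (- s * sqrt (real n))"
    by (simp add: mult_left_mono)
qed

lemma has_sum_int_theta:
  fixes x :: real assumes x: "0 < x" "x < 1"
  shows "((\<lambda>k::int. x ^ nat (k\<^sup>2)) has_sum (1 + 2 * (\<Sum>k. x ^ ((Suc k)\<^sup>2)))) UNIV"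
proof -
  have sm: "summable (\<lambda>k. x ^ ((Suc k)\<^sup>2))"
  proof (rule summable_comparison_test'[OF summable_geometric[of x]])
    fix n :: nat
    have "n \<le> (Suc n)\<^sup>2" by (simp add: power2_eq_square)
    thus "norm (x ^ ((Suc n)\<^sup>2)) \<le> x ^ n" using x by (simp add: power_decreasing)
  qed (use x in auto)
  define S where "S = (\<Sum>k. x ^ ((Suc k)\<^sup>2))"
  have nat: "((\<lambda>k. x ^ ((Suc k)\<^sup>2)) has_sum S) UNIV" unfolding S_def
    by (rule norm_summable_imp_has_sum) (use x sm summable_sums[OF sm] in auto)
  have pos: "((\<lambda>k::int. x ^ nat (k\<^sup>2)) has_sum S) {0<..}"
    by (rule has_sum_reindex_bij_witness[THEN iffD1, OF _ _ _ _ _ _ nat, of "\<lambda>k. nat (k - 1)" "\<lambda>k. int (Suc k)"])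
       (auto simp: nat_power_eq simp del: of_nat_Suc)
  have neg: "((\<lambda>k::int. x ^ nat (k\<^sup>2)) has_sum S) {..<0}"
    by (rule has_sum_reindex_bij_witness[THEN iffD1, OF _ _ _ _ _ _ nat, of "\<lambda>k. nat (- k - 1)" "\<lambda>k. - int (Suc k)"])
       (auto simp: nat_power_eq simp del: of_nat_Suc)
  have z: "((\<lambda>k::int. x ^ nat (k\<^sup>2)) has_sum 1) {0}" using has_sum_finite[of "{0::int}" "\<lambda>k. x ^ nat (k\<^sup>2)"] by simp
  have "((\<lambda>k::int. x ^ nat (k\<^sup>2)) has_sum (1 + (S + S))) ({0} \<union> ({0<..} \<union> {..<0}))"
    by (intro has_sum_Un_disjoint z pos neg) auto
  moreover have "{0::int} \<union> ({0<..} \<union> {..<0}) = UNIV" by auto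
  ultimately show ?thesis by (simp add: S_def)
qed

text \<open>A power of x with exponent |z|^2 is a product over the coordinates, so the induction can
  split off the last coordinate as an independent factor.\<close>

lemma has_sum_lattice_theta:
  fixes x :: real assumes x: "0 < x" "x < 1"
  shows "((\<lambda>z. x ^ sq_norm \<nu> z) has_sum (1 + 2 * (\<Sum>k. x ^ ((Suc k)\<^sup>2))) ^ \<nu>) (int_lattice \<nu>)"
proof (induction \<nu>)
  case 0
  have "int_lattice 0 = {\<lambda>_. 0}" by (auto simp: int_lattice_def)
  thus ?case using has_sum_finite[of "{\<lambda>_::nat. 0::int}" "\<lambda>z. x ^ sq_norm 0 z"] by (simp add: sq_norm_def)
next
  case (Suc \<nu>)
  define T where "T = 1 + 2 * (\<Sum>k. x ^ ((Suc k)\<^sup>2))"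
  have inner: "((\<lambda>z. x ^ nat (k\<^sup>2) * x ^ sq_norm \<nu> z) has_sum x ^ nat (k\<^sup>2) * T ^ \<nu>) (int_lattice \<nu>)" for k :: int
    using has_sum_cmult_right[OF Suc.IH] by (simp add: T_def)
  have outer: "((\<lambda>k::int. x ^ nat (k\<^sup>2) * T ^ \<nu>) has_sum T * T ^ \<nu>) UNIV"
    using has_sum_cmult_left[OF has_sum_int_theta[OF x]] by (simp add: T_def)
  have "((\<lambda>(k, z). x ^ nat (k\<^sup>2) * x ^ sq_norm \<nu> z) has_sum T * T ^ \<nu>) (UNIV \<times> int_lattice \<nu>)"
  proof (rule has_sum_SigmaI)
    show "(\<lambda>(k::int, z). x ^ nat (k\<^sup>2) * x ^ sq_norm \<nu> z) summable_on UNIV \<times> int_lattice \<nu>"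
      by (rule summable_on_SigmaI[where g = "\<lambda>k. x ^ nat (k\<^sup>2) * T ^ \<nu>"])
         (use inner outer x in \<open>auto simp: summable_on_def\<close>)
  qed (use inner outer in auto)
  moreover have "((\<lambda>(k, z). x ^ nat (k\<^sup>2) * x ^ sq_norm \<nu> z) has_sum T * T ^ \<nu>) (UNIV \<times> int_lattice \<nu>) \<longleftrightarrow>
      ((\<lambda>z. x ^ sq_norm (Suc \<nu>) z) has_sum T * T ^ \<nu>) (int_lattice (Suc \<nu>))"
  proof (rule has_sum_reindex_bij_witness[of _ "\<lambda>z. (z \<nu>, z(\<nu> := 0))" "\<lambda>(k, z). z(\<nu> := k)"])
    fix a :: "int \<times> (nat \<Rightarrow> int)" assume "a \<in> UNIV \<times> int_lattice \<nu>"
    then obtain k z where a: "a = (k, z)" "z \<in> int_lattice \<nu>" by auto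
    have "(\<Sum>i<\<nu>. ((z(\<nu> := k)) i)\<^sup>2) = (\<Sum>i<\<nu>. (z i)\<^sup>2)" by (intro sum.cong) auto
    hence "sq_norm (Suc \<nu>) (z(\<nu> := k)) = nat (k\<^sup>2) + sq_norm \<nu> z"
      by (simp add: sq_norm_def nat_add_distrib sum_nonneg)
    thus "x ^ sq_norm (Suc \<nu>) (case a of (k, z) \<Rightarrow> z(\<nu> := k)) = (case a of (k, z) \<Rightarrow> x ^ nat (k\<^sup>2) * x ^ sq_norm \<nu> z)"
      using a by (simp add: power_add)
    show "(\<lambda>z. (z \<nu>, z(\<nu> := 0))) (case a of (k, z) \<Rightarrow> z(\<nu> := k)) = a" using a by (auto simp: int_lattice_def)
  qed (auto simp: int_lattice_def)
  ultimately show ?case by (simp add: T_def)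
qed

lemma suminf_rep_eq_theta:
  assumes "\<nu> \<ge> 2" "a > 0"
  shows "(\<Sum>n. real (rep \<nu> n) * exp (- a * real n)) = (1 + 2 * (\<Sum>k. exp (- a * (real (Suc k))\<^sup>2))) ^ \<nu>"
proof -
  have "((\<lambda>x. exp (- a * real (sq_norm \<nu> x))) has_sum (\<Sum>n. real (rep \<nu> n) * exp (- a * real n))) (int_lattice \<nu>)"
    by (rule has_sum_lattice_radial[where g = "\<lambda>n. exp (- a * real n)"]) (use summable_rep_exp[OF assms] in simp)
  moreover have "exp (- a * real n) = exp (- a) ^ n" for n
    by (simp only: exp_of_nat_mult[symmetric] mult.commute)
  moreover have "((\<lambda>z. exp (-a) ^ sq_norm \<nu> z) has_sum (1 + 2 * (\<Sum>k. exp (-a) ^ ((Suc k)\<^sup>2))) ^ \<nu>) (int_lattice \<nu>)"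
    by (rule has_sum_lattice_theta) (use assms in auto)
  moreover have "exp (-a) ^ ((Suc k)\<^sup>2) = exp (- a * (real (Suc k))\<^sup>2)" for k
    by (simp only: exp_of_nat_mult[symmetric] mult.commute of_nat_power)
  ultimately show ?thesis using has_sum_unique by fastforce
qed

text \<open>The power with exponent nu of the one-dimensional formula at t = w^2; the parameter w
  becomes the integration variable of \<open>subordination\<close>.\<close>

lemma lattice_theta_transformation:
  assumes "\<nu> \<ge> 2"
  shows "\<exists>K>0. \<forall>w>0. (\<Sum>n. real (rep \<nu> n) * exp (- real n / w\<^sup>2)) =
           (w / K) ^ \<nu> * (\<Sum>n. real (rep \<nu> n) * exp (- (pi\<^sup>2 * w\<^sup>2) * real n))"
proof -
  obtain K where K: "K > 0" and T: "\<And>t. t > 0 \<Longrightarrow> 1 + 2 * (\<Sum>j. exp (- pi\<^sup>2 * (real (Suc j))\<^sup>2 * t)) =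
                 K / sqrt t * (1 + 2 * (\<Sum>k. exp (- (real (Suc k))\<^sup>2 / t)))"
    using theta_transformation by blast
  have "(\<Sum>n. real (rep \<nu> n) * exp (- real n / w\<^sup>2)) =
           (w / K) ^ \<nu> * (\<Sum>n. real (rep \<nu> n) * exp (- (pi\<^sup>2 * w\<^sup>2) * real n))" if w: "w > 0" for w :: real
  proof -
    have "(\<Sum>n. real (rep \<nu> n) * exp (- (1 / w\<^sup>2) * real n)) = (1 + 2 * (\<Sum>k. exp (- (1 / w\<^sup>2) * (real (Suc k))\<^sup>2))) ^ \<nu>"
      by (rule suminf_rep_eq_theta) (use assms w in auto)
    moreover have "(\<Sum>n. real (rep \<nu> n) * exp (- (pi\<^sup>2 * w\<^sup>2) * real n)) = (1 + 2 * (\<Sum>k. exp (- (pi\<^sup>2 * w\<^sup>2) * (real (Suc k))\<^sup>2))) ^ \<nu>"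
      by (rule suminf_rep_eq_theta) (use assms w in auto)
    moreover have "1 + 2 * (\<Sum>k. exp (- (pi\<^sup>2 * w\<^sup>2) * (real (Suc k))\<^sup>2)) = K / w * (1 + 2 * (\<Sum>k. exp (- (1 / w\<^sup>2) * (real (Suc k))\<^sup>2)))"
      using T[of "w\<^sup>2"] w by (simp add: mult_ac)
    hence "1 + 2 * (\<Sum>k. exp (- (1 / w\<^sup>2) * (real (Suc k))\<^sup>2)) = w / K * (1 + 2 * (\<Sum>k. exp (- (pi\<^sup>2 * w\<^sup>2) * (real (Suc k))\<^sup>2)))"
      using w K by (simp only:) simp
    ultimately show ?thesis by (simp only: power_mult_distrib) simp
  qed
  thus ?thesis using K by blast
qed

section \<open>Poisson summation for \<open>exp (- s |x|)\<close>\<close>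

text \<open>The odd primitive increases, and it is bounded because E x + exp (- x) decreases for x
  >= 1. The value of the Gaussian integral is left open; L > 0 is all that is carried along.\<close>

lemma gaussian_antiderivative:
  "\<exists>(E :: real \<Rightarrow> real) L. (\<forall>x. (E has_real_derivative exp (- x\<^sup>2)) (at x)) \<and>
     (\<forall>x. E (-x) = - E x) \<and> (E \<longlongrightarrow> L) at_top \<and> L > 0"
proof -
  have "\<exists>F. \<forall>x::real. (-\<infinity>::ereal) < ereal x \<longrightarrow> ereal x < \<infinity> \<longrightarrow> (F has_vector_derivative exp (- x\<^sup>2)) (at x)"
    by (rule einterval_antiderivative) (auto intro!: continuous_intros)
  then obtain F where F: "\<And>x::real. (F has_real_derivative exp (- x\<^sup>2)) (at x)"
    by (auto simp: has_real_derivative_iff_has_vector_derivative)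
  define E where "E = (\<lambda>x. (F x - F (-x)) / 2)"
  have dE: "(E has_real_derivative exp (- x\<^sup>2)) (at x)" for x
    unfolding E_def by (auto intro!: derivative_eq_intros F[THEN DERIV_chain2] F)
  have E0: "E 0 = 0" by (simp add: E_def)
  have mono: "E x \<le> E y" if "x \<le> y" for x y
    by (rule DERIV_nonneg_imp_nondecreasing[OF that]) (use dE in \<open>auto intro!: exI\<close>)
  have smono: "E x < E y" if "x < y" for x y
    by (rule DERIV_pos_imp_increasing[OF that]) (use dE in \<open>auto intro!: exI\<close>)
  have bd: "E x \<le> E 1 + exp (-1)" for x
  proof (cases "x \<le> 1")
    case True
    thus ?thesis using mono[OF True] by (smt (verit) exp_ge_zero)
  next
    case False
    have "E x + exp (- x) \<le> E 1 + exp (-1)"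
    proof (rule DERIV_nonpos_imp_nonincreasing[of 1 x "\<lambda>x. E x + exp (- x)"])
      fix y :: real assume y: "1 \<le> y" "y \<le> x"
      have "y * 1 \<le> y\<^sup>2" using y unfolding power2_eq_square by (intro mult_left_mono) auto
      hence "exp (- y\<^sup>2) - exp (- y) \<le> 0" by simp
      moreover have "((\<lambda>x. E x + exp (- x)) has_real_derivative exp (- y\<^sup>2) - exp (- y)) (at y)"
        by (auto intro!: derivative_eq_intros dE)
      ultimately show "\<exists>z. ((\<lambda>x. E x + exp (- x)) has_real_derivative z) (at y) \<and> z \<le> 0" by blast
    qed (use False in simp)
    thus ?thesis by (smt (verit) exp_ge_zero)
  qed
  define L where "L = Sup (range E)"
  have bdd: "bdd_above (range E)" using bd by (auto intro!: bdd_aboveI)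
  have "(E \<longlongrightarrow> L) at_top"
  proof (rule increasing_tendsto)
    show "\<forall>\<^sub>F x in at_top. E x \<le> L" unfolding L_def by (intro always_eventually allI cSup_upper bdd) auto
    fix l assume "l < L"
    then obtain x0 where x0: "l < E x0" unfolding L_def using bdd by (auto simp: less_cSup_iff)
    show "\<forall>\<^sub>F x in at_top. l < E x"
      using eventually_ge_at_top[of x0] by eventually_elim (use mono x0 in \<open>meson less_le_trans\<close>)
  qed
  moreover have "E 1 \<le> L" unfolding L_def by (intro cSup_upper bdd) auto
  hence "L > 0" using smono[of 0 1] E0 by simp
  moreover have "E (-x) = - E x" for x by (simp add: E_def field_simps)
  ultimately show ?thesis using dE by blast
qed

text \<open>Writes exp (- s a) as a mixture over w of the Gaussians exp (- (a / w)^2), to which the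
  theta transformation applies. Nonnegative integrals let sums and integrals be exchanged
  freely.\<close>

lemma subordination:
  "\<exists>c>0. \<forall>s>0. \<forall>a\<ge>0. (\<integral>\<^sup>+w. ennreal (indicator {0<..} w * (s * exp (- (s * w / 2)\<^sup>2 - (a / w)\<^sup>2))) \<partial>lborel) = ennreal (c * exp (- s * a))"
proof -
  obtain E L where E: "\<And>x. (E has_real_derivative exp (- x\<^sup>2)) (at x)" "\<And>x. E (-x) = - E x" "(E \<longlongrightarrow> L) at_top" "L > 0"
    using gaussian_antiderivative by blast
  have Ebot: "(E \<longlongrightarrow> - L) at_bot"
  proof -
    have "((\<lambda>x. - E (- x)) \<longlongrightarrow> - L) at_bot"
      by (intro tendsto_minus filterlim_compose[OF E(3)] filterlim_uminus_at_top_at_bot)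
    thus ?thesis by (simp add: E(2))
  qed
  have contE: "isCont E x" for x using E(1) DERIV_isCont by blast
  have E0: "E 0 = 0" using E(2)[of 0] by simp
  have "(\<integral>\<^sup>+w. ennreal (indicator {0<..} w * (s * exp (- (s * w / 2)\<^sup>2 - (a / w)\<^sup>2))) \<partial>lborel) = ennreal (2 * L * exp (- s * a))"
    if s: "s > 0" and a: "a \<ge> 0" for s a :: real
  proof -
    define f where "f = (\<lambda>w. s * exp (- (s * w / 2)\<^sup>2 - (a / w)\<^sup>2))"
    \<comment> \<open>Completing the square: (s w / 2 - a / w)^2 and (s w / 2 + a / w)^2 differ from
      (s w / 2)^2 + (a / w)^2 by - s a and + s a. The weights exp (- s a) and exp (s a) compensate
      for this, and the contributions a / w^2 of the two inner derivatives cancel.\<close>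
    define F where "F = (\<lambda>w. exp (- s * a) * E (s * w / 2 - a / w) + exp (s * a) * E (s * w / 2 + a / w))"
    have top: "(F \<longlongrightarrow> exp (- s * a) * L + exp (s * a) * L) at_top"
    proof -
      have "filterlim (\<lambda>w::real. s * w / 2 - a / w) at_top at_top" "filterlim (\<lambda>w::real. s * w / 2 + a / w) at_top at_top"
        using s by real_asymp+
      thus ?thesis unfolding F_def by (intro tendsto_intros filterlim_compose[OF E(3)])
    qed
    \<comment> \<open>For a = 0 the arguments of \<open>E\<close> tend to 0 instead of diverging,
      yet the limit obeys the same formula, both sides being 0.\<close>
    have zero: "(F \<longlongrightarrow> exp (s * a) * L - exp (- s * a) * L) (at_right 0)"
    proof (cases "a = 0")
      case True
      have "((\<lambda>w. E (s * w / 2)) \<longlongrightarrow> E (s * 0 / 2)) (at_right 0)"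
        by (intro isCont_tendsto_compose[OF contE]) (auto intro!: tendsto_eq_intros)
      hence "((\<lambda>w. E (s * w / 2) + E (s * w / 2)) \<longlongrightarrow> 0 + 0) (at_right 0)" using E0 by (intro tendsto_add) auto
      thus ?thesis using True by (simp add: F_def)
    next
      case False
      hence "filterlim (\<lambda>w::real. s * w / 2 - a / w) at_bot (at_right 0)" "filterlim (\<lambda>w::real. s * w / 2 + a / w) at_top (at_right 0)"
        using s a by real_asymp+
      hence "(F \<longlongrightarrow> exp (- s * a) * (- L) + exp (s * a) * L) (at_right 0)"
        unfolding F_def by (intro tendsto_intros filterlim_compose[OF E(3)] filterlim_compose[OF Ebot])
      thus ?thesis by (simp add: algebra_simps)
    qed
    have dF: "(F has_real_derivative f w) (at w)" if w: "w > 0" for w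
    proof -
      have "((\<lambda>w. s * w / 2 - a / w) has_real_derivative (s / 2 + a / w\<^sup>2)) (at w)"
        "((\<lambda>w. s * w / 2 + a / w) has_real_derivative (s / 2 - a / w\<^sup>2)) (at w)"
        using w by (auto intro!: derivative_eq_intros simp: power2_eq_square)
      hence "(F has_real_derivative exp (- s * a) * (exp (- (s * w / 2 - a / w)\<^sup>2) * (s / 2 + a / w\<^sup>2)) +
              exp (s * a) * (exp (- (s * w / 2 + a / w)\<^sup>2) * (s / 2 - a / w\<^sup>2))) (at w)"
        unfolding F_def by (intro DERIV_add DERIV_cmult DERIV_chain2[OF E(1)])
      moreover have "exp (- s * a) * (exp (- (s * w / 2 - a / w)\<^sup>2) * (s / 2 + a / w\<^sup>2)) = (s / 2 + a / w\<^sup>2) * exp (- (s * w / 2)\<^sup>2 - (a / w)\<^sup>2)"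
      proof -
        have "- s * a + - (s * w / 2 - a / w)\<^sup>2 = - (s * w / 2)\<^sup>2 - (a / w)\<^sup>2" using w by (simp add: power2_diff)
        thus ?thesis by (simp flip: exp_add mult.assoc)
      qed
      moreover have "exp (s * a) * (exp (- (s * w / 2 + a / w)\<^sup>2) * (s / 2 - a / w\<^sup>2)) = (s / 2 - a / w\<^sup>2) * exp (- (s * w / 2)\<^sup>2 - (a / w)\<^sup>2)"
      proof -
        have "s * a + - (s * w / 2 + a / w)\<^sup>2 = - (s * w / 2)\<^sup>2 - (a / w)\<^sup>2" using w by (simp add: power2_sum)
        thus ?thesis by (simp flip: exp_add mult.assoc)
      qed
      moreover have "(s / 2 + a / w\<^sup>2) * X + (s / 2 - a / w\<^sup>2) * X = s * X" for X by (simp add: algebra_simps)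
      ultimately show ?thesis by (simp only: f_def)
    qed
    have prems: "(0::ereal) < \<infinity>" "\<And>x. 0 < ereal x \<Longrightarrow> ereal x < \<infinity> \<Longrightarrow> DERIV F x :> f x"
      "\<And>x. 0 < ereal x \<Longrightarrow> ereal x < \<infinity> \<Longrightarrow> isCont f x"
      "AE x in lborel. 0 < ereal x \<longrightarrow> ereal x < \<infinity> \<longrightarrow> 0 \<le> f x"
      "((F \<circ> real_of_ereal) \<longlongrightarrow> exp (s * a) * L - exp (- s * a) * L) (at_right 0)"
      "((F \<circ> real_of_ereal) \<longlongrightarrow> exp (- s * a) * L + exp (s * a) * L) (at_left \<infinity>)"
    proof -
      show "((F \<circ> real_of_ereal) \<longlongrightarrow> exp (s * a) * L - exp (- s * a) * L) (at_right 0)"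
        using zero by (simp add: zero_ereal_def ereal_tendsto_simps)
      show "((F \<circ> real_of_ereal) \<longlongrightarrow> exp (- s * a) * L + exp (s * a) * L) (at_left \<infinity>)"
        using top by (simp add: ereal_tendsto_simps)
      show "AE x in lborel. 0 < ereal x \<longrightarrow> ereal x < \<infinity> \<longrightarrow> 0 \<le> f x"
        using s by (intro AE_I2) (simp add: f_def)
      show "isCont f x" if "0 < ereal x" for x
        using that unfolding f_def by (intro continuous_intros) auto
    qed (use dF in auto)
    note FTC = interval_integral_FTC_nonneg[OF prems]
    have ein: "einterval 0 \<infinity> = {0::real<..}" by (auto simp: einterval_def)
    have int: "integrable lborel (\<lambda>w. indicator {0<..} w * f w)"
      using FTC(1) unfolding set_integrable_def ein by simp
    have "(\<integral>\<^sup>+w. ennreal (indicator {0<..} w * f w) \<partial>lborel) = ennreal (LINT w|lborel. indicator {0<..} w * f w)"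
      by (rule nn_integral_eq_integral[OF int]) (use s in \<open>auto simp: f_def indicator_def\<close>)
    also have "(LINT w|lborel. indicator {0<..} w * f w) = (LBINT w=0..\<infinity>. f w)"
      unfolding interval_lebesgue_integral_def set_lebesgue_integral_def ein by simp
    also have "\<dots> = 2 * L * exp (- s * a)" using FTC(2) by simp
    finally show ?thesis unfolding f_def .
  qed
  thus ?thesis using E(4) by (intro exI[of _ "2 * L"]) auto
qed

lemma summable_powr_shift: "p > 1 \<Longrightarrow> summable (\<lambda>n. (real n + 1) powr (- p))"
  using summable_Suc_iff[of "\<lambda>n. real n powr (- p)"] by (simp add: summable_real_powr_iff add.commute)

text \<open>The exponents add up to nu/2 - 2/3 - (nu + 1)/2 = - 7/6; the bound from slicing alone
  would give - 1.\<close>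

lemma summable_rep_powr_shift:
  assumes "\<nu> \<ge> 2"
  shows "summable (\<lambda>n. real (rep \<nu> n) * (real n + 1) powr (- ((real \<nu> + 1) / 2)))"
proof -
  obtain C where C: "C > 0" "\<And>n. real (rep \<nu> n) \<le> C * (real n + 1) powr (real \<nu> / 2 - 2/3)"
    using rep_le[OF assms(1)] by auto
  have "summable (\<lambda>n. C * (real n + 1) powr (- (7/6)))" by (intro summable_mult summable_powr_shift) auto
  thus ?thesis
  proof (rule summable_comparison_test')
    fix n :: nat
    have "real (rep \<nu> n) * (real n + 1) powr (- ((real \<nu> + 1) / 2)) \<le>
        (C * (real n + 1) powr (real \<nu> / 2 - 2/3)) * (real n + 1) powr (- ((real \<nu> + 1) / 2))"
      by (intro mult_right_mono C) auto
    also have "\<dots> = C * ((real n + 1) powr (real \<nu> / 2 - 2/3) * (real n + 1) powr (- ((real \<nu> + 1) / 2)))" by simp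
    also have "(real n + 1) powr (real \<nu> / 2 - 2/3) * (real n + 1) powr (- ((real \<nu> + 1) / 2)) = (real n + 1) powr (- (7/6))"
      by (subst powr_add[symmetric]) (simp add: field_simps)
    finally show "norm (real (rep \<nu> n) * (real n + 1) powr (- ((real \<nu> + 1) / 2))) \<le> C * (real n + 1) powr (- (7/6))" by simp
  qed
qed

lemma summable_rep_powr:
  assumes "\<nu> \<ge> 2" "s > 0"
  shows "summable (\<lambda>n. real (rep \<nu> n) * (s + 4 * pi\<^sup>2 * real n) powr (- ((real \<nu> + 1) / 2)))"
proof -
  define c where "c = min s (4 * pi\<^sup>2)"
  have c: "c > 0" using assms by (simp add: c_def)
  have "summable (\<lambda>n. c powr (- ((real \<nu> + 1) / 2)) * (real (rep \<nu> n) * (real n + 1) powr (- ((real \<nu> + 1) / 2))))"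
    by (intro summable_mult summable_rep_powr_shift assms)
  thus ?thesis
  proof (rule summable_comparison_test')
    fix n :: nat
    have "c * (real n + 1) \<le> s + 4 * pi\<^sup>2 * real n"
      using mult_right_mono[of c "4 * pi\<^sup>2" "real n"] by (simp add: c_def algebra_simps)
    hence "(s + 4 * pi\<^sup>2 * real n) powr (- ((real \<nu> + 1) / 2)) \<le> (c * (real n + 1)) powr (- ((real \<nu> + 1) / 2))"
      using c by (intro powr_mono2') auto
    also have "\<dots> = c powr (- ((real \<nu> + 1) / 2)) * (real n + 1) powr (- ((real \<nu> + 1) / 2))"
      by (rule powr_mult)
    finally have "real (rep \<nu> n) * (s + 4 * pi\<^sup>2 * real n) powr (- ((real \<nu> + 1) / 2)) \<le>
       real (rep \<nu> n) * (c powr (- ((real \<nu> + 1) / 2)) * (real n + 1) powr (- ((real \<nu> + 1) / 2)))"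
      by (intro mult_left_mono) auto
    thus "norm (real (rep \<nu> n) * (s + 4 * pi\<^sup>2 * real n) powr (- ((real \<nu> + 1) / 2))) \<le>
       c powr (- ((real \<nu> + 1) / 2)) * (real (rep \<nu> n) * (real n + 1) powr (- ((real \<nu> + 1) / 2)))"
      by (simp add: mult_ac)
  qed
qed

text \<open>Rescaling w by 1 / sqrt b contributes a factor b^(-1/2) for each of the nu powers of w
  and one more for the measure.\<close>

lemma nn_integral_gaussian_scale:
  assumes "b > 0"
  shows "(\<integral>\<^sup>+w. ennreal (indicator {0<..} w * (w ^ \<nu> * exp (- b * w\<^sup>2))) \<partial>lborel) =
     ennreal (b powr (- ((real \<nu> + 1) / 2))) * (\<integral>\<^sup>+w. ennreal (indicator {0<..} w * (w ^ \<nu> * exp (- w\<^sup>2))) \<partial>lborel)"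
proof -
  define r where "r = 1 / sqrt b"
  have r: "r > 0" "b * r\<^sup>2 = 1" using assms by (auto simp: r_def power_divide)
  have rp: "r = b powr (- (1/2))" using assms by (simp add: r_def powr_minus_divide powr_half_sqrt)
  have "(\<integral>\<^sup>+w. ennreal (indicator {0<..} w * (w ^ \<nu> * exp (- b * w\<^sup>2))) \<partial>lborel) =
     ennreal r * (\<integral>\<^sup>+w. ennreal (indicator {0<..} (0 + r * w) * ((0 + r * w) ^ \<nu> * exp (- b * (0 + r * w)\<^sup>2))) \<partial>lborel)"
    using r by (subst nn_integral_real_affine[of _ r 0]) auto
  also have "(\<integral>\<^sup>+w. ennreal (indicator {0<..} (0 + r * w) * ((0 + r * w) ^ \<nu> * exp (- b * (0 + r * w)\<^sup>2))) \<partial>lborel) =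
     (\<integral>\<^sup>+w. ennreal (r ^ \<nu>) * ennreal (indicator {0<..} w * (w ^ \<nu> * exp (- w\<^sup>2))) \<partial>lborel)"
  proof (intro nn_integral_cong)
    fix w :: real
    have ind: "indicator {0<..} (0 + r * w) = (indicator {0<..} w :: real)" using r by (simp add: indicator_def zero_less_mult_iff)
    have ex: "- b * (0 + r * w)\<^sup>2 = - w\<^sup>2" using r by (simp add: power_mult_distrib flip: mult.assoc)
    show "ennreal (indicator {0<..} (0 + r * w) * ((0 + r * w) ^ \<nu> * exp (- b * (0 + r * w)\<^sup>2))) =
      ennreal (r ^ \<nu>) * ennreal (indicator {0<..} w * (w ^ \<nu> * exp (- w\<^sup>2)))"
      unfolding ind ex using r(1) by (subst ennreal_mult'[symmetric]) (auto simp: power_mult_distrib mult_ac)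
  qed
  also have "\<dots> = ennreal (r ^ \<nu>) * (\<integral>\<^sup>+w. ennreal (indicator {0<..} w * (w ^ \<nu> * exp (- w\<^sup>2))) \<partial>lborel)"
    by (rule nn_integral_cmult) auto
  also have "ennreal r * (ennreal (r ^ \<nu>) * (\<integral>\<^sup>+w. ennreal (indicator {0<..} w * (w ^ \<nu> * exp (- w\<^sup>2))) \<partial>lborel)) =
     ennreal (r ^ Suc \<nu>) * (\<integral>\<^sup>+w. ennreal (indicator {0<..} w * (w ^ \<nu> * exp (- w\<^sup>2))) \<partial>lborel)"
    using r by (simp add: ennreal_mult mult.assoc)
  also have "r ^ Suc \<nu> = b powr (- ((real \<nu> + 1) / 2))"
    unfolding rp using assms by (subst powr_power) (auto simp: field_simps)
  finally show ?thesis .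
qed

lemma suminf_ennreal_cmult:
  fixes f :: "nat \<Rightarrow> real"
  assumes "summable f" "\<And>n. f n \<ge> 0" "c \<ge> 0"
  shows "(\<Sum>n. ennreal (c * f n)) = ennreal (c * suminf f)"
  by (subst suminf_ennreal2) (use assms in \<open>auto intro: summable_mult simp: suminf_mult\<close>)

text \<open>Each exponential is replaced by its Gaussian mixture, the sum is taken inside the
  integral, the theta transformation is applied for every w, and the sum is taken out again. The
  Gaussian moments then produce the powers with exponent - (nu + 1)/2.\<close>

lemma poisson_real:
  assumes \<nu>: "\<nu> \<ge> 2"
  shows "\<exists>\<kappa>>0. \<forall>s>0. (\<Sum>n. real (rep \<nu> n) * exp (- s * sqrt (real n))) =
     \<kappa> * s * (\<Sum>n. real (rep \<nu> n) * (s\<^sup>2 + 4 * pi\<^sup>2 * real n) powr (- ((real \<nu> + 1) / 2)))"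
proof -
  let ?\<alpha> = "(real \<nu> + 1) / 2"
  obtain K where K: "K > 0" and theta: "\<And>w. w > 0 \<Longrightarrow> (\<Sum>n. real (rep \<nu> n) * exp (- real n / w\<^sup>2)) =
           (w / K) ^ \<nu> * (\<Sum>n. real (rep \<nu> n) * exp (- (pi\<^sup>2 * w\<^sup>2) * real n))"
    using lattice_theta_transformation[OF \<nu>] by blast
  obtain c where c: "c > 0" and sub: "\<And>s a. s > 0 \<Longrightarrow> a \<ge> 0 \<Longrightarrow>
      (\<integral>\<^sup>+w. ennreal (indicator {0<..} w * (s * exp (- (s * w / 2)\<^sup>2 - (a / w)\<^sup>2))) \<partial>lborel) = ennreal (c * exp (- s * a))"
    using subordination by blast
  define J where "J = (\<integral>\<^sup>+w. ennreal (indicator {0<..} w * (w ^ \<nu> * exp (- w\<^sup>2))) \<partial>lborel)"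
  define A where "A = (\<lambda>s. \<Sum>n. real (rep \<nu> n) * exp (- s * sqrt (real n)))"
  define B where "B = (\<lambda>s. \<Sum>n. real (rep \<nu> n) * (s\<^sup>2 + 4 * pi\<^sup>2 * real n) powr (- ?\<alpha>))"
  have eq: "ennreal (c * A s) = ennreal (s / K ^ \<nu> * 4 powr ?\<alpha> * B s) * J" if s: "s > 0" for s
  proof -
    define f where "f = (\<lambda>n w. ennreal (indicator {0<..} w * (real (rep \<nu> n) * (s * exp (- (s * w / 2)\<^sup>2 - (sqrt (real n) / w)\<^sup>2)))))"
    define g where "g = (\<lambda>n w. ennreal (indicator {0<..} w * (real (rep \<nu> n) * (s / K ^ \<nu> * (w ^ \<nu> * exp (- ((s\<^sup>2 + 4 * pi\<^sup>2 * real n) / 4) * w\<^sup>2))))))"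
    have fint: "(\<integral>\<^sup>+w. f n w \<partial>lborel) = ennreal (c * (real (rep \<nu> n) * exp (- s * sqrt (real n))))" for n
    proof -
      have "(\<integral>\<^sup>+w. f n w \<partial>lborel) = (\<integral>\<^sup>+w. ennreal (real (rep \<nu> n)) * ennreal (indicator {0<..} w * (s * exp (- (s * w / 2)\<^sup>2 - (sqrt (real n) / w)\<^sup>2))) \<partial>lborel)"
        unfolding f_def by (intro nn_integral_cong) (subst ennreal_mult'[symmetric], auto simp: mult_ac)
      also have "\<dots> = ennreal (real (rep \<nu> n)) * ennreal (c * exp (- s * sqrt (real n)))"
        by (subst nn_integral_cmult) (use sub[OF s, of "sqrt (real n)"] in auto)
      also have "\<dots> = ennreal (c * (real (rep \<nu> n) * exp (- s * sqrt (real n))))"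
        by (subst ennreal_mult'[symmetric]) (auto simp: mult_ac)
      finally show ?thesis .
    qed
    have gint: "(\<integral>\<^sup>+w. g n w \<partial>lborel) = ennreal ((s / K ^ \<nu> * 4 powr ?\<alpha>) * (real (rep \<nu> n) * (s\<^sup>2 + 4 * pi\<^sup>2 * real n) powr (- ?\<alpha>))) * J" for n
    proof -
      \<comment> \<open>The Gaussian rates (s / 2)^2 and pi^2 n combine into b; its denominator 4 is
        the origin of the factor \<open>4 powr ?\<alpha>\<close>.\<close>
      define b where "b = (s\<^sup>2 + 4 * pi\<^sup>2 * real n) / 4"
      have b: "b > 0" using s by (simp add: b_def add_pos_nonneg)
      have "(\<integral>\<^sup>+w. g n w \<partial>lborel) = (\<integral>\<^sup>+w. ennreal (real (rep \<nu> n) * (s / K ^ \<nu>)) * ennreal (indicator {0<..} w * (w ^ \<nu> * exp (- b * w\<^sup>2))) \<partial>lborel)"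
        unfolding g_def b_def using s K by (intro nn_integral_cong) (subst ennreal_mult'[symmetric], auto simp: mult_ac)
      also have "\<dots> = ennreal (real (rep \<nu> n) * (s / K ^ \<nu>)) * (ennreal (b powr (- ?\<alpha>)) * J)"
        unfolding J_def by (subst nn_integral_cmult) (use nn_integral_gaussian_scale[OF b, of \<nu>] in auto)
      also have "\<dots> = ennreal (real (rep \<nu> n) * (s / K ^ \<nu>) * b powr (- ?\<alpha>)) * J"
        using s K by (subst ennreal_mult'[where b = "b powr _"]) (auto simp: mult.assoc)
      also have "b powr (- ?\<alpha>) = 4 powr ?\<alpha> * (s\<^sup>2 + 4 * pi\<^sup>2 * real n) powr (- ?\<alpha>)"
        unfolding b_def by (subst powr_divide) (auto simp: powr_minus field_simps)
      finally show ?thesis by (simp add: mult_ac)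
    qed
    have fg: "(\<Sum>n. f n w) = (\<Sum>n. g n w)" for w
    proof (cases "w > 0")
      case w: True
      have f': "f n w = ennreal ((s * exp (- (s * w / 2)\<^sup>2)) * (real (rep \<nu> n) * exp (- (1 / w\<^sup>2) * real n)))" for n
      proof -
        have "- (s * w / 2)\<^sup>2 - (sqrt (real n) / w)\<^sup>2 = - (s * w / 2)\<^sup>2 + - (1 / w\<^sup>2) * real n"
          by (simp add: power_divide)
        hence "exp (- (s * w / 2)\<^sup>2 - (sqrt (real n) / w)\<^sup>2) = exp (- (s * w / 2)\<^sup>2) * exp (- (1 / w\<^sup>2) * real n)"
          by (simp only: exp_add)
        thus ?thesis unfolding f_def using w by (simp add: mult_ac)
      qed
      have g': "g n w = ennreal ((s * exp (- (s * w / 2)\<^sup>2)) * ((w / K) ^ \<nu> * (real (rep \<nu> n) * exp (- (pi\<^sup>2 * w\<^sup>2) * real n))))" for n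
      proof -
        have "- ((s\<^sup>2 + 4 * pi\<^sup>2 * real n) / 4) * w\<^sup>2 = - (s * w / 2)\<^sup>2 + - (pi\<^sup>2 * w\<^sup>2) * real n"
          by (simp add: power2_eq_square field_simps)
        hence "exp (- ((s\<^sup>2 + 4 * pi\<^sup>2 * real n) / 4) * w\<^sup>2) = exp (- (s * w / 2)\<^sup>2) * exp (- (pi\<^sup>2 * w\<^sup>2) * real n)"
          by (simp only: exp_add)
        thus ?thesis unfolding g_def using w by (simp add: power_divide mult_ac)
      qed
      have "(\<Sum>n. f n w) = ennreal ((s * exp (- (s * w / 2)\<^sup>2)) * (\<Sum>n. real (rep \<nu> n) * exp (- (1 / w\<^sup>2) * real n)))"
        unfolding f' by (intro suminf_ennreal_cmult summable_rep_exp \<nu>) (use s w in auto)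
      moreover have "(\<Sum>n. g n w) = ennreal ((s * exp (- (s * w / 2)\<^sup>2)) * ((w / K) ^ \<nu> * (\<Sum>n. real (rep \<nu> n) * exp (- (pi\<^sup>2 * w\<^sup>2) * real n))))"
        unfolding g' mult.assoc[of _ "(w / K) ^ \<nu>", symmetric] mult.assoc[of "s * exp _", symmetric]
        by (intro suminf_ennreal_cmult summable_rep_exp \<nu>) (use s w K in auto)
      moreover have "(\<Sum>n. real (rep \<nu> n) * exp (- (1 / w\<^sup>2) * real n)) = (w / K) ^ \<nu> * (\<Sum>n. real (rep \<nu> n) * exp (- (pi\<^sup>2 * w\<^sup>2) * real n))"
        using theta[OF w] by simp
      ultimately show ?thesis by simp
    qed (simp add: f_def g_def)
    have "ennreal (c * A s) = (\<Sum>n. \<integral>\<^sup>+w. f n w \<partial>lborel)"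
      unfolding fint A_def by (intro suminf_ennreal_cmult[symmetric] summable_rep_exp_sqrt \<nu> s) (use c in auto)
    also have "\<dots> = (\<integral>\<^sup>+w. (\<Sum>n. f n w) \<partial>lborel)"
      by (rule nn_integral_suminf[symmetric]) (auto simp: f_def)
    also have "\<dots> = (\<integral>\<^sup>+w. (\<Sum>n. g n w) \<partial>lborel)" unfolding fg ..
    also have "\<dots> = (\<Sum>n. \<integral>\<^sup>+w. g n w \<partial>lborel)"
      by (rule nn_integral_suminf) (auto simp: g_def)
    also have "\<dots> = (\<Sum>n. ennreal ((s / K ^ \<nu> * 4 powr ?\<alpha>) * (real (rep \<nu> n) * (s\<^sup>2 + 4 * pi\<^sup>2 * real n) powr (- ?\<alpha>)))) * J"
      unfolding gint by (rule ennreal_suminf_multc)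
    also have "(\<Sum>n. ennreal ((s / K ^ \<nu> * 4 powr ?\<alpha>) * (real (rep \<nu> n) * (s\<^sup>2 + 4 * pi\<^sup>2 * real n) powr (- ?\<alpha>)))) = ennreal (s / K ^ \<nu> * 4 powr ?\<alpha> * B s)"
      unfolding B_def by (intro suminf_ennreal_cmult summable_rep_powr \<nu>) (use s K in auto)
    finally show ?thesis .
  qed
  have rep0: "rep \<nu> 0 \<ge> 1"
  proof -
    have "(\<lambda>_. 0) \<in> {x \<in> int_lattice \<nu>. sq_norm \<nu> x = 0}" by (simp add: int_lattice_def sq_norm_def)
    thus ?thesis unfolding rep_def using finite_sphere[of \<nu> 0] by (metis One_nat_def Suc_leI card_gt_0_iff empty_iff)
  qed
  have posA: "A s > 0" if "s > 0" for s
    unfolding A_def by (rule suminf_pos2[of _ 0]) (use summable_rep_exp_sqrt[OF \<nu> that] rep0 in auto)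
  have nonnegB: "B s \<ge> 0" if "s > 0" for s
    unfolding B_def by (intro suminf_nonneg summable_rep_powr \<nu>) (use that in auto)
  have B1: "B 1 > 0"
    unfolding B_def by (rule suminf_pos2[of _ 0]) (use summable_rep_powr[OF \<nu>, of 1] rep0 in auto)
  \<comment> \<open>The moment J is never evaluated: its finiteness follows from the identity at s =
    1, whose left side is finite while B 1 is positive, and it is nonzero because A 1 is.\<close>
  have "J \<noteq> \<infinity>"
  proof
    assume "J = \<infinity>"
    hence "ennreal (1 / K ^ \<nu> * 4 powr ?\<alpha> * B 1) * J = \<infinity>" using B1 K by (auto simp: ennreal_mult_eq_top_iff)
    thus False using eq[of 1] by simp
  qed
  then obtain j where j: "J = ennreal j" "j \<ge> 0" by (cases J) auto
  have eq': "c * A s = (s / K ^ \<nu> * 4 powr ?\<alpha> * B s) * j" if s: "s > 0" for s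
  proof -
    have "ennreal (c * A s) = ennreal ((s / K ^ \<nu> * 4 powr ?\<alpha> * B s) * j)"
      unfolding eq[OF s] j(1) by (rule ennreal_mult''[OF j(2), symmetric])
    thus ?thesis using posA[OF s] nonnegB[OF s] c s j K by (subst (asm) ennreal_inj) auto
  qed
  have "j \<noteq> 0" using eq'[of 1] posA[of 1] c by auto
  define \<kappa> where "\<kappa> = j * 4 powr ?\<alpha> / (c * K ^ \<nu>)"
  have "\<kappa> > 0" using \<open>j \<noteq> 0\<close> j c K by (simp add: \<kappa>_def)
  moreover have "A s = \<kappa> * s * B s" if "s > 0" for s
    using eq'[OF that] c K by (simp add: \<kappa>_def field_simps)
  ultimately show ?thesis unfolding A_def B_def by blast
qed

section \<open>Analytic continuation of the Poisson formula to the right half-plane\<close>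

lemma holomorphic_on_suminf:
  fixes f :: "nat \<Rightarrow> complex \<Rightarrow> complex"
  assumes S: "open S" and f: "\<And>n. f n holomorphic_on S"
    and bd: "\<And>x. x \<in> S \<Longrightarrow> \<exists>d M. d > 0 \<and> cball x d \<subseteq> S \<and> summable M \<and> (\<forall>n. \<forall>y\<in>cball x d. norm (f n y) \<le> M n)"
  shows "(\<lambda>x. \<Sum>n. f n x) holomorphic_on S"
proof (rule holomorphic_uniform_sequence[OF S, of "\<lambda>N x. \<Sum>n<N. f n x"])
  show "(\<lambda>x. \<Sum>n<N. f n x) holomorphic_on S" for N by (intro holomorphic_intros f)
  fix x assume "x \<in> S"
  then obtain d M where dM: "d > 0" "cball x d \<subseteq> S" "summable M" "\<And>n y. y \<in> cball x d \<Longrightarrow> norm (f n y) \<le> M n"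
    using bd by meson
  have "uniform_limit (cball x d) (\<lambda>N x. \<Sum>n<N. f n x) (\<lambda>x. \<Sum>n. f n x) sequentially"
    by (rule Weierstrass_m_test[OF dM(4,3)])
  thus "\<exists>d>0. cball x d \<subseteq> S \<and> uniform_limit (cball x d) (\<lambda>N x. \<Sum>n<N. f n x) (\<lambda>x. \<Sum>n. f n x) sequentially"
    using dM by blast
qed

text \<open>In the right half-plane s^2 is real only for real s, so the principal power of s^2 + x
  never meets its branch cut.\<close>

lemma sq_add_not_nonpos_Reals:
  assumes "Re s > 0" "x \<ge> 0"
  shows "s\<^sup>2 + complex_of_real x \<notin> \<real>\<^sub>\<le>\<^sub>0"
proof
  assume "s\<^sup>2 + complex_of_real x \<in> \<real>\<^sub>\<le>\<^sub>0"
  hence "Im (s\<^sup>2) = 0" "Re (s\<^sup>2) + x \<le> 0" by (auto simp: complex_nonpos_Reals_iff)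
  hence "Im s = 0" "(Re s)\<^sup>2 - (Im s)\<^sup>2 + x \<le> 0" using assms(1) by (auto simp: Re_power2 Im_power2)
  moreover have "(Re s)\<^sup>2 + x > 0" using assms by (intro add_pos_nonneg) auto
  ultimately show False by simp
qed

lemma norm_sq_add_ge:
  assumes "x \<ge> 0"
  shows "norm (s\<^sup>2 + complex_of_real (x\<^sup>2)) \<ge> (Re s)\<^sup>2"
proof -
  have "s\<^sup>2 + complex_of_real (x\<^sup>2) = (s - \<i> * complex_of_real x) * (s + \<i> * complex_of_real x)"
    by (simp add: power2_eq_square algebra_simps)
  hence "norm (s\<^sup>2 + complex_of_real (x\<^sup>2)) = norm (s - \<i> * complex_of_real x) * norm (s + \<i> * complex_of_real x)"
    by (simp only: norm_mult)
  moreover have "\<bar>Re s\<bar> \<le> norm (s - \<i> * complex_of_real x)" "\<bar>Re s\<bar> \<le> norm (s + \<i> * complex_of_real x)"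
    using abs_Re_le_cmod[of "s - \<i> * complex_of_real x"] abs_Re_le_cmod[of "s + \<i> * complex_of_real x"] by simp_all
  hence "\<bar>Re s\<bar> * \<bar>Re s\<bar> \<le> norm (s - \<i> * complex_of_real x) * norm (s + \<i> * complex_of_real x)"
    by (intro mult_mono) auto
  ultimately show ?thesis by (simp add: power2_eq_square)
qed

text \<open>Both sides are holomorphic as locally uniform limits and agree on the positive axis by
  \<open>poisson_real\<close>; the identity theorem does the rest.\<close>

lemma poisson_complex:
  assumes \<nu>: "\<nu> \<ge> 2"
  shows "\<exists>\<kappa>>0. \<forall>s. Re s > 0 \<longrightarrow> (\<Sum>n. of_nat (rep \<nu> n) * exp (- s * complex_of_real (sqrt (real n)))) =
     complex_of_real \<kappa> * s * (\<Sum>n. of_nat (rep \<nu> n) *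
        (s\<^sup>2 + complex_of_real (4 * pi\<^sup>2 * real n)) powr complex_of_real (- ((real \<nu> + 1) / 2)))"
proof -
  define \<alpha> where "\<alpha> = (real \<nu> + 1) / 2"
  obtain \<kappa> where \<kappa>: "\<kappa> > 0" and pois: "\<And>s. s > 0 \<Longrightarrow> (\<Sum>n. real (rep \<nu> n) * exp (- s * sqrt (real n))) =
     \<kappa> * s * (\<Sum>n. real (rep \<nu> n) * (s\<^sup>2 + 4 * pi\<^sup>2 * real n) powr (- \<alpha>))"
    using poisson_real[OF \<nu>] unfolding \<alpha>_def by blast
  define A where "A = (\<lambda>s. \<Sum>n. of_nat (rep \<nu> n) * exp (- s * complex_of_real (sqrt (real n))))"
  define B where "B = (\<lambda>s. \<Sum>n. of_nat (rep \<nu> n) * (s\<^sup>2 + complex_of_real (4 * pi\<^sup>2 * real n)) powr complex_of_real (- \<alpha>))"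
  define S where "S = {s. Re s > 0}"
  have S: "open S" "connected S" unfolding S_def by (auto simp: open_halfspace_Re_gt intro!: convex_connected convex_halfspace_Re_gt)
  have ball: "cball x (Re x / 2) \<subseteq> S \<and> (\<forall>y\<in>cball x (Re x / 2). Re y \<ge> Re x / 2)" if "x \<in> S" for x
  proof -
    have "Re y \<ge> Re x / 2" if "y \<in> cball x (Re x / 2)" for y
      using that abs_Re_le_cmod[of "x - y"] by (auto simp: dist_norm)
    thus ?thesis using that unfolding S_def by force
  qed
  have holA: "A holomorphic_on S" unfolding A_def
  proof (rule holomorphic_on_suminf[OF S(1)])
    fix x assume x: "x \<in> S"
    have "norm (of_nat (rep \<nu> n) * exp (- y * complex_of_real (sqrt (real n)))) \<le> real (rep \<nu> n) * exp (- (Re x / 2) * sqrt (real n))"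
      if "y \<in> cball x (Re x / 2)" for n y
    proof -
      have "Re x / 2 \<le> Re y" using ball[OF x] that by blast
      hence "(Re x / 2) * sqrt (real n) \<le> Re y * sqrt (real n)" by (intro mult_right_mono) auto
      thus ?thesis by (simp add: norm_mult mult_left_mono)
    qed
    moreover have "summable (\<lambda>n. real (rep \<nu> n) * exp (- (Re x / 2) * sqrt (real n)))"
      using x by (intro summable_rep_exp_sqrt \<nu>) (auto simp: S_def)
    ultimately show "\<exists>d M. d > 0 \<and> cball x d \<subseteq> S \<and> summable M \<and> (\<forall>n. \<forall>y\<in>cball x d. norm (of_nat (rep \<nu> n) * exp (- y * complex_of_real (sqrt (real n)))) \<le> M n)"
      using ball[OF x] x by (intro exI[of _ "Re x / 2"] exI[of _ "\<lambda>n. real (rep \<nu> n) * exp (- (Re x / 2) * sqrt (real n))"]) (auto simp: S_def)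
  qed (intro holomorphic_intros)
  have holB: "B holomorphic_on S" unfolding B_def
  proof (rule holomorphic_on_suminf[OF S(1)])
    fix x assume x: "x \<in> S"
    define d R where "d = Re x / 2" and "R = norm x + d"
    have d: "d > 0" using x by (simp add: d_def S_def)
    hence R: "R > 0" by (simp add: R_def add_nonneg_pos)
    \<comment> \<open>One constant for two regimes: if 4 n >= R^2 + 1, then 4 pi^2 n dominates |y|^2
      <= R^2; for smaller n the lower bound (Re y)^2 >= d^2 is spread over n + 1 <= R^2 + 1.\<close>
    define c where "c = min 1 (d\<^sup>2 / (R\<^sup>2 + 1))"
    have R1: "R\<^sup>2 + 1 > 0" by (intro add_nonneg_pos) auto
    have c: "c > 0" using d R1 by (simp add: c_def)
    have "norm (of_nat (rep \<nu> n) * (y\<^sup>2 + complex_of_real (4 * pi\<^sup>2 * real n)) powr complex_of_real (- \<alpha>)) \<le>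
       c powr (- \<alpha>) * (real (rep \<nu> n) * (real n + 1) powr (- \<alpha>))" if y: "y \<in> cball x d" for n y
    proof -
      have Rey: "Re y \<ge> d" using ball[OF x] y by (simp add: d_def)
      have "norm y \<le> R" using y norm_triangle_ineq2[of y x] by (simp add: R_def dist_norm norm_minus_commute)
      hence y2: "norm (y\<^sup>2) \<le> R\<^sup>2" by (simp add: norm_power power_mono)
      have "c * (real n + 1) \<le> norm (y\<^sup>2 + complex_of_real (4 * pi\<^sup>2 * real n))"
      proof (cases "4 * real n \<ge> R\<^sup>2 + 1")
        case True
        have "pi\<^sup>2 \<ge> 3\<^sup>2" using pi_gt3 by (intro power_mono) auto
        hence "4 * pi\<^sup>2 * real n \<ge> 36 * real n" by (intro mult_right_mono) auto
        moreover define P where "P = 4 * pi\<^sup>2 * real n"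
        ultimately have pi9: "P \<ge> 36 * real n" by (simp only:)
        have "real n > 0" using True R1 by linarith
        hence "real n \<ge> 1" by simp
        hence "c * (real n + 1) \<le> 1 * (real n + 1)" by (intro mult_right_mono) (auto simp: c_def)
        also have "\<dots> \<le> 4 * pi\<^sup>2 * real n - R\<^sup>2" 
        proof -
          have "k + 1 \<le> P - q" if "P \<ge> 36 * k" "4 * k \<ge> q + 1" "k \<ge> 1" for k q :: real
            using that by linarith
          from this[OF pi9 True \<open>real n \<ge> 1\<close>] show ?thesis unfolding P_def by simp
        qed
        also have "\<dots> \<le> norm (complex_of_real (4 * pi\<^sup>2 * real n)) - norm (y\<^sup>2)"
          using y2 by (simp only: norm_of_real)
        also have "\<dots> \<le> norm (y\<^sup>2 + complex_of_real (4 * pi\<^sup>2 * real n))" by (metis add.commute norm_diff_ineq)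
        finally show ?thesis .
      next
        case False
        hence "real n + 1 \<le> R\<^sup>2 + 1" if "n > 0" using that by linarith
        hence "real n + 1 \<le> R\<^sup>2 + 1" by (cases "n = 0") auto
        hence "c * (real n + 1) \<le> d\<^sup>2 / (R\<^sup>2 + 1) * (R\<^sup>2 + 1)" by (intro mult_mono) (auto simp: c_def)
        also have "\<dots> = d\<^sup>2" using R1 by simp
        also have "\<dots> \<le> (Re y)\<^sup>2" using Rey d by (intro power_mono) auto
        also have "\<dots> \<le> norm (y\<^sup>2 + complex_of_real ((2 * pi * sqrt (real n))\<^sup>2))" by (intro norm_sq_add_ge) auto
        finally show ?thesis by (simp add: power_mult_distrib)
      qed
      hence "norm (y\<^sup>2 + complex_of_real (4 * pi\<^sup>2 * real n)) powr (- \<alpha>) \<le> (c * (real n + 1)) powr (- \<alpha>)"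
        using c by (intro powr_mono2') (auto simp: \<alpha>_def)
      also have "\<dots> = c powr (- \<alpha>) * (real n + 1) powr (- \<alpha>)" by (rule powr_mult)
      finally have "real (rep \<nu> n) * norm (y\<^sup>2 + complex_of_real (4 * pi\<^sup>2 * real n)) powr (- \<alpha>) \<le> real (rep \<nu> n) * (c powr (- \<alpha>) * (real n + 1) powr (- \<alpha>))"
        by (intro mult_left_mono) auto
      thus ?thesis by (simp add: norm_mult norm_powr_real_powr' mult_ac del: of_real_add of_real_mult of_real_power of_real_minus)
    qed
    moreover have "summable (\<lambda>n. c powr (- \<alpha>) * (real (rep \<nu> n) * (real n + 1) powr (- \<alpha>)))"
      unfolding \<alpha>_def by (intro summable_mult summable_rep_powr_shift \<nu>)
    ultimately show "\<exists>d M. d > 0 \<and> cball x d \<subseteq> S \<and> summable M \<and> (\<forall>n. \<forall>y\<in>cball x d.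
         norm (of_nat (rep \<nu> n) * (y\<^sup>2 + complex_of_real (4 * pi\<^sup>2 * real n)) powr complex_of_real (- \<alpha>)) \<le> M n)"
      using ball[OF x] d by (intro exI[of _ d] exI[of _ "\<lambda>n. c powr (- \<alpha>) * (real (rep \<nu> n) * (real n + 1) powr (- \<alpha>))"]) (auto simp: d_def)
  next
    fix n
    show "(\<lambda>s. of_nat (rep \<nu> n) * (s\<^sup>2 + complex_of_real (4 * pi\<^sup>2 * real n)) powr complex_of_real (- \<alpha>)) holomorphic_on S"
      using sq_add_not_nonpos_Reals[of _ "4 * pi\<^sup>2 * real n"]
      by (intro holomorphic_intros) (auto simp: S_def)
  qed
  have real: "A (complex_of_real x) - complex_of_real \<kappa> * complex_of_real x * B (complex_of_real x) = 0" if x: "x > 0" for x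
  proof -
    have "A (complex_of_real x) = complex_of_real (\<Sum>n. real (rep \<nu> n) * exp (- x * sqrt (real n)))"
      unfolding A_def by (subst suminf_of_real[OF summable_rep_exp_sqrt[OF \<nu> x]]) (simp add: exp_of_real[symmetric])
    moreover have "B (complex_of_real x) = complex_of_real (\<Sum>n. real (rep \<nu> n) * (x\<^sup>2 + 4 * pi\<^sup>2 * real n) powr (- \<alpha>))"
    proof -
      have "(complex_of_real x)\<^sup>2 + complex_of_real (4 * pi\<^sup>2 * real n) = complex_of_real (x\<^sup>2 + 4 * pi\<^sup>2 * real n)" for n by simp
      hence "((complex_of_real x)\<^sup>2 + complex_of_real (4 * pi\<^sup>2 * real n)) powr complex_of_real (- \<alpha>) =
            complex_of_real ((x\<^sup>2 + 4 * pi\<^sup>2 * real n) powr (- \<alpha>))" for n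
        by (simp only:) (rule powr_of_real, simp)
      moreover have "summable (\<lambda>n. real (rep \<nu> n) * (x\<^sup>2 + 4 * pi\<^sup>2 * real n) powr (- \<alpha>))"
        unfolding \<alpha>_def using x by (intro summable_rep_powr \<nu>) auto
      ultimately show ?thesis unfolding B_def by (subst suminf_of_real) auto
    qed
    ultimately show ?thesis using pois[OF x] by simp
  qed
  have "A s - complex_of_real \<kappa> * s * B s = 0" if s: "Re s > 0" for s :: complex
  proof (rule analytic_continuation[of "\<lambda>s. A s - complex_of_real \<kappa> * s * B s" S "complex_of_real ` {0<..}" 1])
    show "(\<lambda>s. A s - complex_of_real \<kappa> * s * B s) holomorphic_on S" by (intro holomorphic_intros holA holB)
    show "(1::complex) islimpt complex_of_real ` {0<..}"
      unfolding islimpt_sequential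
    proof (intro exI[of _ "\<lambda>n. complex_of_real (1 + 1 / real (Suc n))"] conjI allI)
      show "complex_of_real (1 + 1 / real (Suc n)) \<in> complex_of_real ` {0<..} - {1}" for n
        by (auto simp: complex_eq_iff intro!: imageI add_pos_nonneg)
      have "(\<lambda>n. 1 + 1 / real (Suc n)) \<longlonglongrightarrow> 1" by real_asymp
      hence "(\<lambda>n. complex_of_real (1 + 1 / real (Suc n))) \<longlonglongrightarrow> complex_of_real 1" by (rule tendsto_of_real)
      thus "(\<lambda>n. complex_of_real (1 + 1 / real (Suc n))) \<longlonglongrightarrow> 1" by simp
    qed
  qed (use S real s in \<open>auto simp: S_def\<close>)
  hence "\<forall>s. Re s > 0 \<longrightarrow> A s = complex_of_real \<kappa> * s * B s" by simp
  thus ?thesis using \<kappa> unfolding A_def B_def \<alpha>_def by blast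
qed

section \<open>The arithmetic coefficients\<close>

text \<open>For Q = 1 the quotient \<open>rad_coeff 1 m / m\<close> is the coefficient c m of the
  overview. The parameter Q removes the primes of Q; it arises when
  \<open>rad_coeff 1 (Q * k)\<close> is split into a constant and a part depending on k.\<close>

definition rad_coeff :: "nat \<Rightarrow> nat \<Rightarrow> real" where
  "rad_coeff Q n = (\<Prod>p | prime p \<and> p dvd n \<and> \<not> p dvd Q. 1 - real p)"

lemma finite_primes_dvd: "n > 0 \<Longrightarrow> finite {p::nat. prime p \<and> p dvd n \<and> P p}"
  by (rule finite_subset[of _ "{..n}"]) (auto dest: dvd_imp_le)

lemma prime_power_coprime_induct [consumes 1, case_names one mult]:
  fixes n :: nat
  assumes "n > 0" "P 1"
    "\<And>p a n. prime p \<Longrightarrow> a > 0 \<Longrightarrow> n > 0 \<Longrightarrow> \<not> p dvd n \<Longrightarrow> P n \<Longrightarrow> P (p ^ a * n)"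
  shows "P n"
  using assms(1)
proof (induction n rule: less_induct)
  case (less n)
  show ?case
  proof (cases "n = 1")
    case False
    then obtain p where p: "prime p" "p dvd n" using prime_factor_nat by blast
    define a where "a = multiplicity p n"
    have a: "a > 0" using p less.prems by (simp add: a_def prime_multiplicity_gt_zero_iff)
    have "\<exists>m. n = p ^ a * m \<and> \<not> p dvd m"
      using multiplicity_decompose'[of n p] p less.prems unfolding a_def by (metis not_prime_unit neq0_conv)
    then obtain m where m: "n = p ^ a * m" "\<not> p dvd m" by blast
    have m0: "m > 0" using m(1) less.prems by (cases m) auto
    have "1 < p ^ a" using one_less_power[OF prime_gt_1_nat[OF p(1)] a] .
    hence "m < n" using m(1) m0 by simp
    thus ?thesis using assms(3)[OF p(1) a m0 m(2)] less.IH m m0 by metis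
  qed (use assms(2) in simp)
qed

lemma rad_coeff_mult_coprime:
  assumes "m > 0" "n > 0" "coprime m n"
  shows "rad_coeff Q (m * n) = rad_coeff Q m * rad_coeff Q n"
proof -
  have "{p. prime p \<and> p dvd m * n \<and> \<not> p dvd Q} = {p. prime p \<and> p dvd m \<and> \<not> p dvd Q} \<union> {p. prime p \<and> p dvd n \<and> \<not> p dvd Q}"
    by (auto simp: prime_dvd_mult_iff)
  moreover have "{p. prime p \<and> p dvd m \<and> \<not> p dvd Q} \<inter> {p. prime p \<and> p dvd n \<and> \<not> p dvd Q} = {}"
    using assms(3) by (auto dest: coprime_common_divisor)
  ultimately show ?thesis unfolding rad_coeff_def
    using finite_primes_dvd[OF assms(1)] finite_primes_dvd[OF assms(2)] by (simp add: prod.union_disjoint)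
qed

lemma rad_coeff_prime_power:
  assumes "prime p" "a > 0"
  shows "rad_coeff Q (p ^ a) = (if p dvd Q then 1 else 1 - real p)"
proof -
  have "{r. prime r \<and> r dvd p ^ a \<and> \<not> r dvd Q} = (if p dvd Q then {} else {p})"
    using assms by (auto simp: prime_dvd_power_iff primes_dvd_imp_eq dest: prime_dvd_power)
  thus ?thesis by (simp add: rad_coeff_def)
qed

lemma rad_coeff_1 [simp]: "rad_coeff Q 1 = 1" "rad_coeff Q (Suc 0) = 1"
proof -
  have e: "{p::nat. prime p \<and> p dvd Suc 0 \<and> \<not> p dvd Q} = {}" by (auto simp: prime_nat_iff)
  show "rad_coeff Q 1 = 1" "rad_coeff Q (Suc 0) = 1" unfolding rad_coeff_def One_nat_def e by simp_all
qed

lemma abs_rad_coeff_le: "n > 0 \<Longrightarrow> \<bar>rad_coeff Q n\<bar> \<le> real n"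
proof (induction n rule: prime_power_coprime_induct)
  case (mult p a n)
  have c: "coprime (p ^ a) n" using mult.hyps by (simp add: prime_imp_coprime)
  have p1: "real p \<ge> 1" "p > 0" using prime_ge_1_nat[OF mult.hyps(1)] by auto
  have "real p \<le> real p ^ a" using power_increasing[of 1 a "real p"] p1(1) mult.hyps(2) by simp
  hence "1 \<le> real (p ^ a)" "real p \<le> real (p ^ a)" using p1 by simp_all
  hence "\<bar>rad_coeff Q (p ^ a)\<bar> \<le> real (p ^ a)"
    unfolding rad_coeff_prime_power[OF mult.hyps(1,2)] using p1(1) by (auto simp del: of_nat_power)
  hence "\<bar>rad_coeff Q (p ^ a)\<bar> * \<bar>rad_coeff Q n\<bar> \<le> real (p ^ a) * real n"
    using mult by (intro mult_mono) auto
  thus ?case using mult.hyps p1(2) by (subst rad_coeff_mult_coprime[OF _ _ c]) (auto simp: abs_mult)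
qed simp

lemma rad_coeff_mult_base:
  assumes "Q > 0" "k > 0"
  shows "rad_coeff 1 (Q * k) = rad_coeff 1 Q * rad_coeff Q k"
proof -
  have "{p. prime p \<and> p dvd Q * k \<and> \<not> p dvd 1} = {p. prime p \<and> p dvd Q \<and> \<not> p dvd 1} \<union> {p. prime p \<and> p dvd k \<and> \<not> p dvd Q}"
    by (auto simp: prime_dvd_mult_iff)
  moreover have "{p. prime p \<and> p dvd Q \<and> \<not> p dvd 1} \<inter> {p. prime p \<and> p dvd k \<and> \<not> p dvd Q} = {}" by auto
  ultimately show ?thesis unfolding rad_coeff_def
    using finite_primes_dvd[OF assms(1)] finite_primes_dvd[OF assms(2)] by (simp add: prod.union_disjoint)
qed

lemma rad_coeff_nonzero: "n > 0 \<Longrightarrow> rad_coeff Q n \<noteq> 0"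
  unfolding rad_coeff_def using finite_primes_dvd[of n] by (auto simp: prod_zero_iff)

text \<open>This is why a denominator q enters the vanishing question only through its set of prime
  divisors.\<close>

lemma rad_coeff_cong: 
  assumes "\<And>p. prime p \<Longrightarrow> p dvd m \<longleftrightarrow> p dvd n"
  shows "rad_coeff Q m = rad_coeff Q n"
  unfolding rad_coeff_def using assms by (intro prod.cong) auto

text \<open>The divisor sum of a multiplicative function is computed prime by prime: at \<open>p\<close> not
  dividing \<open>Q\<close> the local factor is the telescoping sum \<open>1 + (1 - p) * (1/p + \<dots> + 1/p^a) = 1/p^a\<close>.\<close>

lemma sum_rad_coeff_prime_power:
  assumes p: "prime p" and Q: "Q > 0"
  shows "(\<Sum>i | i \<le> a \<and> coprime (p ^ (a - i)) Q. rad_coeff Q (p ^ i) / real (p ^ i)) = 1 / real (p ^ a)"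
proof (cases "p dvd Q")
  case True
  hence "\<not> coprime p Q" using p by (metis coprime_common_divisor dvd_refl not_prime_unit)
  \<comment> \<open>Only i = a survives, since a positive power of p is not coprime to Q. As
    \<open>rad_coeff Q\<close> ignores p, the remaining term is 1 / p^a.\<close>
  hence "{i. i \<le> a \<and> coprime (p ^ (a - i)) Q} = {a}" by (auto simp: coprime_power_left_iff)
  thus ?thesis using True rad_coeff_prime_power[OF p, of a Q] by (cases "a = 0") auto
next
  case False
  hence "coprime p Q" using p by (simp add: prime_imp_coprime)
  hence "{i. i \<le> a \<and> coprime (p ^ (a - i)) Q} = {..a}" by auto
  moreover have "(\<Sum>i\<le>a. rad_coeff Q (p ^ i) / real (p ^ i)) = 1 / real (p ^ a)"
  proof (induction a)
    case (Suc a)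
    have "real p > 0" using p prime_gt_0_nat by simp
    thus ?case using Suc rad_coeff_prime_power[OF p, of "Suc a" Q] False by (simp add: field_simps)
  qed simp
  ultimately show ?thesis by simp
qed

text \<open>For Q = 1 the convolution of c with the constant 1 gives 1/n, the coefficients of - ln
  (1 - b). For general Q the condition on n div k records that the cofactor f = n div k ranges over
  numbers coprime to Q.\<close>

lemma sum_rad_coeff_divisors:
  assumes "n > 0" "Q > 0"
  shows "(\<Sum>k | k dvd n \<and> coprime (n div k) Q. rad_coeff Q k / real k) = 1 / real n"
  using assms(1)
proof (induction n rule: prime_power_coprime_induct)
  case one
  have "{k::nat. k dvd 1 \<and> coprime (1 div k) Q} = {1}" by auto
  thus ?case by simp
next
  case (mult p a n)
  note p = mult.hyps(1)
  have p0: "p > 0" using p prime_gt_0_nat by simp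
  have cop: "coprime (p ^ i) d" if "d dvd n" for i d
    using that mult.hyps(4) p by (metis coprime_power_left_iff dvd_trans prime_imp_coprime)
  let ?A = "{i. i \<le> a \<and> coprime (p ^ (a - i)) Q}" and ?B = "{k. k dvd n \<and> coprime (n div k) Q}"
  have dv: "p ^ a * n div (p ^ i * d) = p ^ (a - i) * (n div d)" if ia: "i \<le> a" and dn: "d dvd n" for i d
  proof -
    obtain e where e: "n = d * e" using dn by auto
    have "d > 0" using e mult.hyps by (cases d) auto
    have "p ^ a * n = (p ^ i * d) * (p ^ (a - i) * e)" using ia by (simp add: e power_add[symmetric] mult_ac)
    thus ?thesis using e \<open>d > 0\<close> p0 by (metis mult_pos_pos nonzero_mult_div_cancel_left not_gr_zero zero_less_power)
  qed
  have "(\<Sum>k | k dvd p ^ a * n \<and> coprime (p ^ a * n div k) Q. rad_coeff Q k / real k) =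
     (\<Sum>(i, d)\<in>?A \<times> ?B. (rad_coeff Q (p ^ i) / real (p ^ i)) * (rad_coeff Q d / real d))"
  proof (rule sum.reindex_bij_witness[of _ "\<lambda>(i, d). p ^ i * d" "\<lambda>k. (multiplicity p k, k div p ^ multiplicity p k)"])
    fix k assume "k \<in> {k. k dvd p ^ a * n \<and> coprime (p ^ a * n div k) Q}"
    hence k: "k dvd p ^ a * n" "coprime (p ^ a * n div k) Q" by auto
    have k0: "k > 0" using k(1) mult.hyps p0 by (metis dvd_0_left_iff mult_is_0 neq0_conv power_not_zero)
    define i where "i = multiplicity p k"
    have "\<exists>d. k = p ^ i * d \<and> \<not> p dvd d"
      using multiplicity_decompose'[of k p] p k0 unfolding i_def by (metis not_prime_unit neq0_conv)
    then obtain d where d: "k = p ^ i * d" "\<not> p dvd d" by blast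
    have d': "k div p ^ i = d" using d p0 by simp
    have "i \<le> multiplicity p (p ^ a * n)" unfolding i_def
      using k mult.hyps p0 by (intro dvd_imp_multiplicity_le) auto
    also have "multiplicity p (p ^ a * n) = a"
      using mult.hyps p by (subst multiplicity_eqI[of p a]) (auto simp: p0)
    finally have ia: "i \<le> a" .
    have "coprime d (p ^ a)" using d p by (metis coprime_commute coprime_power_left_iff prime_imp_coprime)
    moreover have "d dvd p ^ a * n" using k(1) d(1) dvd_mult_right by blast
    ultimately have dn: "d dvd n" using coprime_dvd_mult_right_iff by blast
    show "(case (multiplicity p k, k div p ^ multiplicity p k) of (i, d) \<Rightarrow> p ^ i * d) = k"
      using d d' by (simp add: i_def)
    have "coprime (p ^ (a - i) * (n div d)) Q" using k(2) dv[OF ia dn] d(1) by simp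
    hence "coprime (p ^ (a - i)) Q" "coprime (n div d) Q" by simp_all
    thus "(multiplicity p k, k div p ^ multiplicity p k) \<in> ?A \<times> ?B"
      using ia dn d' by (simp add: i_def)
    have "d > 0" using d k0 by (cases d) auto
    have "rad_coeff Q k = rad_coeff Q (p ^ i) * rad_coeff Q d"
      unfolding d(1) by (rule rad_coeff_mult_coprime) (use p0 \<open>d > 0\<close> cop[OF dn] in auto)
    moreover have "real k = real (p ^ i) * real d" by (simp only: d(1) of_nat_mult)
    ultimately show "(case (multiplicity p k, k div p ^ multiplicity p k) of (i, d) \<Rightarrow> (rad_coeff Q (p ^ i) / real (p ^ i)) * (rad_coeff Q d / real d)) = rad_coeff Q k / real k"
      by (simp only: i_def[symmetric] case_prod_conv d' times_divide_times_eq)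
  next
    fix b assume "b \<in> ?A \<times> ?B"
    then obtain i d where b: "b = (i, d)" "i \<le> a" "coprime (p ^ (a - i)) Q" "d dvd n" "coprime (n div d) Q" by auto
    have nd: "\<not> p dvd d" using b mult.hyps dvd_trans by blast
    hence mu: "multiplicity p (p ^ i * d) = i" using p p0 by (subst multiplicity_eqI[of p i]) (auto)
    show "(multiplicity p (case b of (i, d) \<Rightarrow> p ^ i * d), (case b of (i, d) \<Rightarrow> p ^ i * d) div p ^ multiplicity p (case b of (i, d) \<Rightarrow> p ^ i * d)) = b"
      using mu b p0 by simp
    have "p ^ i * d dvd p ^ a * n" using b by (intro mult_dvd_mono le_imp_power_dvd)
    moreover have "coprime (p ^ (a - i) * (n div d)) Q" using b by simp
    ultimately show "(case b of (i, d) \<Rightarrow> p ^ i * d) \<in> {k. k dvd p ^ a * n \<and> coprime (p ^ a * n div k) Q}"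
      using b dv by simp
  qed
  also have "\<dots> = (\<Sum>i\<in>?A. rad_coeff Q (p ^ i) / real (p ^ i)) * (\<Sum>d\<in>?B. rad_coeff Q d / real d)"
    by (simp add: sum_product sum.cartesian_product)
  also have "\<dots> = 1 / real (p ^ a * n)"
    unfolding sum_rad_coeff_prime_power[OF p assms(2)] mult.IH by simp
  finally show ?case .
qed

section \<open>Non-vanishing of the singular coefficients\<close>

lemma rep_square_pos:
  assumes "\<nu> > 0" shows "rep \<nu> (n\<^sup>2) > 0"
proof -
  define x where "x = (\<lambda>i::nat. if i = 0 then int n else 0)"
  have "(\<Sum>i<\<nu>. (x i)\<^sup>2) = (\<Sum>i<\<nu>. if i = 0 then (int n)\<^sup>2 else 0)" by (intro sum.cong) (auto simp: x_def)
  also have "\<dots> = (int n)\<^sup>2" using assms by (simp add: sum.delta)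
  finally have "x \<in> {x \<in> int_lattice \<nu>. sq_norm \<nu> x = n\<^sup>2}"
    using assms by (auto simp: int_lattice_def sq_norm_def x_def nat_power_eq)
  thus ?thesis unfolding rep_def using finite_sphere[of \<nu> "n\<^sup>2"] by (metis card_gt_0_iff empty_iff)
qed

text \<open>At the square of n L the exponent nu/2 - 2/3 doubles to nu - 4/3, one third below nu -
  1; that third makes the later series converge.\<close>

lemma rep_square_le:
  assumes "\<nu> \<ge> 2" "L > 0"
  shows "\<exists>C>0. \<forall>n>0. real (rep \<nu> ((n * L)\<^sup>2)) \<le> C * real n powr (real \<nu> - 4/3)"
proof -
  define \<beta> where "\<beta> = real \<nu> / 2 - 2/3"
  obtain C where C: "C > 0" "\<And>n. real (rep \<nu> n) \<le> C * (real n + 1) powr \<beta>"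
    using rep_le[OF assms(1)] unfolding \<beta>_def by auto
  have "real (rep \<nu> ((n * L)\<^sup>2)) \<le> (C * (2 * (real L)\<^sup>2) powr \<beta>) * real n powr (real \<nu> - 4/3)" if n: "n > 0" for n
  proof -
    have "1 \<le> (n * L)\<^sup>2" using n assms by simp
    hence "1 \<le> real ((n * L)\<^sup>2)" by (metis of_nat_1 of_nat_le_iff)
    moreover have "real ((n * L)\<^sup>2) = (real L)\<^sup>2 * (real n)\<^sup>2" by (simp add: power_mult_distrib mult.commute)
    ultimately have "real ((n * L)\<^sup>2) + 1 \<le> 2 * (real L)\<^sup>2 * (real n)\<^sup>2" by linarith
    hence "(real ((n * L)\<^sup>2) + 1) powr \<beta> \<le> (2 * (real L)\<^sup>2 * (real n)\<^sup>2) powr \<beta>"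
      using assms by (intro powr_mono2) (auto simp: \<beta>_def)
    also have "\<dots> = (2 * (real L)\<^sup>2) powr \<beta> * ((real n)\<^sup>2) powr \<beta>" by (rule powr_mult)
    also have "((real n)\<^sup>2) powr \<beta> = real n powr (real \<nu> - 4/3)"
    proof -
      have "((real n)\<^sup>2) powr \<beta> = (real n powr 2) powr \<beta>" using n by simp
      also have "\<dots> = real n powr (2 * \<beta>)" by (rule powr_powr)
      finally show ?thesis by (simp add: \<beta>_def)
    qed
    finally have "C * (real ((n * L)\<^sup>2) + 1) powr \<beta> \<le> C * ((2 * (real L)\<^sup>2) powr \<beta> * real n powr (real \<nu> - 4/3))"
      using C by (intro mult_left_mono) auto
    thus ?thesis using C(2)[of "(n * L)\<^sup>2"] by (simp add: mult.assoc)
  qed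
  thus ?thesis using C assms by (intro exI[of _ "C * (2 * (real L)\<^sup>2) powr \<beta>"]) auto
qed

lemma summable_on_powr:
  assumes "p > 1" shows "(\<lambda>n::nat. real n powr (-p)) summable_on {0<..}"
proof -
  have "summable (\<lambda>n. real n powr (-p))" using assms by (simp add: summable_real_powr_iff)
  hence "summable (\<lambda>n. norm (real n powr (-p)))" by simp
  hence "(\<lambda>n::nat. real n powr (-p)) summable_on UNIV" by (rule norm_summable_imp_summable_on)
  thus ?thesis by (rule summable_on_subset_banach) auto
qed

text \<open>The candidates Q r 2^i with Q = (2 n)! and n <= r <= 2 n have no primes beyond those of
  Q, and consecutive ones have ratio at most 1 + 1/n. Choosing n with 1 + 1/n < b / a places one of
  them in every such interval far enough out.\<close>

lemma smooth_numbers_dense: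
  fixes a b :: real assumes ab: "0 < a" "a < b"
  shows "\<exists>Q>0. \<exists>X. \<forall>x\<ge>X. \<exists>q>0. (\<forall>p. prime p \<longrightarrow> p dvd q \<longleftrightarrow> p dvd Q) \<and> x / b < real q \<and> real q < x / a"
proof -
  obtain n :: nat where n: "1 / (b / a - 1) < real n" using reals_Archimedean2 by blast
  have ba: "b / a - 1 > 0" using ab by (simp add: field_simps)
  hence "0 < 1 / (b / a - 1)" by simp
  hence n0: "n > 0" "real n > 0" using n by (metis of_nat_0_less_iff order_less_trans)+
  have n1: "1 + 1 / real n < b / a" using n ba n0 by (simp add: field_simps)
  define Q where "Q = (fact (2 * n) :: nat)"
  have Q0: "Q > 0" by (simp add: Q_def)
  have "\<exists>q>0. (\<forall>p. prime p \<longrightarrow> p dvd q \<longleftrightarrow> p dvd Q) \<and> x / b < real q \<and> real q < x / a"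
    if x: "x \<ge> b * (real Q * real n)" for x
  proof -
    define y where "y = x / b"
    have y: "y \<ge> real Q * real n" using x ab by (simp add: y_def field_simps)
    have y0: "y > 0" using y Q0 n0 by (smt (verit) mult_pos_pos of_nat_0_less_iff)
    define z where "z = y / (real Q * real n)"
    have z1: "z \<ge> 1" using y Q0 n0 by (simp add: z_def field_simps)
    obtain N where "z < 2 ^ N" using real_arch_pow[of 2 z] by auto
    \<comment> \<open>Fixes i by 2^i <= z < 2^(i + 1), so that y / D lies between n and 2 n.\<close>
    define M where "M = (LEAST N. z < 2 ^ N)"
    have M: "z < 2 ^ M" unfolding M_def by (rule LeastI[of "\<lambda>N. z < 2 ^ N"]) fact
    have "M \<noteq> 0" using M z1 by (cases M) auto
    then obtain i where i: "M = Suc i" by (cases M) auto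
    have lo: "2 ^ i \<le> z" using not_less_Least[of i "\<lambda>N. z < 2 ^ N"] i unfolding M_def by auto
    define D where "D = real Q * 2 ^ i"
    have D0: "D > 0" using Q0 by (simp add: D_def)
    have Dlo: "D * real n \<le> y" using lo Q0 n0 by (simp add: z_def D_def field_simps)
    have Dhi: "y < D * (2 * real n)" using M Q0 n0 by (simp add: z_def D_def i field_simps)
    \<comment> \<open>The least integer strictly above y / D, which makes y < q strict; D <= y / n
      turns the overshoot of at most D into the factor 1 + 1/n.\<close>
    define r where "r = nat \<lfloor>y / D\<rfloor> + 1"
    have "0 \<le> y / D" using y0 D0 by simp
    hence r: "y / D < real r" "real r \<le> y / D + 1" unfolding r_def by linarith+
    have "y / D < 2 * real n" using Dhi D0 by (simp add: field_simps)
    hence r2: "r \<le> 2 * n" unfolding r_def using \<open>0 \<le> y / D\<close> by linarith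
    define q where "q = Q * r * 2 ^ i"
    have rq: "real q = D * real r" by (simp add: q_def D_def)
    have r0: "r > 0" by (simp add: r_def)
    have "p dvd q \<longleftrightarrow> p dvd Q" if p: "prime p" for p
    proof
      assume "p dvd q"
      then consider "p dvd Q" | "p dvd r" | "p dvd 2 ^ i" using p by (auto simp: q_def prime_dvd_mult_iff)
      thus "p dvd Q"
      proof cases
        case 2
        hence "p \<le> 2 * n" using r0 r2 by (meson dvd_imp_le le_trans)
        thus ?thesis unfolding Q_def using p by (simp add: prime_dvd_fact_iff)
      next
        case 3
        hence "p dvd 2" using p prime_dvd_power by blast
        hence "p \<le> 2 * n" using n0 dvd_imp_le[of p 2] by simp
        thus ?thesis unfolding Q_def using p by (simp add: prime_dvd_fact_iff)
      qed
    qed (simp add: q_def)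
    moreover have "y < real q" unfolding rq using r(1) D0 by (simp add: field_simps)
    moreover have "real q < x / a"
    proof -
      have "real q \<le> y + D" unfolding rq using r(2) D0 by (simp add: field_simps)
      also have "D \<le> y / real n" using Dlo n0 by (simp add: field_simps)
      also have "y + y / real n = y * (1 + 1 / real n)" by (simp add: algebra_simps)
      also have "\<dots> < y * (b / a)" using n1 y0 by (intro mult_strict_left_mono) auto
      also have "\<dots> = x / a" using ab by (simp add: y_def)
      finally show ?thesis by simp
    qed
    ultimately show ?thesis using r0 Q0 by (intro exI[of _ q]) (auto simp: y_def q_def)
  qed
  thus ?thesis using Q0 by blast
qed

text \<open>If every admissible sum vanished, it would vanish for j = f L with each f coprime to Q
  and some q having exactly the primes of Q. With weights f^(-nu) the terms become functions of n =
  f k, apart from the factor \<open>rad_coeff Q k / k\<close>, whose sum over k is 1/n by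
  \<open>sum_rad_coeff_divisors\<close>. What remains is the sum of rep ((n L)^2) / n^(nu +
  1).\<close>

lemma nonvanishing_coefficient:
  fixes a b :: real
  assumes \<nu>: "\<nu> \<ge> 2" and ab: "0 < a" "a < b"
  shows "\<exists>j q. j > 0 \<and> q > 0 \<and> coprime j q \<and> a < real j / real q \<and> real j / real q < b \<and>
     (\<Sum>k. rad_coeff 1 (q * Suc k) / real (Suc k) ^ Suc \<nu> * real (rep \<nu> ((Suc k * j)\<^sup>2))) \<noteq> 0"
proof (rule ccontr)
  assume contr: "\<not> ?thesis"
  obtain Q X where Q: "Q > 0" and dense: "\<And>x. x \<ge> X \<Longrightarrow> \<exists>q>0. (\<forall>p. prime p \<longrightarrow> p dvd q \<longleftrightarrow> p dvd Q) \<and> x / b < real q \<and> real q < x / a"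
    using smooth_numbers_dense[OF ab] by blast
  \<comment> \<open>L is at least X, so every multiple f L lies in the range where a suitable q
    exists; and it is 1 modulo Q, so f L is coprime to Q whenever f is.\<close>
  define L where "L = Q * nat \<lceil>X\<rceil> + 1"
  have L: "L > 0" "coprime L Q"
    unfolding L_def by (simp, rule coprimeI) (metis dvd_add_right_iff dvd_mult2)
  have "x \<le> Q * x + 1" for x using Q by (cases Q) auto
  hence "nat \<lceil>X\<rceil> \<le> L" unfolding L_def .
  hence LX: "real L \<ge> X" by linarith
  obtain C where C: "C > 0" "\<And>n. n > 0 \<Longrightarrow> real (rep \<nu> ((n * L)\<^sup>2)) \<le> C * real n powr (real \<nu> - 4/3)"
    using rep_square_le[OF \<nu> L(1)] by blast
  define t where "t = (\<lambda>(f::nat, k::nat). rad_coeff Q k / real k ^ Suc \<nu> * real (rep \<nu> ((f * k * L)\<^sup>2)) / real f ^ \<nu>)"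
  define A where "A = {f::nat. f > 0 \<and> coprime f Q}"
  \<comment> \<open>Exponent 4/3 in both variables: this absolute summability over pairs is what
    permits the rearrangement below.\<close>
  have tbound: "norm (t (f, k)) \<le> C * (real f powr (-(4/3)) * real k powr (-(4/3)))" if "f > 0" "k > 0" for f k
  proof -
    have "norm (t (f, k)) = \<bar>rad_coeff Q k\<bar> / real k ^ Suc \<nu> * real (rep \<nu> ((f * k * L)\<^sup>2)) / real f ^ \<nu>"
      by (simp add: t_def abs_mult)
    also have "\<dots> \<le> real k / real k ^ Suc \<nu> * (C * real (f * k) powr (real \<nu> - 4/3)) / real f ^ \<nu>"
      using that by (intro divide_right_mono mult_mono abs_rad_coeff_le C(2)) auto
    also have "\<dots> = C * (real f powr (real \<nu> - 4/3) / real f ^ \<nu>) * (real k powr (real \<nu> - 4/3) / real k ^ \<nu>)"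
      using that by (simp add: powr_mult mult_ac)
    also have "real f powr (real \<nu> - 4/3) / real f ^ \<nu> = real f powr (-(4/3))"
      using that by (simp add: powr_diff[symmetric] flip: powr_realpow)
    also have "real k powr (real \<nu> - 4/3) / real k ^ \<nu> = real k powr (-(4/3))"
      using that by (simp add: powr_diff[symmetric] flip: powr_realpow)
    finally show ?thesis by (simp add: mult.assoc)
  qed
  have sum43: "(\<lambda>n::nat. real n powr (-(4/3))) summable_on {0<..}" by (rule summable_on_powr) simp
  have "(\<lambda>(f, k). C * (real f powr (-(4/3)) * real k powr (-(4/3)))) summable_on ({0<..} \<times> {0<..})"
  proof (rule summable_on_SigmaI)
    fix f :: nat
    show "((\<lambda>k. case (f, k) of (f, k) \<Rightarrow> C * (real f powr (-(4/3)) * real k powr (-(4/3)))) has_sum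
       C * real f powr (-(4/3)) * infsum (\<lambda>n::nat. real n powr (-(4/3))) {0<..}) {0<..}"
      using has_sum_cmult_right[OF has_sum_infsum[OF sum43], of "C * real f powr (-(4/3))"] by (simp add: mult.assoc)
    show "(\<lambda>f. C * real f powr (-(4/3)) * infsum (\<lambda>n::nat. real n powr (-(4/3))) {0<..}) summable_on {0<..}"
      by (intro summable_on_cmult_left summable_on_cmult_right sum43)
  qed (use C in auto)
  hence "(\<lambda>p. C * (real (fst p) powr (-(4/3)) * real (snd p) powr (-(4/3)))) summable_on ({0<..} \<times> {0<..})"
    by (simp add: case_prod_unfold)
  hence "(\<lambda>p. norm (t p)) summable_on ({0<..} \<times> {0<..})"
    by (rule Infinite_Sum.abs_summable_on_comparison_test') (use tbound in auto)
  hence "t summable_on ({0<..} \<times> {0<..})" by (rule abs_summable_summable)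
  hence tsum: "t summable_on (A \<times> {0<..})" by (rule summable_on_subset_banach) (auto simp: A_def)
  have inner: "((\<lambda>k. t (f, k)) has_sum 0) {0<..}" if f: "f \<in> A" for f
  proof -
    have f0: "f > 0" "coprime f Q" using f by (auto simp: A_def)
    have "L \<le> f * L" using f0 by simp
    hence "real L \<le> real (f * L)" by (simp only: of_nat_le_iff)
    hence "real (f * L) \<ge> X" using LX by linarith
    then obtain q where q: "q > 0" "\<And>p. prime p \<Longrightarrow> p dvd q \<longleftrightarrow> p dvd Q" "real (f * L) / b < real q" "real q < real (f * L) / a"
      using dense by blast
    have "coprime (f * L) q"
    proof (rule ccontr)
      assume "\<not> coprime (f * L) q"
      hence "gcd (f * L) q \<noteq> 1" by (simp add: coprime_iff_gcd_eq_1)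
      then obtain p where "prime p" "p dvd f * L" "p dvd q" using prime_factor_nat by (metis gcd_greatest_iff)
      moreover have "coprime (f * L) Q" using f0 L by simp
      ultimately show False using q(2) coprime_common_divisor not_prime_unit by blast
    qed
    moreover have "a < real (f * L) / real q" "real (f * L) / real q < b" using q ab by (simp_all add: field_simps)
    moreover have "f * L > 0" using f0 L by simp
    ultimately have "(\<Sum>k. rad_coeff 1 (q * Suc k) / real (Suc k) ^ Suc \<nu> * real (rep \<nu> ((Suc k * (f * L))\<^sup>2))) = 0"
      using contr q(1) by blast
    moreover have "rad_coeff 1 (q * Suc k) / real (Suc k) ^ Suc \<nu> * real (rep \<nu> ((Suc k * (f * L))\<^sup>2)) =
       rad_coeff 1 Q * real f ^ \<nu> * t (f, Suc k)" for k
    proof -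
      \<comment> \<open>Equal sets of primes let Q replace q, after which the nonzero constant
        \<open>rad_coeff 1 Q\<close> separates from k.\<close>
      have "rad_coeff 1 (q * Suc k) = rad_coeff 1 (Q * Suc k)"
        by (rule rad_coeff_cong) (use q(2) in \<open>simp only: prime_dvd_mult_iff\<close>)
      also have "\<dots> = rad_coeff 1 Q * rad_coeff Q (Suc k)" by (rule rad_coeff_mult_base) (use Q in auto)
      finally show ?thesis using f0 by (simp add: t_def mult_ac del: power_Suc)
    qed
    ultimately have z: "(\<Sum>k. rad_coeff 1 Q * real f ^ \<nu> * t (f, Suc k)) = 0" by simp
    have sf: "summable (\<lambda>k. norm (t (f, Suc k)))"
    proof (rule summable_comparison_test')
      show "summable (\<lambda>k. C * (real f powr (-(4/3)) * real (Suc k) powr (-(4/3))))"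
        using summable_powr_shift[of "4/3"] by (intro summable_mult) (simp add: add.commute)
      show "norm (norm (t (f, Suc k))) \<le> C * (real f powr (-(4/3)) * real (Suc k) powr (-(4/3)))" for k
        using tbound[of f "Suc k"] f0 by simp
    qed
    have "rad_coeff 1 Q * real f ^ \<nu> * (\<Sum>k. t (f, Suc k)) = 0"
      using z suminf_mult[OF summable_norm_cancel[OF sf], of "rad_coeff 1 Q * real f ^ \<nu>"] by simp
    hence "(\<Sum>k. t (f, Suc k)) = 0" using rad_coeff_nonzero[OF Q, of 1] f0 by simp
    hence "((\<lambda>k. t (f, Suc k)) has_sum 0) UNIV"
      using norm_summable_imp_has_sum[OF sf] summable_sums[OF summable_norm_cancel[OF sf]] by simp
    moreover have "((\<lambda>k. t (f, Suc k)) has_sum 0) UNIV \<longleftrightarrow> ((\<lambda>k. t (f, k)) has_sum 0) {0<..}"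
      by (rule has_sum_reindex_bij_witness[of _ "\<lambda>k. k - 1" Suc]) auto
    ultimately show ?thesis by simp
  qed
  have "(t has_sum 0) (A \<times> {0<..})"
    by (rule has_sum_SigmaI[where g = "\<lambda>_. 0"]) (use inner tsum in auto)
  moreover define u where "u = (\<lambda>(n, k). (rad_coeff Q k / real k) * (real (rep \<nu> ((n * L)\<^sup>2)) / real n ^ \<nu>))"
  moreover define D where "D = (\<lambda>n. {k. k dvd n \<and> coprime (n div k) Q})"
  \<comment> \<open>New index n = f k; D n consists of the divisors k of n whose cofactor f is
    coprime to Q.\<close>
  have "(t has_sum 0) (A \<times> {0<..}) \<longleftrightarrow> (u has_sum 0) (Sigma {0<..} D)"
  proof (rule has_sum_reindex_bij_witness[of _ "\<lambda>(n, k). (n div k, k)" "\<lambda>(f, k). (f * k, k)"])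
    fix p assume "p \<in> A \<times> {0::nat<..}"
    then obtain f k where p: "p = (f, k)" "f > 0" "k > 0" "coprime f Q" by (auto simp: A_def)
    thus "u (case p of (f, k) \<Rightarrow> (f * k, k)) = t p"
      by (simp add: u_def t_def power_mult_distrib mult_ac)
    show "(case (case p of (f, k) \<Rightarrow> (f * k, k)) of (n, k) \<Rightarrow> (n div k, k)) = p" using p by simp
    show "(case p of (f, k) \<Rightarrow> (f * k, k)) \<in> Sigma {0<..} D" using p by (simp add: D_def)
  next
    fix p assume "p \<in> Sigma {0<..} D"
    then obtain n k where p: "p = (n, k)" "n > 0" "k dvd n" "coprime (n div k) Q" by (auto simp: D_def)
    thus "(case (case p of (n, k) \<Rightarrow> (n div k, k)) of (f, k) \<Rightarrow> (f * k, k)) = p" by simp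
    have "k > 0" "n div k > 0" using p by (auto intro!: Nat.gr0I simp: dvd_div_eq_0_iff)
    thus "(case p of (n, k) \<Rightarrow> (n div k, k)) \<in> A \<times> {0<..}" using p by (simp add: A_def)
  qed simp
  ultimately have "(u has_sum 0) (Sigma {0<..} D)" by simp
  hence "((\<lambda>n. real (rep \<nu> ((n * L)\<^sup>2)) / real n ^ Suc \<nu>) has_sum 0) {0<..}"
  proof (rule has_sum_Sigma')
    fix n :: nat assume n: "n \<in> {0<..}"
    have fin: "finite (D n)" unfolding D_def by (rule finite_subset[OF _ finite_divisors_nat[of n]]) (use n in blast, use n in simp)
    have "(\<Sum>k\<in>D n. u (n, k)) = (\<Sum>k\<in>D n. rad_coeff Q k / real k) * (real (rep \<nu> ((n * L)\<^sup>2)) / real n ^ \<nu>)"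
      by (simp only: u_def case_prod_conv sum_distrib_right)
    also have "\<dots> = real (rep \<nu> ((n * L)\<^sup>2)) / real n ^ Suc \<nu>"
      unfolding D_def using n Q by (subst sum_rad_coeff_divisors) auto
    finally show "((\<lambda>k. u (n, k)) has_sum real (rep \<nu> ((n * L)\<^sup>2)) / real n ^ Suc \<nu>) (D n)"
      using has_sum_finite[OF fin, of "\<lambda>k. u (n, k)"] by simp
  qed
  \<comment> \<open>Nonnegative terms with total 0, yet the one at n = 1 is positive.\<close>
  hence "(\<Sum>n\<in>{1::nat}. real (rep \<nu> ((n * L)\<^sup>2)) / real n ^ Suc \<nu>) \<le> 0"
    by (rule finite_sum_le_has_sum) auto
  moreover have "rep \<nu> (L\<^sup>2) > 0" using \<nu> by (intro rep_square_pos) auto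
  ultimately show False by simp
qed

section \<open>Behaviour of the lattice sums near the imaginary axis\<close>

text \<open>The sum W of the overview, in the form grouped by spheres.\<close>

definition lattice_exp_sum :: "nat \<Rightarrow> complex \<Rightarrow> complex" where
  "lattice_exp_sum \<nu> s = (\<Sum>n. of_nat (rep \<nu> n) * exp (- s * complex_of_real (sqrt (real n))))"

text \<open>Uniform in the centre k: on either side of k the terms are among those of one fixed
  convergent series.\<close>

lemma shifted_powr_sums_bounded:
  assumes "p > 1"
  shows "\<exists>Z>0. \<forall>k::nat. summable (\<lambda>n. (1 + \<bar>real n - real k\<bar>) powr (-p)) \<and> (\<Sum>n. (1 + \<bar>real n - real k\<bar>) powr (-p)) \<le> Z"
proof -
  define a where "a = (\<lambda>i::nat. (real i + 1) powr (-p))"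
  have sa: "summable a" unfolding a_def by (rule summable_powr_shift[OF assms])
  have a0: "a i > 0" for i by (simp add: a_def)
  have part: "(\<Sum>n<N. (1 + \<bar>real n - real k\<bar>) powr (-p)) \<le> 2 * suminf a" for N k :: nat
  proof -
    have "(\<Sum>n<N. (1 + \<bar>real n - real k\<bar>) powr (-p)) \<le> (\<Sum>n\<in>{..<k} \<union> {k..<k+N}. (1 + \<bar>real n - real k\<bar>) powr (-p))"
      by (rule sum_mono2) auto
    also have "\<dots> = (\<Sum>n<k. (1 + \<bar>real n - real k\<bar>) powr (-p)) + (\<Sum>n=k..<k+N. (1 + \<bar>real n - real k\<bar>) powr (-p))"
      by (rule sum.union_disjoint) auto
    also have "(\<Sum>n<k. (1 + \<bar>real n - real k\<bar>) powr (-p)) = sum a ((\<lambda>n. k - n) ` {..<k})"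
      by (subst sum.reindex) (auto simp: a_def inj_on_def of_nat_diff algebra_simps intro!: sum.cong)
    also have "\<dots> \<le> suminf a" using a0 by (intro sum_le_suminf sa) (auto intro: less_imp_le)
    also have "(\<Sum>n=k..<k+N. (1 + \<bar>real n - real k\<bar>) powr (-p)) = sum a ((\<lambda>n. n - k) ` {k..<k+N})"
      by (subst sum.reindex) (auto simp: a_def inj_on_def of_nat_diff algebra_simps intro!: sum.cong)
    also have "\<dots> \<le> suminf a" using a0 by (intro sum_le_suminf sa) (auto intro: less_imp_le)
    finally show ?thesis by simp
  qed
  have "summable (\<lambda>n. (1 + \<bar>real n - real k\<bar>) powr (-p))" for k :: nat
    by (rule summableI_nonneg_bounded[OF _ part]) auto
  moreover from this have "(\<Sum>n. (1 + \<bar>real n - real k\<bar>) powr (-p)) \<le> 2 * suminf a" for k :: nat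
    by (intro suminf_le_const part)
  moreover have "suminf a > 0" using a0 by (intro suminf_pos sa) auto
  ultimately show ?thesis by (intro exI[of _ "2 * suminf a"]) auto
qed

text \<open>Here y is the critical squared radius, whose own sphere is left out. At distance d >=
  \<delta> from y, \<open>rep\<close> is at most a constant times ((1 + y) d)^\<beta>, and d^\<beta>
  against d^(-\<alpha>) leaves the exponent - 7/6, summable uniformly in y. The whole sum thus obeys
  the same bound as a single value of \<open>rep\<close> near y.\<close>

lemma rep_away_from_radius_bound:
  assumes \<nu>: "\<nu> \<ge> 2" and \<delta>: "\<delta> > 0"
  shows "\<exists>C>0. \<forall>y\<ge>0. (\<forall>n::nat. real n \<noteq> y \<longrightarrow> \<delta> \<le> \<bar>real n - y\<bar>) \<longrightarrow>
      summable (\<lambda>n. if real n = y then 0 else real (rep \<nu> n) * \<bar>real n - y\<bar> powr (- ((real \<nu> + 1) / 2))) \<and>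
      (\<Sum>n. if real n = y then 0 else real (rep \<nu> n) * \<bar>real n - y\<bar> powr (- ((real \<nu> + 1) / 2))) \<le> C * (1 + y) powr (real \<nu> / 2 - 2/3)"
proof -
  define \<alpha> \<beta> where "\<alpha> = (real \<nu> + 1) / 2" and "\<beta> = real \<nu> / 2 - 2/3"
  have \<beta>: "\<beta> \<ge> 0" "\<beta> + - \<alpha> = - (7/6)" using \<nu> by (simp_all add: \<alpha>_def \<beta>_def field_simps)
  obtain C where C: "C > 0" "\<And>n. real (rep \<nu> n) \<le> C * (real n + 1) powr \<beta>"
    using rep_le[OF \<nu>] unfolding \<beta>_def by auto
  obtain Z where Z: "Z > 0" "\<And>k::nat. summable (\<lambda>n. (1 + \<bar>real n - real k\<bar>) powr (-(7/6)))"
     "\<And>k::nat. (\<Sum>n. (1 + \<bar>real n - real k\<bar>) powr (-(7/6))) \<le> Z"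
    using shifted_powr_sums_bounded[of "7/6"] by auto
  \<comment> \<open>Chosen so that d >= \<delta> implies 1 + d <= A d and 2 + d <= B d.\<close>
  define A B where "A = 1 + 1 / \<delta>" and "B = 1 + 2 / \<delta>"
  have AB: "A > 0" "B > 0" using \<delta> by (simp_all add: A_def B_def add_pos_pos)
  define E where "E = C * A powr \<beta> * B powr (7/6)"
  have E: "E > 0" using C AB by (simp add: E_def)
  have main: "summable (\<lambda>n. if real n = y then 0 else real (rep \<nu> n) * \<bar>real n - y\<bar> powr (- \<alpha>)) \<and>
      (\<Sum>n. if real n = y then 0 else real (rep \<nu> n) * \<bar>real n - y\<bar> powr (- \<alpha>)) \<le> (E * Z) * (1 + y) powr \<beta>"
    if y: "y \<ge> 0" and sp: "\<And>n::nat. real n \<noteq> y \<Longrightarrow> \<delta> \<le> \<bar>real n - y\<bar>" for y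
  proof -
    define f where "f = (\<lambda>n. if real n = y then 0 else real (rep \<nu> n) * \<bar>real n - y\<bar> powr (- \<alpha>))"
    define k where "k = nat \<lfloor>y\<rfloor>"
    have k: "real k \<le> y" "y < real k + 1" unfolding k_def using y by linarith+
    have le: "f n \<le> (E * (1 + y) powr \<beta>) * (1 + \<bar>real n - real k\<bar>) powr (-(7/6))" for n
    proof (cases "real n = y")
      case False
      define d where "d = \<bar>real n - y\<bar>"
      have d: "d \<ge> \<delta>" "d > 0" using sp[OF False] \<delta> by (auto simp: d_def)
      hence d1: "1 \<le> d / \<delta>" using \<delta> by simp
      have dB: "d powr (-(7/6)) \<le> B powr (7/6) * (1 + \<bar>real n - real k\<bar>) powr (-(7/6))"
      proof -
        have "1 + \<bar>real n - real k\<bar> \<le> 2 + d" using k unfolding d_def by linarith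
        also have "\<dots> \<le> B * d"
        proof -
          have "B * d = d + 2 * (d / \<delta>)" by (simp add: B_def algebra_simps)
          thus ?thesis using d1 by linarith
        qed
        finally have "1 + \<bar>real n - real k\<bar> \<le> B * d" .
        hence "(B * d) powr (-(7/6)) \<le> (1 + \<bar>real n - real k\<bar>) powr (-(7/6))" by (intro powr_mono2') auto
        hence "B powr (7/6) * (B powr (-(7/6)) * d powr (-(7/6))) \<le> B powr (7/6) * (1 + \<bar>real n - real k\<bar>) powr (-(7/6))"
          unfolding powr_mult by (intro mult_left_mono) auto
        moreover have "B powr (7/6) * B powr (-(7/6)) = 1" using AB by (simp add: powr_add[symmetric])
        ultimately show ?thesis by (simp flip: mult.assoc)
      qed
      have "real n + 1 \<le> (1 + y) + d" unfolding d_def by linarith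
      also have "\<dots> \<le> (1 + y) * (1 + d)" using y d by (simp add: algebra_simps)
      also have "\<dots> \<le> (1 + y) * (A * d)" using y d1 by (intro mult_left_mono) (auto simp: A_def algebra_simps)
      finally have "(real n + 1) powr \<beta> \<le> ((1 + y) * (A * d)) powr \<beta>" using \<beta> by (intro powr_mono2) auto
      also have "\<dots> = (1 + y) powr \<beta> * (A powr \<beta> * d powr \<beta>)" by (simp only: powr_mult)
      finally have "C * (real n + 1) powr \<beta> \<le> C * ((1 + y) powr \<beta> * (A powr \<beta> * d powr \<beta>))"
        using C by (intro mult_left_mono) auto
      with C(2)[of n] have "real (rep \<nu> n) \<le> C * ((1 + y) powr \<beta> * (A powr \<beta> * d powr \<beta>))" by linarith
      hence "f n \<le> C * ((1 + y) powr \<beta> * (A powr \<beta> * d powr \<beta>)) * d powr (- \<alpha>)"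
        using False by (simp add: f_def d_def mult_right_mono)
      also have "\<dots> = C * (1 + y) powr \<beta> * A powr \<beta> * (d powr \<beta> * d powr (- \<alpha>))" by simp
      also have "d powr \<beta> * d powr (- \<alpha>) = d powr (-(7/6))" by (simp only: powr_add[symmetric] \<beta>(2))
      also have "C * (1 + y) powr \<beta> * A powr \<beta> * d powr (-(7/6)) \<le> C * (1 + y) powr \<beta> * A powr \<beta> * (B powr (7/6) * (1 + \<bar>real n - real k\<bar>) powr (-(7/6)))"
        using dB C by (intro mult_left_mono) auto
      finally show ?thesis by (simp add: E_def mult_ac)
    qed (use E in \<open>simp add: f_def\<close>)
    have f0: "f n \<ge> 0" for n by (simp add: f_def)
    have sm: "summable (\<lambda>n. (E * (1 + y) powr \<beta>) * (1 + \<bar>real n - real k\<bar>) powr (-(7/6)))" by (intro summable_mult Z)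
    have sf: "summable f" by (rule summable_comparison_test'[OF sm]) (use le f0 in auto)
    have "suminf f \<le> (\<Sum>n. (E * (1 + y) powr \<beta>) * (1 + \<bar>real n - real k\<bar>) powr (-(7/6)))"
      by (intro suminf_le le sf sm)
    also have "\<dots> = (E * (1 + y) powr \<beta>) * (\<Sum>n. (1 + \<bar>real n - real k\<bar>) powr (-(7/6)))" by (intro suminf_mult Z)
    also have "\<dots> \<le> (E * (1 + y) powr \<beta>) * Z" using E by (intro mult_left_mono Z) auto
    finally show ?thesis using sf by (simp add: f_def mult_ac)
  qed
  show ?thesis unfolding \<alpha>_def[symmetric] \<beta>_def[symmetric]
    using main E Z by (intro exI[of _ "E * Z"]) auto
qed

text \<open>Complements \<open>norm_sq_add_ge\<close>: near the imaginary axis Re s gives no useful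
  lower bound, but the imaginary part does, away from the critical radius.\<close>

lemma norm_sq_add_ge_Im:
  assumes "x \<ge> 0"
  shows "norm (s\<^sup>2 + complex_of_real (x\<^sup>2)) \<ge> \<bar>(Im s)\<^sup>2 - x\<^sup>2\<bar>"
proof -
  have "s\<^sup>2 + complex_of_real (x\<^sup>2) = (s - \<i> * complex_of_real x) * (s + \<i> * complex_of_real x)"
    by (simp add: power2_eq_square algebra_simps)
  hence "norm (s\<^sup>2 + complex_of_real (x\<^sup>2)) = norm (s - \<i> * complex_of_real x) * norm (s + \<i> * complex_of_real x)"
    by (simp only: norm_mult)
  moreover have "\<bar>Im s - x\<bar> \<le> norm (s - \<i> * complex_of_real x)" "\<bar>Im s + x\<bar> \<le> norm (s + \<i> * complex_of_real x)"
    using abs_Im_le_cmod[of "s - \<i> * complex_of_real x"] abs_Im_le_cmod[of "s + \<i> * complex_of_real x"] by simp_all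
  hence "\<bar>Im s - x\<bar> * \<bar>Im s + x\<bar> \<le> norm (s - \<i> * complex_of_real x) * norm (s + \<i> * complex_of_real x)"
    by (intro mult_mono) auto
  moreover have "\<bar>Im s - x\<bar> * \<bar>Im s + x\<bar> = \<bar>(Im s)\<^sup>2 - x\<^sup>2\<bar>"
    by (simp add: power2_eq_square algebra_simps flip: abs_mult)
  ultimately show ?thesis by linarith
qed

text \<open>The value r (m^2 \<tau>^2) of the overview for \<tau> = j / q in lowest terms; it is 0
  unless m \<tau> is an integer.\<close>

definition rep_at_multiple :: "nat \<Rightarrow> nat \<Rightarrow> nat \<Rightarrow> nat \<Rightarrow> real" where
  "rep_at_multiple \<nu> j q m = (if q dvd m then real (rep \<nu> ((m div q * j)\<^sup>2)) else 0)"

text \<open>In the Poisson formula at s = m (\<sigma> + 2 pi i \<tau>) only the sphere n = (m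
  \<tau>)^2 degenerates as \<sigma> tends to 0, and there s^2 + 4 pi^2 n equals m^2 \<sigma>
  (\<sigma> + 4 pi i \<tau>). All other n have distance at least 1/q^2 from (m \<tau>)^2, so they
  contribute O(m^(nu - 4/3)), times a factor m from s, uniformly in \<sigma>.\<close>

lemma lattice_exp_sum_main_term:
  assumes \<nu>: "\<nu> \<ge> 2" and jq: "j > 0" "q > 0" "coprime j q"
  shows "\<exists>\<kappa>>0. \<exists>C>0. \<forall>m>0. \<forall>\<sigma>. 0 < \<sigma> \<longrightarrow> \<sigma> < 1 \<longrightarrow>
     norm (lattice_exp_sum \<nu> (of_nat m * (of_real \<sigma> + \<i> * of_real (2 * pi * (real j / real q)))) -
       of_real \<kappa> * (of_nat m * (of_real \<sigma> + \<i> * of_real (2 * pi * (real j / real q)))) * of_real (rep_at_multiple \<nu> j q m) *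
         (of_real ((real m)\<^sup>2 * \<sigma>) * (of_real \<sigma> + \<i> * of_real (4 * pi * (real j / real q)))) powr of_real (- ((real \<nu> + 1) / 2)))
     \<le> C * real m powr (real \<nu> - 1/3)"
proof -
  define \<alpha> \<beta> \<tau> where "\<alpha> = (real \<nu> + 1) / 2" and "\<beta> = real \<nu> / 2 - 2/3" and "\<tau> = real j / real q"
  have \<tau>: "\<tau> > 0" using jq by (simp add: \<tau>_def)
  obtain \<kappa> where \<kappa>: "\<kappa> > 0" and pois: "\<And>s. Re s > 0 \<Longrightarrow> lattice_exp_sum \<nu> s =
     complex_of_real \<kappa> * s * (\<Sum>n. of_nat (rep \<nu> n) * (s\<^sup>2 + complex_of_real (4 * pi\<^sup>2 * real n)) powr complex_of_real (- \<alpha>))"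
    using poisson_complex[OF \<nu>] unfolding lattice_exp_sum_def \<alpha>_def by blast
  obtain D where D: "D > 0" and away: "\<And>y. y \<ge> 0 \<Longrightarrow> (\<And>n::nat. real n \<noteq> y \<Longrightarrow> 1 / (real q)\<^sup>2 \<le> \<bar>real n - y\<bar>) \<Longrightarrow>
      summable (\<lambda>n. if real n = y then 0 else real (rep \<nu> n) * \<bar>real n - y\<bar> powr (- \<alpha>)) \<and>
      (\<Sum>n. if real n = y then 0 else real (rep \<nu> n) * \<bar>real n - y\<bar> powr (- \<alpha>)) \<le> D * (1 + y) powr \<beta>"
    using rep_away_from_radius_bound[OF \<nu>, of "1 / (real q)\<^sup>2"] jq unfolding \<alpha>_def \<beta>_def by fastforce
  define C where "C = \<kappa> * (1 + 2 * pi * \<tau>) * (D * (1 + \<tau>\<^sup>2) powr \<beta>)"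
  have "1 + 2 * pi * \<tau> > 0" "1 + \<tau>\<^sup>2 > 0" using \<tau> by (auto intro!: add_pos_pos)
  hence C: "C > 0" using \<kappa> D by (simp add: C_def)
  have "norm (lattice_exp_sum \<nu> (of_nat m * (of_real \<sigma> + \<i> * of_real (2 * pi * \<tau>))) -
       of_real \<kappa> * (of_nat m * (of_real \<sigma> + \<i> * of_real (2 * pi * \<tau>))) * of_real (rep_at_multiple \<nu> j q m) *
         (of_real ((real m)\<^sup>2 * \<sigma>) * (of_real \<sigma> + \<i> * of_real (4 * pi * \<tau>))) powr of_real (- \<alpha>))
     \<le> C * real m powr (real \<nu> - 1/3)" if m: "m > 0" and \<sigma>: "0 < \<sigma>" "\<sigma> < 1" for m \<sigma>
  proof -
    define z where "z = of_nat m * (of_real \<sigma> + \<i> * of_real (2 * pi * \<tau>))"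
    define y where "y = (real m * \<tau>)\<^sup>2"
    have y0: "y \<ge> 0" by (simp add: y_def)
    have z: "Re z = real m * \<sigma>" "Im z = 2 * pi * (real m * \<tau>)" by (simp_all add: z_def)
    have nz: "norm z \<le> real m * (1 + 2 * pi * \<tau>)"
    proof -
      have "norm (of_real \<sigma> + \<i> * of_real (2 * pi * \<tau>)) \<le> norm (of_real \<sigma> :: complex) + norm (\<i> * of_real (2 * pi * \<tau>))"
        by (rule norm_triangle_ineq)
      also have "\<dots> \<le> 1 + 2 * pi * \<tau>" using \<sigma> \<tau> by (simp add: norm_mult)
      finally show ?thesis by (simp add: z_def norm_mult mult_left_mono)
    qed
    have yq: "y * (real q)\<^sup>2 = real ((m * j)\<^sup>2)" using jq by (simp add: y_def \<tau>_def power_mult_distrib power_divide)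
    have dvd: "q dvd m \<and> n = (m div q * j)\<^sup>2" if "real n = y" for n
    proof -
      have "real (n * q\<^sup>2) = real ((m * j)\<^sup>2)" using yq that by simp
      hence e: "n * q\<^sup>2 = (m * j)\<^sup>2" by (simp only: of_nat_eq_iff)
      hence "q\<^sup>2 dvd (m * j)\<^sup>2" by (metis dvd_triv_right)
      hence "q dvd m * j" by (simp add: pow_divides_pow_iff)
      hence qm: "q dvd m" using jq by (metis coprime_commute coprime_dvd_mult_left_iff)
      then obtain r where r: "m = q * r" by auto
      have "n * q\<^sup>2 = (r * j)\<^sup>2 * q\<^sup>2" using e by (simp add: r power_mult_distrib mult_ac)
      hence "n = (r * j)\<^sup>2" using jq by simp
      thus ?thesis using r jq by simp
    qed
    have conv: "real ((m div q * j)\<^sup>2) = y" if "q dvd m"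
    proof -
      from that obtain r where r: "m = q * r" by auto
      thus ?thesis using jq by (simp add: y_def \<tau>_def power_mult_distrib power_divide)
    qed
    have sp: "1 / (real q)\<^sup>2 \<le> \<bar>real n - y\<bar>" if "real n \<noteq> y" for n :: nat
    proof -
      define i where "i = int (n * q\<^sup>2) - int ((m * j)\<^sup>2)"
      have e: "(real n - y) * (real q)\<^sup>2 = real_of_int i"
        using yq by (simp add: i_def left_diff_distrib)
      hence "i \<noteq> 0" using that jq by auto
      hence "1 \<le> real_of_int \<bar>i\<bar>" by simp
      hence "1 \<le> \<bar>(real n - y) * (real q)\<^sup>2\<bar>" unfolding e by simp
      also have "\<bar>(real n - y) * (real q)\<^sup>2\<bar> = \<bar>real n - y\<bar> * (real q)\<^sup>2" by (simp add: abs_mult)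
      finally show ?thesis using jq by (simp add: pos_divide_le_eq)
    qed
    define f where "f = (\<lambda>n. of_nat (rep \<nu> n) * (z\<^sup>2 + complex_of_real (4 * pi\<^sup>2 * real n)) powr complex_of_real (- \<alpha>))"
    define h where "h = (\<lambda>n. if real n = y then 0 else real (rep \<nu> n) * \<bar>real n - y\<bar> powr (- \<alpha>))"
    have h: "summable h" "suminf h \<le> D * (1 + y) powr \<beta>" using away[OF y0 sp] by (simp_all add: h_def)
    define g where "g = (\<lambda>n. if real n = y then 0 else f n)"
    define e where "e = (\<lambda>n. if real n = y then f n else 0)"
    have gh: "norm (g n) \<le> h n" for n
    proof (cases "real n = y")
      case False
      have "pi\<^sup>2 \<ge> 1\<^sup>2" using pi_gt3 by (intro power_mono) auto
      hence "1 * \<bar>real n - y\<bar> \<le> 4 * pi\<^sup>2 * \<bar>real n - y\<bar>" by (intro mult_right_mono) auto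
      also have "\<dots> = \<bar>(Im z)\<^sup>2 - (2 * pi * sqrt (real n))\<^sup>2\<bar>"
      proof -
        have "(Im z)\<^sup>2 - (2 * pi * sqrt (real n))\<^sup>2 = 4 * pi\<^sup>2 * (y - real n)"
          unfolding z y_def by (simp add: power_mult_distrib algebra_simps)
        thus ?thesis by (simp add: abs_mult abs_minus_commute)
      qed
      also have "\<dots> \<le> norm (z\<^sup>2 + complex_of_real ((2 * pi * sqrt (real n))\<^sup>2))" by (intro norm_sq_add_ge_Im) auto
      also have "(2 * pi * sqrt (real n))\<^sup>2 = 4 * pi\<^sup>2 * real n" by (simp add: power_mult_distrib)
      finally have le: "\<bar>real n - y\<bar> \<le> norm (z\<^sup>2 + complex_of_real (4 * pi\<^sup>2 * real n))" by simp
      have "norm (z\<^sup>2 + complex_of_real (4 * pi\<^sup>2 * real n)) powr (- \<alpha>) \<le> \<bar>real n - y\<bar> powr (- \<alpha>)"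
        using False le by (intro powr_mono2') (auto simp: \<alpha>_def)
      hence "real (rep \<nu> n) * norm (z\<^sup>2 + complex_of_real (4 * pi\<^sup>2 * real n)) powr (- \<alpha>) \<le> real (rep \<nu> n) * \<bar>real n - y\<bar> powr (- \<alpha>)"
        by (intro mult_left_mono) auto
      thus ?thesis using False unfolding g_def h_def f_def
        by (simp add: norm_mult norm_powr_real_powr' del: of_real_add of_real_mult of_real_power of_real_minus)
    qed (simp add: g_def h_def)
    have sng: "summable (\<lambda>n. norm (g n))" by (rule summable_comparison_test'[OF h(1)]) (use gh in auto)
    have ng: "norm (suminf g) \<le> D * (1 + y) powr \<beta>"
    proof -
      have "norm (suminf g) \<le> (\<Sum>n. norm (g n))" by (rule summable_norm[OF sng])
      also have "\<dots> \<le> suminf h" by (intro suminf_le gh sng h(1))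
      finally show ?thesis using h(2) by simp
    qed
    have e: "e sums (of_real (rep_at_multiple \<nu> j q m) * (of_real ((real m)\<^sup>2 * \<sigma>) * (of_real \<sigma> + \<i> * of_real (4 * pi * \<tau>))) powr of_real (- \<alpha>))"
    proof (cases "q dvd m")
      case True
      define N where "N = (m div q * j)\<^sup>2"
      have N: "real N = y" using conv[OF True] by (simp add: N_def)
      have "z\<^sup>2 + complex_of_real (4 * pi\<^sup>2 * real N) = of_real ((real m)\<^sup>2 * \<sigma>) * (of_real \<sigma> + \<i> * of_real (4 * pi * \<tau>))"
        unfolding N y_def z_def by (simp add: complex_eq_iff power2_eq_square algebra_simps)
      hence "f N = of_real (rep_at_multiple \<nu> j q m) * (of_real ((real m)\<^sup>2 * \<sigma>) * (of_real \<sigma> + \<i> * of_real (4 * pi * \<tau>))) powr of_real (- \<alpha>)"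
        using True by (simp add: f_def rep_at_multiple_def N_def)
      moreover have "e = (\<lambda>n. if n = N then f N else 0)" unfolding e_def using N by (auto simp: fun_eq_iff)
      ultimately show ?thesis using sums_single[of N "\<lambda>_. f N"] by simp
    next
      case False
      hence "real n \<noteq> y" for n using dvd by blast
      hence "e = (\<lambda>_. 0)" unfolding e_def by simp
      thus ?thesis using False by (simp add: rep_at_multiple_def)
    qed
    have "f = (\<lambda>n. e n + g n)" by (auto simp: e_def g_def)
    hence "suminf f = suminf e + suminf g"
      using suminf_add[OF sums_summable[OF e] summable_norm_cancel[OF sng]] by simp
    hence "lattice_exp_sum \<nu> z = of_real \<kappa> * z * (of_real (rep_at_multiple \<nu> j q m) * (of_real ((real m)\<^sup>2 * \<sigma>) * (of_real \<sigma> + \<i> * of_real (4 * pi * \<tau>))) powr of_real (- \<alpha>)) + of_real \<kappa> * z * suminf g"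
      using pois[of z] z m \<sigma> sums_unique[OF e] by (simp add: f_def algebra_simps)
    hence "norm (lattice_exp_sum \<nu> z - of_real \<kappa> * z * of_real (rep_at_multiple \<nu> j q m) * (of_real ((real m)\<^sup>2 * \<sigma>) * (of_real \<sigma> + \<i> * of_real (4 * pi * \<tau>))) powr of_real (- \<alpha>))
        = norm (of_real \<kappa> * z * suminf g)" by (simp only: mult.assoc add_diff_cancel_left')
    also have "\<dots> = \<kappa> * norm z * norm (suminf g)" using \<kappa> by (simp add: norm_mult)
    also have "\<dots> \<le> \<kappa> * (real m * (1 + 2 * pi * \<tau>)) * (D * (1 + y) powr \<beta>)"
      using \<kappa> nz ng \<tau> by (intro mult_mono) auto
    also have "\<dots> \<le> \<kappa> * (real m * (1 + 2 * pi * \<tau>)) * (D * ((1 + \<tau>\<^sup>2) powr \<beta> * real m powr (real \<nu> - 4/3)))"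
    proof -
      have "1 \<le> (real m)\<^sup>2" using m by simp
      hence "1 + y \<le> (1 + \<tau>\<^sup>2) * (real m)\<^sup>2" by (simp add: y_def power_mult_distrib algebra_simps)
      hence "(1 + y) powr \<beta> \<le> ((1 + \<tau>\<^sup>2) * (real m)\<^sup>2) powr \<beta>"
        using y0 \<nu> by (intro powr_mono2) (auto simp: \<beta>_def)
      also have "\<dots> = (1 + \<tau>\<^sup>2) powr \<beta> * ((real m)\<^sup>2) powr \<beta>" by (rule powr_mult)
      also have "((real m)\<^sup>2) powr \<beta> = (real m powr 2) powr \<beta>" using m by simp
      also have "\<dots> = real m powr (2 * \<beta>)" by (rule powr_powr)
      also have "2 * \<beta> = real \<nu> - 4/3" by (simp add: \<beta>_def)
      finally show ?thesis using \<kappa> D \<tau> by (intro mult_left_mono) auto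
    qed
    also have "\<dots> = C * (real m powr 1 * real m powr (real \<nu> - 4/3))" using m by (simp add: C_def mult_ac)
    also have "real m powr 1 * real m powr (real \<nu> - 4/3) = real m powr (real \<nu> - 1/3)"
      by (subst powr_add[symmetric]) (simp add: field_simps)
    finally show ?thesis by (simp add: z_def)
  qed
  thus ?thesis using \<kappa> C unfolding \<alpha>_def \<tau>_def by blast
qed

section \<open>Growth of the lattice sum in the whole half-plane\<close>

lemma sq_norm_eq_0_iff: "x \<in> int_lattice \<nu> \<Longrightarrow> sq_norm \<nu> x = 0 \<longleftrightarrow> x = (\<lambda>_. 0)"
proof
  assume x: "x \<in> int_lattice \<nu>" "sq_norm \<nu> x = 0"
  hence "(\<Sum>i<\<nu>. (x i)\<^sup>2) = 0" using sum_nonneg[of "{..<\<nu>}" "\<lambda>i. (x i)\<^sup>2"] by (simp add: sq_norm_def)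
  hence "\<forall>i<\<nu>. x i = 0" by (subst (asm) sum_nonneg_eq_0_iff) auto
  thus "x = (\<lambda>_. 0)" using x by (auto simp: int_lattice_def fun_eq_iff) (metis not_le)
qed (simp add: sq_norm_def)

lemma rep_0: "rep \<nu> 0 = 1"
proof -
  have "{x \<in> int_lattice \<nu>. sq_norm \<nu> x = 0} = {\<lambda>_. 0}"
    using sq_norm_eq_0_iff by (auto simp: int_lattice_def sq_norm_def)
  thus ?thesis by (simp add: rep_def)
qed

text \<open>For a <= 1 the term n = 0 of the Poisson formula dominates and gives a times a^(-(nu +
  1)). For a >= 1 a factor exp (1 - a) splits off, because nonzero vectors have norm at least 1, and
  it beats every power.\<close>

lemma lattice_exp_sum_real_bound:
  assumes \<nu>: "\<nu> \<ge> 2"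
  shows "\<exists>C>0. \<forall>a>0. (\<Sum>n. real (rep \<nu> (Suc n)) * exp (- a * sqrt (real (Suc n)))) \<le> C * a powr (- real \<nu>)"
proof -
  define \<alpha> where "\<alpha> = (real \<nu> + 1) / 2"
  define T where "T = (\<lambda>a. \<Sum>n. real (rep \<nu> (Suc n)) * exp (- a * sqrt (real (Suc n))))"
  obtain \<kappa> where \<kappa>: "\<kappa> > 0" and pois: "\<And>s. s > 0 \<Longrightarrow> (\<Sum>n. real (rep \<nu> n) * exp (- s * sqrt (real n))) =
     \<kappa> * s * (\<Sum>n. real (rep \<nu> n) * (s\<^sup>2 + 4 * pi\<^sup>2 * real n) powr (- \<alpha>))"
    using poisson_real[OF \<nu>] unfolding \<alpha>_def by blast
  have sm: "summable (\<lambda>n. real (rep \<nu> (Suc n)) * exp (- a * sqrt (real (Suc n))))" if "a > 0" for a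
    using summable_rep_exp_sqrt[OF \<nu> that] by (subst summable_Suc_iff)
  have T0: "T a \<ge> 0" if "a > 0" for a unfolding T_def by (intro suminf_nonneg sm that) auto
  define Z where "Z = (\<Sum>n. real (rep \<nu> (Suc n)) * (real (Suc n) + 1) powr (- \<alpha>))"
  have sZ: "summable (\<lambda>n. real (rep \<nu> (Suc n)) * (real (Suc n) + 1) powr (- \<alpha>))"
    using summable_rep_powr_shift[OF \<nu>] unfolding \<alpha>_def by (subst summable_Suc_iff)
  have Z0: "Z \<ge> 0" unfolding Z_def by (intro suminf_nonneg sZ) auto
  have small: "T a \<le> \<kappa> * (1 + Z) * a powr (- real \<nu>)" if a: "0 < a" "a \<le> 1" for a
  proof -
    have sp: "summable (\<lambda>n. real (rep \<nu> n) * (a\<^sup>2 + 4 * pi\<^sup>2 * real n) powr (- \<alpha>))"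
      unfolding \<alpha>_def using a by (intro summable_rep_powr \<nu>) auto
    have "T a \<le> (\<Sum>n. real (rep \<nu> n) * exp (- a * sqrt (real n)))"
      using suminf_split_head[OF summable_rep_exp_sqrt[OF \<nu> a(1)]] by (simp add: T_def rep_0)
    also have "\<dots> = \<kappa> * a * (\<Sum>n. real (rep \<nu> n) * (a\<^sup>2 + 4 * pi\<^sup>2 * real n) powr (- \<alpha>))" by (rule pois[OF a(1)])
    also have "(\<Sum>n. real (rep \<nu> n) * (a\<^sup>2 + 4 * pi\<^sup>2 * real n) powr (- \<alpha>)) =
       (\<Sum>n. real (rep \<nu> (Suc n)) * (a\<^sup>2 + 4 * pi\<^sup>2 * real (Suc n)) powr (- \<alpha>)) + (a\<^sup>2) powr (- \<alpha>)"
      using suminf_split_head[OF sp] by (simp add: rep_0)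
    also have "(\<Sum>n. real (rep \<nu> (Suc n)) * (a\<^sup>2 + 4 * pi\<^sup>2 * real (Suc n)) powr (- \<alpha>)) \<le> Z"
      unfolding Z_def
    proof (intro suminf_le sZ)
      show "summable (\<lambda>n. real (rep \<nu> (Suc n)) * (a\<^sup>2 + 4 * pi\<^sup>2 * real (Suc n)) powr (- \<alpha>))"
        using sp by (subst summable_Suc_iff)
      fix n :: nat
      have "pi\<^sup>2 \<ge> 1\<^sup>2" using pi_gt3 by (intro power_mono) auto
      hence "4 * real (Suc n) \<le> 4 * pi\<^sup>2 * real (Suc n)" by (intro mult_right_mono) auto
      moreover have "real (Suc n) + 1 \<le> 4 * real (Suc n)" by simp
      ultimately have "real (Suc n) + 1 \<le> a\<^sup>2 + 4 * pi\<^sup>2 * real (Suc n)" by (smt (verit) zero_le_power2)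
      thus "real (rep \<nu> (Suc n)) * (a\<^sup>2 + 4 * pi\<^sup>2 * real (Suc n)) powr (- \<alpha>) \<le> real (rep \<nu> (Suc n)) * (real (Suc n) + 1) powr (- \<alpha>)"
        by (intro mult_left_mono powr_mono2') (auto simp: \<alpha>_def)
    qed
    also have "(a\<^sup>2) powr (- \<alpha>) = (a powr 2) powr (- \<alpha>)" using a by simp
    also have "\<dots> = a powr (2 * - \<alpha>)" by (rule powr_powr)
    finally have "T a \<le> \<kappa> * a * (Z + a powr (2 * - \<alpha>))" using \<kappa> a by simp
    also have "\<dots> = \<kappa> * (a * Z + a powr 1 * a powr (2 * - \<alpha>))" using a by (simp add: algebra_simps)
    also have "a powr 1 * a powr (2 * - \<alpha>) = a powr (- real \<nu>)" 
    proof -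
      have "1 + 2 * - \<alpha> = - real \<nu>" by (simp add: \<alpha>_def field_simps)
      thus ?thesis by (simp only: powr_add[symmetric])
    qed
    also have "a * Z \<le> a powr (- real \<nu>) * Z"
    proof (intro mult_right_mono Z0)
      have "a \<le> 1" by fact
      also have "1 \<le> a powr (- real \<nu>)" using a powr_mono2'[of "- real \<nu>" a 1] by simp
      finally show "a \<le> a powr (- real \<nu>)" .
    qed
    finally show ?thesis using \<kappa> by (simp add: algebra_simps)
  qed
  have large: "T a \<le> T 1 * (exp 1 * fact \<nu>) * a powr (- real \<nu>)" if a: "a \<ge> 1" for a
  proof -
    have "T a \<le> (\<Sum>n. exp (1 - a) * (real (rep \<nu> (Suc n)) * exp (- 1 * sqrt (real (Suc n)))))"
      unfolding T_def
    proof (intro suminf_le sm summable_mult)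
      fix n
      have "(a - 1) * 1 \<le> (a - 1) * sqrt (real (Suc n))" using a by (intro mult_left_mono) auto
      hence "- a * sqrt (real (Suc n)) \<le> (1 - a) + - 1 * sqrt (real (Suc n))" by (simp add: algebra_simps)
      hence "exp (- a * sqrt (real (Suc n))) \<le> exp (1 - a) * exp (- 1 * sqrt (real (Suc n)))"
        by (simp only: exp_le_cancel_iff flip: exp_add)
      thus "real (rep \<nu> (Suc n)) * exp (- a * sqrt (real (Suc n))) \<le> exp (1 - a) * (real (rep \<nu> (Suc n)) * exp (- 1 * sqrt (real (Suc n))))"
        by (subst mult.left_commute) (rule mult_left_mono, auto)
    qed (use a in auto)
    also have "\<dots> = exp (1 - a) * T 1" unfolding T_def by (intro suminf_mult sm) auto
    also have "exp (1 - a) \<le> exp 1 * fact \<nu> * a powr (- real \<nu>)"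
    proof -
      have "a ^ \<nu> / fact \<nu> \<le> exp a"
        using a sum_le_suminf[OF summable_exp_generic[of a], of "{\<nu>}"] by (simp add: exp_def divide_inverse mult.commute)
      hence "exp (- a) \<le> fact \<nu> / a ^ \<nu>" using a by (simp add: exp_minus field_simps)
      thus ?thesis using a by (simp add: exp_diff exp_minus powr_minus powr_realpow field_simps)
    qed
    finally show ?thesis using T0[of 1] by (simp add: mult_right_mono mult_ac)
  qed
  define C where "C = \<kappa> * (1 + Z) + T 1 * (exp 1 * fact \<nu>)"
  have pos: "\<kappa> * (1 + Z) > 0" "T 1 * (exp 1 * fact \<nu>) \<ge> 0" using \<kappa> Z0 T0[of 1] by auto
  have "T a \<le> C * a powr (- real \<nu>)" if "a > 0" for a
  proof (cases "a \<le> 1")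
    case True
    have "T a \<le> \<kappa> * (1 + Z) * a powr (- real \<nu>)" using small that True by auto
    also have "\<dots> \<le> C * a powr (- real \<nu>)" using pos by (intro mult_right_mono) (auto simp: C_def)
    finally show ?thesis .
  next
    case False
    hence "T a \<le> T 1 * (exp 1 * fact \<nu>) * a powr (- real \<nu>)" using large by auto
    also have "\<dots> \<le> C * a powr (- real \<nu>)" using pos by (intro mult_right_mono) (auto simp: C_def)
    finally show ?thesis .
  qed
  moreover have "C > 0" unfolding C_def by (rule add_pos_nonneg[OF pos])
  ultimately show ?thesis unfolding T_def by blast
qed

lemma lattice_exp_sum_minus_1:
  assumes \<nu>: "\<nu> \<ge> 2" and s: "Re s > 0"
  shows "summable (\<lambda>n. norm (of_nat (rep \<nu> (Suc n)) * exp (- s * complex_of_real (sqrt (real (Suc n))))))"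
    and "lattice_exp_sum \<nu> s - 1 = (\<Sum>n. of_nat (rep \<nu> (Suc n)) * exp (- s * complex_of_real (sqrt (real (Suc n)))))"
    and "norm (lattice_exp_sum \<nu> s - 1) \<le> (\<Sum>n. real (rep \<nu> (Suc n)) * exp (- Re s * sqrt (real (Suc n))))"
proof -
  have n: "norm (of_nat (rep \<nu> n) * exp (- s * complex_of_real (sqrt (real n)))) = real (rep \<nu> n) * exp (- Re s * sqrt (real n))" for n
    by (simp add: norm_mult)
  have sm: "summable (\<lambda>n. norm (of_nat (rep \<nu> n) * exp (- s * complex_of_real (sqrt (real n)))))"
    unfolding n by (rule summable_rep_exp_sqrt[OF \<nu> s])
  thus s1: "summable (\<lambda>n. norm (of_nat (rep \<nu> (Suc n)) * exp (- s * complex_of_real (sqrt (real (Suc n))))))"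
    by (subst summable_Suc_iff)
  show e: "lattice_exp_sum \<nu> s - 1 = (\<Sum>n. of_nat (rep \<nu> (Suc n)) * exp (- s * complex_of_real (sqrt (real (Suc n)))))"
    unfolding lattice_exp_sum_def using suminf_split_head[OF summable_norm_cancel[OF sm]] by (simp add: rep_0)
  show "norm (lattice_exp_sum \<nu> s - 1) \<le> (\<Sum>n. real (rep \<nu> (Suc n)) * exp (- Re s * sqrt (real (Suc n))))"
    unfolding e using summable_norm[OF s1] unfolding n .
qed

section \<open>The logarithmic series and its radial limits\<close>

definition log_zeta_series :: "nat \<Rightarrow> complex \<Rightarrow> complex" where
  "log_zeta_series \<nu> s =
     (\<Sum>i. of_real (rad_coeff 1 (Suc i) / real (Suc i)) * (lattice_exp_sum \<nu> (of_nat (Suc i) * s) - 1))"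

lemma abs_rad_coeff_div_le: "\<bar>rad_coeff 1 (Suc i) / real (Suc i)\<bar> \<le> 1"
  using abs_rad_coeff_le[of "Suc i" 1] by simp

lemma summable_powr_Suc: "p > 1 \<Longrightarrow> summable (\<lambda>i. real (Suc i) powr (- p))"
  using summable_powr_shift[of p] by (simp add: add.commute)

lemma lattice_exp_sum_bound:
  assumes \<nu>: "\<nu> \<ge> 2"
  shows "\<exists>C>0. \<forall>s. Re s > 0 \<longrightarrow> norm (lattice_exp_sum \<nu> s - 1) \<le> C * Re s powr (- real \<nu>)"
proof -
  obtain C where C: "C > 0" "\<And>a. a > 0 \<Longrightarrow> (\<Sum>n. real (rep \<nu> (Suc n)) * exp (- a * sqrt (real (Suc n)))) \<le> C * a powr (- real \<nu>)"
    using lattice_exp_sum_real_bound[OF \<nu>] by blast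
  have "norm (lattice_exp_sum \<nu> s - 1) \<le> C * Re s powr (- real \<nu>)" if "Re s > 0" for s
    using lattice_exp_sum_minus_1(3)[OF \<nu> that] C(2)[OF that] by (rule order_trans)
  thus ?thesis using C(1) by blast
qed

lemma summable_log_zeta_series:
  assumes \<nu>: "\<nu> \<ge> 2" and s: "Re s > 0"
  shows "summable (\<lambda>i. norm (of_real (rad_coeff 1 (Suc i) / real (Suc i)) * (lattice_exp_sum \<nu> (of_nat (Suc i) * s) - 1)))"
proof -
  obtain C where C: "C > 0" "\<And>s. Re s > 0 \<Longrightarrow> norm (lattice_exp_sum \<nu> s - 1) \<le> C * Re s powr (- real \<nu>)"
    using lattice_exp_sum_bound[OF \<nu>] by blast
  have "summable (\<lambda>i. (C * Re s powr (- real \<nu>)) * real (Suc i) powr (- real \<nu>))"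
    using \<nu> by (intro summable_mult summable_powr_Suc) auto
  thus ?thesis
  proof (rule summable_comparison_test')
    fix i :: nat
    have "Re (of_nat (Suc i) * s) > 0" using s by simp
    from C(2)[OF this] have "norm (lattice_exp_sum \<nu> (of_nat (Suc i) * s) - 1) \<le> C * (real (Suc i) * Re s) powr (- real \<nu>)"
      by simp
    also have "\<dots> = (C * Re s powr (- real \<nu>)) * real (Suc i) powr (- real \<nu>)" by (simp only: powr_mult mult_ac)
    finally have "norm (lattice_exp_sum \<nu> (of_nat (Suc i) * s) - 1) \<le> (C * Re s powr (- real \<nu>)) * real (Suc i) powr (- real \<nu>)" .
    moreover have "\<bar>rad_coeff 1 (Suc i) / real (Suc i)\<bar> * norm (lattice_exp_sum \<nu> (of_nat (Suc i) * s) - 1) \<le> 1 * norm (lattice_exp_sum \<nu> (of_nat (Suc i) * s) - 1)"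
      by (intro mult_right_mono abs_rad_coeff_div_le) auto
    ultimately show "norm (norm (of_real (rad_coeff 1 (Suc i) / real (Suc i)) * (lattice_exp_sum \<nu> (of_nat (Suc i) * s) - 1)))
        \<le> (C * Re s powr (- real \<nu>)) * real (Suc i) powr (- real \<nu>)"
      unfolding norm_mult norm_of_real by (simp del: of_nat_Suc)
  qed
qed

lemma rep_at_multiple_le:
  assumes \<nu>: "\<nu> \<ge> 2" and jq: "j > 0" "q > 0"
  shows "\<exists>C>0. \<forall>m>0. rep_at_multiple \<nu> j q m \<le> C * real m powr (real \<nu> - 4/3)"
proof -
  obtain C where C: "C > 0" "\<And>n. n > 0 \<Longrightarrow> real (rep \<nu> ((n * j)\<^sup>2)) \<le> C * real n powr (real \<nu> - 4/3)"
    using rep_square_le[OF \<nu> jq(1)] by blast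
  have "rep_at_multiple \<nu> j q m \<le> C * real m powr (real \<nu> - 4/3)" if m: "m > 0" for m
  proof (cases "q dvd m")
    case True
    hence "m div q > 0" using m jq by (auto simp: dvd_div_eq_0_iff intro!: Nat.gr0I)
    hence "rep_at_multiple \<nu> j q m \<le> C * real (m div q) powr (real \<nu> - 4/3)" using C(2) True by (simp add: rep_at_multiple_def)
    also have "\<dots> \<le> C * real m powr (real \<nu> - 4/3)"
      using C \<nu> by (intro mult_left_mono powr_mono2) auto
    finally show ?thesis .
  qed (use C in \<open>simp add: rep_at_multiple_def\<close>)
  thus ?thesis using C by blast
qed

lemma summable_rep_at_multiple:
  assumes \<nu>: "\<nu> \<ge> 2" and jq: "j > 0" "q > 0"
  shows "summable (\<lambda>i. rad_coeff 1 (Suc i) / real (Suc i) ^ Suc \<nu> * rep_at_multiple \<nu> j q (Suc i))"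
proof -
  define \<rho> where "\<rho> = rep_at_multiple \<nu> j q"
  define b where "b = (\<lambda>i. rad_coeff 1 (Suc i) / real (Suc i) ^ Suc \<nu> * \<rho> (Suc i))"
  obtain C5 where C5: "C5 > 0" "\<And>m. m > 0 \<Longrightarrow> \<rho> m \<le> C5 * real m powr (real \<nu> - 4/3)"
    using rep_at_multiple_le[OF \<nu> jq(1,2)] unfolding \<rho>_def by blast
  have \<rho>0: "\<rho> m \<ge> 0" for m by (simp add: \<rho>_def rep_at_multiple_def)
  define c where "c = (\<lambda>i. rad_coeff 1 (Suc i) / real (Suc i))"
  have c1: "\<bar>c i\<bar> \<le> 1" for i unfolding c_def by (rule abs_rad_coeff_div_le)
  have "summable (\<lambda>i. C5 * real (Suc i) powr (-(4/3)))" by (intro summable_mult summable_powr_Suc) auto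
  hence sb: "summable b"
  proof (rule summable_comparison_test')
    fix i :: nat
    have "norm (b i) = \<bar>c i\<bar> * (\<rho> (Suc i) / real (Suc i) ^ \<nu>)"
      using \<rho>0 by (simp add: b_def c_def abs_mult del: of_nat_Suc)
    also have "\<dots> \<le> 1 * (C5 * real (Suc i) powr (real \<nu> - 4/3) / real (Suc i) ^ \<nu>)"
      using \<rho>0 C5(2)[of "Suc i"] by (intro mult_mono c1 divide_right_mono) auto
    also have "\<dots> = C5 * (real (Suc i) powr (real \<nu> - 4/3) / real (Suc i) powr real \<nu>)" by (simp add: powr_realpow del: of_nat_Suc)
    also have "\<dots> = C5 * real (Suc i) powr (-(4/3))" by (simp add: powr_diff[symmetric] del: of_nat_Suc)
    finally show "norm (b i) \<le> C5 * real (Suc i) powr (-(4/3))" .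
  qed
  thus ?thesis by (simp add: b_def \<rho>_def)
qed

text \<open>Tannery's theorem needs a majorant free of \<sigma>. For small m the expansion by
  Poisson summation has error O(\<sigma>^\<alpha> m^(nu - 1/3)); for large m the plain bound
  \<sigma>^\<alpha> (m \<sigma>)^(-nu) is better. Switching at \<sigma> = m^(-x) makes both
  summable.\<close>

lemma log_zeta_radial_limit:
  assumes \<nu>: "\<nu> \<ge> 2" and jq: "j > 0" "q > 0" "coprime j q"
  shows "\<exists>\<kappa>>0. ((\<lambda>\<sigma>. of_real (\<sigma> powr ((real \<nu> + 1) / 2)) * log_zeta_series \<nu> (of_real \<sigma> + \<i> * of_real (2 * pi * (real j / real q)))) \<longlongrightarrow>
     of_real \<kappa> * (\<i> * of_real (2 * pi * (real j / real q))) * (\<i> * of_real (4 * pi * (real j / real q))) powr of_real (- ((real \<nu> + 1) / 2)) *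
       of_real (\<Sum>i. rad_coeff 1 (Suc i) / real (Suc i) ^ Suc \<nu> * rep_at_multiple \<nu> j q (Suc i))) (at_right 0)"
proof -
  define \<alpha> \<tau> where "\<alpha> = (real \<nu> + 1) / 2" and "\<tau> = real j / real q"
  define \<rho> where "\<rho> = rep_at_multiple \<nu> j q"
  have \<tau>: "\<tau> > 0" using jq by (simp add: \<tau>_def)
  have \<alpha>: "\<alpha> > 0" by (simp add: \<alpha>_def)
  define s where "s = (\<lambda>\<sigma>. of_real \<sigma> + \<i> * of_real (2 * pi * \<tau>))"
  define w where "w = (\<lambda>\<sigma>. of_real \<sigma> + \<i> * of_real (4 * pi * \<tau>))"
  obtain \<kappa> C where \<kappa>: "\<kappa> > 0" and C: "C > 0" and main: "\<And>m \<sigma>. m > 0 \<Longrightarrow> 0 < \<sigma> \<Longrightarrow> \<sigma> < 1 \<Longrightarrow>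
     norm (lattice_exp_sum \<nu> (of_nat m * s \<sigma>) - of_real \<kappa> * (of_nat m * s \<sigma>) * of_real (\<rho> m) * (of_real ((real m)\<^sup>2 * \<sigma>) * w \<sigma>) powr of_real (- \<alpha>))
     \<le> C * real m powr (real \<nu> - 1/3)"
    using lattice_exp_sum_main_term[OF \<nu> jq] unfolding \<alpha>_def[symmetric] \<tau>_def[symmetric] \<rho>_def[symmetric] s_def w_def by blast
  obtain C4 where C4: "C4 > 0" "\<And>s. Re s > 0 \<Longrightarrow> norm (lattice_exp_sum \<nu> s - 1) \<le> C4 * Re s powr (- real \<nu>)"
    using lattice_exp_sum_bound[OF \<nu>] by blast
  obtain C5 where C5: "C5 > 0" "\<And>m. m > 0 \<Longrightarrow> \<rho> m \<le> C5 * real m powr (real \<nu> - 4/3)"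
    using rep_at_multiple_le[OF \<nu> jq(1,2)] unfolding \<rho>_def by blast
  have \<rho>0: "\<rho> m \<ge> 0" for m by (simp add: \<rho>_def rep_at_multiple_def)
  define c where "c = (\<lambda>i. rad_coeff 1 (Suc i) / real (Suc i))"
  have c1: "\<bar>c i\<bar> \<le> 1" for i unfolding c_def by (rule abs_rad_coeff_div_le)
  define lam where "lam = of_real \<kappa> * (\<i> * of_real (2 * pi * \<tau>)) * (\<i> * of_real (4 * pi * \<tau>)) powr of_real (- \<alpha>)"
  define a where "a = (\<lambda>i \<sigma>. of_real (\<sigma> powr \<alpha>) * (of_real (c i) * (lattice_exp_sum \<nu> (of_nat (Suc i) * s \<sigma>) - 1)))"
  define b where "b = (\<lambda>i. rad_coeff 1 (Suc i) / real (Suc i) ^ Suc \<nu> * \<rho> (Suc i))"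
  define M0 where "M0 = (\<lambda>m \<sigma>. of_real \<kappa> * (of_nat m * s \<sigma>) * of_real (\<rho> m) * (of_real (real m powr (- (real \<nu> + 1))) * w \<sigma> powr of_real (- \<alpha>)))"
  have m2\<alpha>: "((real m)\<^sup>2) powr (- \<alpha>) = real m powr (- (real \<nu> + 1))" if "m > 0" for m
  proof -
    have "(real m)\<^sup>2 = real m powr 2" using that by (simp add: powr_numeral)
    hence "((real m)\<^sup>2) powr (- \<alpha>) = (real m powr 2) powr (- \<alpha>)" by (simp only:)
    also have "\<dots> = real m powr (2 * - \<alpha>)" by (rule powr_powr)
    also have "2 * - \<alpha> = - (real \<nu> + 1)" by (simp add: \<alpha>_def field_simps)
    finally show ?thesis .
  qed
  have M0: "of_real (\<sigma> powr \<alpha>) * (of_real \<kappa> * (of_nat m * s \<sigma>) * of_real (\<rho> m) * (of_real ((real m)\<^sup>2 * \<sigma>) * w \<sigma>) powr of_real (- \<alpha>)) = M0 m \<sigma>"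
    if "m > 0" "\<sigma> > 0" for m \<sigma>
  proof -
    have "(of_real ((real m)\<^sup>2 * \<sigma>) * w \<sigma>) powr of_real (- \<alpha>) = of_real ((real m)\<^sup>2 * \<sigma>) powr of_real (- \<alpha>) * w \<sigma> powr of_real (- \<alpha>)"
      by (rule powr_times_real_left) (use that in auto)
    also have "of_real ((real m)\<^sup>2 * \<sigma>) powr of_real (- \<alpha>) = complex_of_real (((real m)\<^sup>2 * \<sigma>) powr (- \<alpha>))"
      by (rule powr_of_real) (use that in auto)
    also have "((real m)\<^sup>2 * \<sigma>) powr (- \<alpha>) = real m powr (- (real \<nu> + 1)) * \<sigma> powr (- \<alpha>)"
      using m2\<alpha>[OF that(1)] by (simp only: powr_mult)
    finally have e: "(of_real ((real m)\<^sup>2 * \<sigma>) * w \<sigma>) powr of_real (- \<alpha>) = of_real (real m powr (- (real \<nu> + 1))) * of_real (\<sigma> powr (- \<alpha>)) * w \<sigma> powr of_real (- \<alpha>)"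
      by (simp only: of_real_mult)
    have "\<sigma> powr \<alpha> * \<sigma> powr (- \<alpha>) = 1" using that by (simp add: powr_add[symmetric])
    hence "complex_of_real (\<sigma> powr \<alpha>) * of_real (\<sigma> powr (- \<alpha>)) = 1" by (metis of_real_mult of_real_1)
    thus ?thesis unfolding e M0_def by (simp add: mult_ac)
  qed
  have err: "norm (a i \<sigma> - of_real (c i) * M0 (Suc i) \<sigma>) \<le> \<sigma> powr \<alpha> * ((C + 1) * real (Suc i) powr (real \<nu> - 1/3))"
    if \<sigma>: "0 < \<sigma>" "\<sigma> < 1" for i \<sigma>
  proof -
    define e where "e = lattice_exp_sum \<nu> (of_nat (Suc i) * s \<sigma>) - of_real \<kappa> * (of_nat (Suc i) * s \<sigma>) * of_real (\<rho> (Suc i)) * (of_real ((real (Suc i))\<^sup>2 * \<sigma>) * w \<sigma>) powr of_real (- \<alpha>)"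
    have ne: "norm e \<le> C * real (Suc i) powr (real \<nu> - 1/3)" unfolding e_def by (rule main) (use \<sigma> in auto)
    have "a i \<sigma> - of_real (c i) * M0 (Suc i) \<sigma> = of_real (c i) * (of_real (\<sigma> powr \<alpha>) * (e - 1))"
    proof -
      have "P * (c' * (X - 1)) - c' * (P * Y) = c' * (P * (X - Y - 1))" for P c' X Y :: complex by (simp add: algebra_simps)
      thus ?thesis unfolding M0[OF zero_less_Suc \<sigma>(1), symmetric] a_def e_def .
    qed
    hence "norm (a i \<sigma> - of_real (c i) * M0 (Suc i) \<sigma>) = \<bar>c i\<bar> * (\<sigma> powr \<alpha> * norm (e - 1))" by (simp add: norm_mult)
    also have "\<dots> \<le> 1 * (\<sigma> powr \<alpha> * (C * real (Suc i) powr (real \<nu> - 1/3) + 1 * real (Suc i) powr (real \<nu> - 1/3)))"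
    proof (intro mult_mono c1 order_refl)
      have "1 \<le> real (Suc i) powr (real \<nu> - 1/3)" using \<nu> by (intro ge_one_powr_ge_zero) auto
      moreover have "norm (e - 1) \<le> norm e + 1" using norm_triangle_ineq4[of e 1] by simp
      ultimately show "norm (e - 1) \<le> C * real (Suc i) powr (real \<nu> - 1/3) + 1 * real (Suc i) powr (real \<nu> - 1/3)" using ne by linarith
    qed (auto intro!: mult_nonneg_nonneg)
    finally show ?thesis by (simp add: distrib_right del: of_nat_Suc)
  qed
  have powr0: "((\<lambda>\<sigma>. \<sigma> powr \<alpha>) \<longlongrightarrow> 0) (at_right 0)"
    using \<alpha> by real_asymp
  have lim: "((\<lambda>\<sigma>. a i \<sigma>) \<longlongrightarrow> lam * of_real (b i)) (at_right 0)" for i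
  proof -
    \<comment> \<open>w 0 is a nonzero imaginary number, off the branch cut, so the power is
      continuous there.\<close>
    have w0: "w 0 \<notin> \<real>\<^sub>\<le>\<^sub>0" using \<tau> by (auto simp: w_def complex_nonpos_Reals_iff)
    have ws: "(w \<longlongrightarrow> w 0) (at_right 0)" "(s \<longlongrightarrow> s 0) (at_right 0)"
      unfolding w_def s_def by (intro tendsto_intros)+
    have "((\<lambda>\<sigma>. of_real (c i) * M0 (Suc i) \<sigma>) \<longlongrightarrow> of_real (c i) * M0 (Suc i) 0) (at_right 0)"
      unfolding M0_def by (intro tendsto_intros tendsto_powr_complex ws w0)
    moreover have "of_real (c i) * M0 (Suc i) 0 = lam * of_real (b i)"
    proof -
      have "real (Suc i) ^ Suc \<nu> = real (Suc i) powr (real \<nu> + 1)"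
        using powr_realpow[of "real (Suc i)" "Suc \<nu>"] by (simp add: add.commute)
      hence "real (Suc i) powr (- (real \<nu> + 1)) = 1 / real (Suc i) ^ Suc \<nu>" by (simp only: powr_minus_divide)
      hence bi: "b i = c i * real (Suc i) * \<rho> (Suc i) * real (Suc i) powr (- (real \<nu> + 1))"
        by (simp add: c_def b_def del: of_nat_Suc power_Suc)
      have "of_real (b i) = of_real (c i) * of_nat (Suc i) * of_real (\<rho> (Suc i)) * (of_real (real (Suc i) powr (- (real \<nu> + 1))) :: complex)"
        unfolding bi by (simp only: of_real_mult of_real_of_nat_eq)
      thus ?thesis by (simp add: M0_def lam_def s_def w_def mult_ac del: of_nat_Suc)
    qed
    moreover have "((\<lambda>\<sigma>. a i \<sigma> - of_real (c i) * M0 (Suc i) \<sigma>) \<longlongrightarrow> 0) (at_right 0)"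
    proof (rule Lim_null_comparison)
      show "\<forall>\<^sub>F \<sigma> in at_right 0. norm (a i \<sigma> - of_real (c i) * M0 (Suc i) \<sigma>) \<le> \<sigma> powr \<alpha> * ((C + 1) * real (Suc i) powr (real \<nu> - 1/3))"
        using eventually_at_right_real[OF zero_less_one] by eventually_elim (use err in auto)
      show "((\<lambda>\<sigma>. \<sigma> powr \<alpha> * ((C + 1) * real (Suc i) powr (real \<nu> - 1/3))) \<longlongrightarrow> 0) (at_right 0)"
        using tendsto_mult_left_zero[OF powr0] by simp
    qed
    ultimately show ?thesis using tendsto_add[of "\<lambda>\<sigma>. of_real (c i) * M0 (Suc i) \<sigma>" "lam * of_real (b i)" "at_right 0" "\<lambda>\<sigma>. a i \<sigma> - of_real (c i) * M0 (Suc i) \<sigma>" 0] by simp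
  qed
  define E1 where "E1 = \<kappa> * (1 + 2 * pi * \<tau>) * (4 * pi * \<tau>) powr (- \<alpha>)"
  have E1: "E1 \<ge> 0" using \<kappa> \<tau> by (simp add: E1_def)
  have M0_le: "norm (M0 m \<sigma>) \<le> E1 * C5 * real m powr (-(4/3))" if "m > 0" "0 < \<sigma>" "\<sigma> < 1" for m \<sigma>
  proof -
    have "norm (s \<sigma>) \<le> norm (of_real \<sigma> :: complex) + norm (\<i> * of_real (2 * pi * \<tau>))" unfolding s_def by (rule norm_triangle_ineq)
    also have "\<dots> \<le> 1 + 2 * pi * \<tau>" using that \<tau> by (simp add: norm_mult)
    finally have ns: "norm (s \<sigma>) \<le> 1 + 2 * pi * \<tau>" .
    have "4 * pi * \<tau> \<le> norm (w \<sigma>)" using abs_Im_le_cmod[of "w \<sigma>"] \<tau> by (simp add: w_def)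
    hence nw: "norm (w \<sigma>) powr (- \<alpha>) \<le> (4 * pi * \<tau>) powr (- \<alpha>)" using \<tau> \<alpha> by (intro powr_mono2') auto
    have "norm (M0 m \<sigma>) = \<kappa> * (real m * norm (s \<sigma>)) * \<rho> m * (real m powr (- (real \<nu> + 1)) * norm (w \<sigma>) powr (- \<alpha>))"
      using \<kappa> \<rho>0 by (simp add: M0_def norm_mult norm_powr_real_powr' del: of_real_minus)
    also have "\<dots> \<le> \<kappa> * (real m * (1 + 2 * pi * \<tau>)) * (C5 * real m powr (real \<nu> - 4/3)) * (real m powr (- (real \<nu> + 1)) * (4 * pi * \<tau>) powr (- \<alpha>))"
      using \<kappa> \<rho>0 ns nw C5 \<tau> that by (intro mult_mono) auto
    also have "\<dots> = E1 * C5 * (real m powr 1 * real m powr (real \<nu> - 4/3) * real m powr (- (real \<nu> + 1)))" using that by (simp add: E1_def)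
    also have "real m powr 1 * real m powr (real \<nu> - 4/3) * real m powr (- (real \<nu> + 1)) = real m powr (-(4/3))"
      unfolding powr_add[symmetric] by simp
    finally show ?thesis .
  qed
  \<comment> \<open>The two majorants are summable exactly for 2 - 2/(3 (nu + 1)) < x < 2, and x is
    the midpoint. The width of this window is due to the power saving in \<open>rep\<close>.\<close>
  define x where "x = 2 - 1 / (3 * (real \<nu> + 1))"
  define e2 where "e2 = 1 + (real \<nu> - 1) / (6 * (real \<nu> + 1))"
  have e2: "e2 > 1" using \<nu> by (simp add: e2_def)
  have ex1: "(- x) * \<alpha> + (real \<nu> - 1/3) = - (7/6)" by (simp add: x_def \<alpha>_def field_simps)
  have ex2: "(- x) * (\<alpha> - real \<nu>) + (- real \<nu>) = - e2" by (simp add: x_def \<alpha>_def e2_def field_simps)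
  define Mj where "Mj = (\<lambda>i. E1 * C5 * real (Suc i) powr (-(4/3)) + (C + 1) * real (Suc i) powr (-(7/6)) + C4 * real (Suc i) powr (- e2))"
  have sMj: "summable Mj" unfolding Mj_def by (intro summable_add summable_mult summable_powr_Suc) (use e2 in auto)
  have bound: "norm (a i \<sigma>) \<le> Mj i" if \<sigma>: "0 < \<sigma>" "\<sigma> < 1" for i \<sigma>
  proof (cases "\<sigma> \<le> real (Suc i) powr (- x)")
    case True
    have "norm (a i \<sigma>) \<le> norm (of_real (c i) * M0 (Suc i) \<sigma>) + norm (a i \<sigma> - of_real (c i) * M0 (Suc i) \<sigma>)"
      using norm_triangle_ineq[of "of_real (c i) * M0 (Suc i) \<sigma>" "a i \<sigma> - of_real (c i) * M0 (Suc i) \<sigma>"] by simp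
    also have "norm (of_real (c i) * M0 (Suc i) \<sigma>) \<le> 1 * (E1 * C5 * real (Suc i) powr (-(4/3)))"
      unfolding norm_mult norm_of_real by (intro mult_mono c1 M0_le) (use \<sigma> in auto)
    also have "norm (a i \<sigma> - of_real (c i) * M0 (Suc i) \<sigma>) \<le> (C + 1) * real (Suc i) powr (-(7/6))"
    proof -
      have "\<sigma> powr \<alpha> \<le> (real (Suc i) powr (- x)) powr \<alpha>" using True \<sigma> \<alpha> by (intro powr_mono2) auto
      hence "\<sigma> powr \<alpha> * ((C + 1) * real (Suc i) powr (real \<nu> - 1/3)) \<le> real (Suc i) powr ((- x) * \<alpha>) * ((C + 1) * real (Suc i) powr (real \<nu> - 1/3))"
        unfolding powr_powr using C by (intro mult_right_mono) auto
      also have "\<dots> = (C + 1) * (real (Suc i) powr ((- x) * \<alpha>) * real (Suc i) powr (real \<nu> - 1/3))" by (simp only: mult_ac)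
      also have "\<dots> = (C + 1) * real (Suc i) powr (-(7/6))" by (simp only: powr_add[symmetric] ex1)
      finally show ?thesis using err[OF \<sigma>, of i] by linarith
    qed
    finally have "norm (a i \<sigma>) \<le> E1 * C5 * real (Suc i) powr (-(4/3)) + (C + 1) * real (Suc i) powr (-(7/6))" by (simp only: mult_1)
    also have "\<dots> \<le> Mj i" unfolding Mj_def using C4(1) by (simp del: of_nat_Suc)
    finally show ?thesis .
  next
    case False
    have "Re (s \<sigma>) = \<sigma>" by (simp add: s_def)
    moreover have "Re (complex_of_real (real (Suc i)) * s \<sigma>) = real (Suc i) * Re (s \<sigma>)"
      by (simp only: times_complex.simps Re_complex_of_real Im_complex_of_real mult_zero_left diff_zero)
    ultimately have Re: "Re (of_nat (Suc i) * s \<sigma>) = real (Suc i) * \<sigma>" by (simp only: of_real_of_nat_eq)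
    have "Re (of_nat (Suc i) * s \<sigma>) > 0" unfolding Re using \<sigma> by (intro mult_pos_pos) auto
    from C4(2)[OF this] have n: "norm (lattice_exp_sum \<nu> (of_nat (Suc i) * s \<sigma>) - 1) \<le> C4 * (real (Suc i) * \<sigma>) powr (- real \<nu>)"
      by (simp only: Re)
    have "norm (a i \<sigma>) = \<bar>c i\<bar> * (\<sigma> powr \<alpha> * norm (lattice_exp_sum \<nu> (of_nat (Suc i) * s \<sigma>) - 1))"
      by (simp add: a_def norm_mult del: of_nat_Suc)
    also have "\<dots> \<le> 1 * (\<sigma> powr \<alpha> * (C4 * (real (Suc i) * \<sigma>) powr (- real \<nu>)))"
      by (intro mult_mono c1 order_refl n) auto
    also have "\<dots> = C4 * real (Suc i) powr (- real \<nu>) * (\<sigma> powr \<alpha> * \<sigma> powr (- real \<nu>))" by (simp only: powr_mult mult_ac mult_1)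
    also have "\<sigma> powr \<alpha> * \<sigma> powr (- real \<nu>) = \<sigma> powr (\<alpha> - real \<nu>)" by (simp add: powr_add[symmetric])
    \<comment> \<open>\<alpha> - nu = (1 - nu)/2 is negative, so the lower bound m^(-x) < \<sigma>
      yields an upper bound for the power.\<close>
    also have "C4 * real (Suc i) powr (- real \<nu>) * \<sigma> powr (\<alpha> - real \<nu>) \<le> C4 * real (Suc i) powr (- real \<nu>) * (real (Suc i) powr (- x)) powr (\<alpha> - real \<nu>)"
      using False \<nu> C4 by (intro mult_left_mono powr_mono2') (auto simp: \<alpha>_def)
    also have "\<dots> = C4 * (real (Suc i) powr ((- x) * (\<alpha> - real \<nu>)) * real (Suc i) powr (- real \<nu>))" by (simp only: powr_powr mult_ac)
    also have "\<dots> = C4 * real (Suc i) powr (- e2)" by (simp only: powr_add[symmetric] ex2)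
    finally have "norm (a i \<sigma>) \<le> C4 * real (Suc i) powr (- e2)" .
    moreover have "0 \<le> E1 * C5 * real (Suc i) powr (-(4/3))" "0 \<le> (C + 1) * real (Suc i) powr (-(7/6))"
      using E1 C5(1) C by auto
    ultimately show ?thesis unfolding Mj_def by linarith
  qed
  have "((\<lambda>\<sigma>. \<Sum>i. a i \<sigma>) \<longlongrightarrow> (\<Sum>i. lam * of_real (b i))) (at_right 0)"
  proof (rule tendsto_suminf_dominated[OF lim _ sMj])
    show "\<forall>\<^sub>F \<sigma> in at_right 0. \<forall>i. norm (a i \<sigma>) \<le> Mj i"
      using eventually_at_right_real[OF zero_less_one] by eventually_elim (use bound in auto)
  qed simp
  moreover have "\<forall>\<^sub>F \<sigma> in at_right 0. (\<Sum>i. a i \<sigma>) = of_real (\<sigma> powr \<alpha>) * log_zeta_series \<nu> (s \<sigma>)"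
    using eventually_at_right_real[OF zero_less_one]
  proof eventually_elim
    case (elim \<sigma>)
    hence "Re (s \<sigma>) > 0" by (simp add: s_def)
    from summable_norm_cancel[OF summable_log_zeta_series[OF \<nu> this]]
    show ?case unfolding a_def log_zeta_series_def c_def by (rule suminf_mult)
  qed
  ultimately have "((\<lambda>\<sigma>. of_real (\<sigma> powr \<alpha>) * log_zeta_series \<nu> (s \<sigma>)) \<longlongrightarrow> (\<Sum>i. lam * of_real (b i))) (at_right 0)"
    by (rule Lim_transform_eventually)
  moreover have "(\<Sum>i. lam * of_real (b i)) = lam * of_real (\<Sum>i. b i)"
  proof -
    have sb: "summable b" unfolding b_def \<rho>_def by (rule summable_rep_at_multiple[OF \<nu> jq(1,2)])
    have "(\<Sum>i. lam * of_real (b i)) = lam * (\<Sum>i. of_real (b i))" by (intro suminf_mult summable_of_real sb)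
    thus ?thesis using suminf_of_real[OF sb, where 'a = complex] by simp
  qed
  ultimately show ?thesis using \<kappa> unfolding lam_def b_def s_def \<alpha>_def[symmetric] \<tau>_def[symmetric] \<rho>_def[symmetric] by auto
qed

section \<open>The logarithm of the zeta function\<close>

text \<open>The factor j is recovered as the gcd of the entries, which makes the decomposition
  unique.\<close>

lemma primitive_decomposition:
  "bij_betw (\<lambda>(j, p). \<lambda>i. int j * p i) ({0<..} \<times> primitive_vecs \<nu>) (int_lattice \<nu> - {\<lambda>_. 0})"
proof -
  let ?f = "\<lambda>(j, p). \<lambda>i. int j * p i"
  have gcd: "Gcd ((\<lambda>i. int j * p i) ` {..<\<nu>}) = int j" if "p \<in> primitive_vecs \<nu>" for j p
  proof -
    have "(\<lambda>i. int j * p i) ` {..<\<nu>} = (*) (int j) ` (p ` {..<\<nu>})" by (simp add: image_image)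
    thus ?thesis using that by (simp add: Gcd_mult primitive_vecs_def del: image_image)
  qed
  have inj: "inj_on ?f ({0<..} \<times> primitive_vecs \<nu>)"
  proof (rule inj_onI)
    fix a b assume ab: "a \<in> {0<..} \<times> primitive_vecs \<nu>" "b \<in> {0<..} \<times> primitive_vecs \<nu>" "?f a = ?f b"
    obtain j p j' p' where e: "a = (j, p)" "b = (j', p')" by fastforce
    have eq: "(\<lambda>i. int j * p i) = (\<lambda>i. int j' * p' i)" using ab(3) e by simp
    have mem: "p \<in> primitive_vecs \<nu>" "p' \<in> primitive_vecs \<nu>" using ab(1,2) e by auto
    have "int j = Gcd ((\<lambda>i. int j * p i) ` {..<\<nu>})" by (rule gcd[OF mem(1), symmetric])
    also have "\<dots> = Gcd ((\<lambda>i. int j' * p' i) ` {..<\<nu>})" by (simp only: eq)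
    also have "\<dots> = int j'" by (rule gcd[OF mem(2)])
    finally have "int j = int j'" .
    moreover from this have "p i = p' i" for i using fun_cong[OF eq, of i] ab(1) e by simp
    ultimately show "a = b" using e by auto
  qed
  have "?f ` ({0<..} \<times> primitive_vecs \<nu>) = int_lattice \<nu> - {\<lambda>_. 0}"
  proof (intro equalityI subsetI)
    fix x assume "x \<in> ?f ` ({0<..} \<times> primitive_vecs \<nu>)"
    then obtain j p where x: "j > 0" "p \<in> primitive_vecs \<nu>" "x = (\<lambda>i. int j * p i)" by auto
    hence "x \<in> int_lattice \<nu>" by (auto simp: int_lattice_def primitive_vecs_def)
    moreover have "x \<noteq> (\<lambda>_. 0)"
    proof
      assume "x = (\<lambda>_. 0)"
      hence e: "(\<lambda>i. int j * p i) = (\<lambda>_. 0)" using x(3) by simp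
      have "Gcd ((\<lambda>i. int j * p i) ` {..<\<nu>}) = 0" unfolding e by (auto simp: Gcd_0_iff)
      thus False using gcd[OF x(2), of j] x(1) by simp
    qed
    ultimately show "x \<in> int_lattice \<nu> - {\<lambda>_. 0}" by simp
  next
    fix x assume x: "x \<in> int_lattice \<nu> - {\<lambda>_. 0}"
    define g where "g = Gcd (x ` {..<\<nu>})"
    obtain i0 where i0: "x i0 \<noteq> 0" using x by (auto simp: fun_eq_iff)
    have "i0 < \<nu>" using i0 x by (auto simp: int_lattice_def)
    hence g0: "g \<noteq> 0" using i0 by (auto simp: g_def Gcd_0_iff)
    have "g \<ge> 0" by (simp add: g_def)
    hence gpos: "g > 0" using g0 by simp
    define p where "p = (\<lambda>i. x i div g)"
    have xp: "x i = g * p i" for i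
    proof (cases "i < \<nu>")
      case True
      hence "g dvd x i" unfolding g_def by (intro Gcd_dvd) auto
      thus ?thesis by (simp add: p_def)
    next
      case False
      thus ?thesis using x by (simp add: p_def int_lattice_def)
    qed
    have "x ` {..<\<nu>} = (*) g ` (p ` {..<\<nu>})" by (simp add: image_image flip: xp)
    hence "g = Gcd ((*) g ` (p ` {..<\<nu>}))" by (simp only: g_def)
    also have "\<dots> = g * Gcd (p ` {..<\<nu>})" using gpos by (simp add: Gcd_mult abs_mult)
    finally have "Gcd (p ` {..<\<nu>}) = 1" using gpos by simp
    moreover have "p i = 0" if "i \<ge> \<nu>" for i using x that by (simp add: p_def int_lattice_def)
    ultimately have "p \<in> primitive_vecs \<nu>" by (simp add: primitive_vecs_def)
    moreover have "x = ?f (nat g, p)" using xp gpos by (auto simp: fun_eq_iff)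
    ultimately show "x \<in> ?f ` ({0<..} \<times> primitive_vecs \<nu>)" using gpos by (intro image_eqI[of _ _ "(nat g, p)"]) auto
  qed
  thus ?thesis using inj by (simp add: bij_betw_def)
qed

lemma sq_norm_scale: "sq_norm \<nu> (\<lambda>i. int j * p i) = j\<^sup>2 * sq_norm \<nu> p"
proof -
  have "(\<Sum>i<\<nu>. (int j * p i)\<^sup>2) = (int j)\<^sup>2 * (\<Sum>i<\<nu>. (p i)\<^sup>2)" by (simp add: power_mult_distrib sum_distrib_left)
  thus ?thesis by (simp add: sq_norm_def nat_mult_distrib nat_power_eq)
qed

lemma has_sum_primitive_multiples:
  fixes g :: "nat \<Rightarrow> 'a :: {banach, real_normed_field}"
  assumes sm: "summable (\<lambda>n. real (rep \<nu> n) * norm (g n))"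
  shows "((\<lambda>(j, p). g (j\<^sup>2 * sq_norm \<nu> p)) has_sum (\<Sum>n. of_nat (rep \<nu> (Suc n)) * g (Suc n))) ({0<..} \<times> primitive_vecs \<nu>)"
proof -
  \<comment> \<open>Setting the value at 0 to 0 discards the origin, the only lattice point that is
    not a positive multiple of a primitive vector.\<close>
  define h where "h = (\<lambda>n. if n = 0 then 0 else g n)"
  have smh: "summable (\<lambda>n. real (rep \<nu> n) * norm (h n))"
    by (rule summable_comparison_test'[OF sm]) (auto simp: h_def)
  have "summable (\<lambda>n. norm (of_nat (rep \<nu> n) * h n))" using smh by (simp add: norm_mult)
  hence "summable (\<lambda>n. of_nat (rep \<nu> n) * h n)" by (rule summable_norm_cancel)
  hence "(\<Sum>n. of_nat (rep \<nu> n) * h n) = (\<Sum>n. of_nat (rep \<nu> (Suc n)) * g (Suc n))"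
    using suminf_split_head[of "\<lambda>n. of_nat (rep \<nu> n) * h n"] by (simp add: h_def)
  hence "((\<lambda>x. h (sq_norm \<nu> x)) has_sum (\<Sum>n. of_nat (rep \<nu> (Suc n)) * g (Suc n))) (int_lattice \<nu>)"
    using has_sum_lattice_radial[OF smh] by simp
  moreover have "((\<lambda>x. h (sq_norm \<nu> x)) has_sum (\<Sum>n. of_nat (rep \<nu> (Suc n)) * g (Suc n))) (int_lattice \<nu>) \<longleftrightarrow>
     ((\<lambda>x. g (sq_norm \<nu> x)) has_sum (\<Sum>n. of_nat (rep \<nu> (Suc n)) * g (Suc n))) (int_lattice \<nu> - {\<lambda>_. 0})"
    by (rule has_sum_cong_neutral) (auto simp: h_def sq_norm_eq_0_iff)
  ultimately have "((\<lambda>x. g (sq_norm \<nu> x)) has_sum (\<Sum>n. of_nat (rep \<nu> (Suc n)) * g (Suc n))) (int_lattice \<nu> - {\<lambda>_. 0})" by simp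
  hence "((\<lambda>q. g (sq_norm \<nu> ((\<lambda>(j, p). \<lambda>i. int j * p i) q))) has_sum (\<Sum>n. of_nat (rep \<nu> (Suc n)) * g (Suc n))) ({0<..} \<times> primitive_vecs \<nu>)"
    by (subst has_sum_reindex_bij_betw[OF primitive_decomposition])
  thus ?thesis by (simp add: case_prod_unfold sq_norm_scale)
qed

lemma has_sum_primitive_exp:
  assumes \<nu>: "\<nu> \<ge> 2" and s: "Re s > 0"
  shows "((\<lambda>(j, p). exp (- s * of_real (real j * vec_norm \<nu> p))) has_sum (lattice_exp_sum \<nu> s - 1)) ({0<..} \<times> primitive_vecs \<nu>)"
proof -
  define g where "g = (\<lambda>n. exp (- s * of_real (sqrt (real n))))"
  have "summable (\<lambda>n. real (rep \<nu> n) * norm (g n))"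
    using summable_rep_exp_sqrt[OF \<nu> s] by (simp add: g_def)
  from has_sum_primitive_multiples[OF this]
  show ?thesis unfolding lattice_exp_sum_minus_1(2)[OF \<nu> s] g_def
    by (simp add: real_sqrt_mult vec_norm_conv_sq_norm)
qed

lemma has_sum_primitive_exp_real:
  assumes \<nu>: "\<nu> \<ge> 2" and a: "a > 0"
  shows "((\<lambda>(j, p). exp (- a * (real j * vec_norm \<nu> p))) has_sum
     (\<Sum>n. real (rep \<nu> (Suc n)) * exp (- a * sqrt (real (Suc n))))) ({0<..} \<times> primitive_vecs \<nu>)"
proof -
  define g where "g = (\<lambda>n. exp (- a * sqrt (real n)))"
  have "summable (\<lambda>n. real (rep \<nu> n) * norm (g n))"
    using summable_rep_exp_sqrt[OF \<nu> a] by (simp add: g_def)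
  from has_sum_primitive_multiples[OF this]
  show ?thesis unfolding g_def by (simp add: real_sqrt_mult vec_norm_conv_sq_norm)
qed

lemma vec_norm_primitive_pos: "p \<in> primitive_vecs \<nu> \<Longrightarrow> vec_norm \<nu> p > 0"
proof -
  assume p: "p \<in> primitive_vecs \<nu>"
  have "p \<in> int_lattice \<nu>" using p by (auto simp: primitive_vecs_def int_lattice_def)
  moreover have "p \<noteq> (\<lambda>_. 0)" using p by (auto simp: primitive_vecs_def) (metis Gcd_0_iff image_subset_iff insertI1 zero_neq_one)
  ultimately show ?thesis using sq_norm_eq_0_iff[of p \<nu>] by (simp add: vec_norm_conv_sq_norm)
qed

lemma has_sum_neg_Ln:
  fixes b :: complex assumes b: "norm b < 1"
  shows "((\<lambda>k::nat. b ^ k / of_nat k) has_sum - Ln (1 - b)) {0<..}"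
proof -
  have A: "(\<lambda>n. (- 1) ^ Suc n / of_nat n * (- b) ^ n) sums Ln (1 + - b)" by (rule Ln_series) (use b in simp)
  have B: "(- 1) ^ Suc n / of_nat n * (- b) ^ n = - (b ^ n / of_nat n)" for n
  proof -
    have "(- 1) ^ n * (- b) ^ n = b ^ n" by (simp flip: power_mult_distrib)
    moreover have "(- 1) ^ Suc n / of_nat n * (- b) ^ n = - ((- 1) ^ n * (- b) ^ n / of_nat n)" by simp
    ultimately show ?thesis by (simp only:)
  qed
  have "(\<lambda>n. - (b ^ n / of_nat n)) sums Ln (1 - b)" using A unfolding B by simp
  from sums_minus[OF this] have "(\<lambda>n. b ^ n / of_nat n) sums - Ln (1 - b)" by simp
  moreover have "summable (\<lambda>n. norm (b ^ n / of_nat n))"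
  proof (rule summable_comparison_test'[OF summable_geometric[of "norm b"]])
    fix n :: nat
    show "norm (norm (b ^ n / of_nat n)) \<le> norm b ^ n"
    proof (cases "n = 0")
      case False
      hence "norm b ^ n / real n \<le> norm b ^ n / 1" by (intro divide_left_mono) auto
      thus ?thesis by (simp add: norm_divide norm_power)
    qed simp
  qed (use b in simp)
  ultimately have "((\<lambda>n. b ^ n / of_nat n) has_sum - Ln (1 - b)) UNIV" by (intro norm_summable_imp_has_sum)
  \<comment> \<open>The term at index 0 is 0, since division by 0 gives 0, so restricting to
    positive k changes nothing.\<close>
  moreover have "((\<lambda>n. b ^ n / of_nat n) has_sum - Ln (1 - b)) UNIV \<longleftrightarrow> ((\<lambda>k::nat. b ^ k / of_nat k) has_sum - Ln (1 - b)) {0<..}"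
    by (rule has_sum_cong_neutral) auto
  ultimately show ?thesis by simp
qed

text \<open>Both sides are rearrangements of the absolutely convergent sum of
  \<open>c(m) exp (- s m j |p|)\<close> over \<open>m, j \<ge> 1\<close> and primitive \<open>p\<close>, where
  \<open>c(m) = rad_coeff 1 m / m\<close> satisfies \<open>\<Sum> m | k. c(m) = 1/k\<close>.\<close>

lemma has_sum_log_zeta:
  assumes \<nu>: "\<nu> \<ge> 2" and s: "Re s > 0"
  shows "((\<lambda>p. - Ln (1 - exp (- s * of_real (vec_norm \<nu> p)))) has_sum log_zeta_series \<nu> s) (primitive_vecs \<nu>)"
proof -
  define Pr where "Pr = primitive_vecs \<nu>"
  define N where "N = vec_norm \<nu>"
  define c where "c = (\<lambda>m. rad_coeff 1 m / real m)"
  have c1: "\<bar>c m\<bar> \<le> 1" if "m > 0" for m using abs_rad_coeff_div_le[of "m - 1"] that by (simp add: c_def)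
  define u where "u = (\<lambda>(m::nat, j::nat, p). complex_of_real (c m) * exp (- s * of_real (real (m * j) * N p)))"
  \<comment> \<open>Norm summability over triples: the inner sum over (j, p) is O((m Re s)^(-nu)),
    which is summable over m as nu >= 2.\<close>
  have usum: "u summable_on ({0<..} \<times> ({0<..} \<times> Pr))"
  proof -
    obtain C where C: "C > 0" "\<And>a. a > 0 \<Longrightarrow> (\<Sum>n. real (rep \<nu> (Suc n)) * exp (- a * sqrt (real (Suc n)))) \<le> C * a powr (- real \<nu>)"
      using lattice_exp_sum_real_bound[OF \<nu>] by blast
    define T where "T = (\<lambda>a. (\<Sum>n. real (rep \<nu> (Suc n)) * exp (- a * sqrt (real (Suc n)))))"
    define v where "v = (\<lambda>(m::nat, q). (case q of (j::nat, p) \<Rightarrow> exp (- (real m * Re s) * (real j * N p))))"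
    have inner: "((\<lambda>q. v (m, q)) has_sum T (real m * Re s)) ({0<..} \<times> Pr)" if "m > 0" for m
      using has_sum_primitive_exp_real[OF \<nu>, of "real m * Re s"] that s by (simp add: v_def T_def Pr_def N_def)
    have T0: "T (real m * Re s) \<ge> 0" if "m > 0" for m
      by (rule has_sum_nonneg[OF inner[OF that]]) (auto simp: v_def)
    have "(\<lambda>m::nat. (C * Re s powr (- real \<nu>)) * real m powr (- real \<nu>)) summable_on {0<..}"
      using \<nu> by (intro summable_on_cmult_right summable_on_powr) auto
    hence outer: "(\<lambda>m. T (real m * Re s)) summable_on {0<..}"
    proof (rule summable_on_comparison_test)
      fix m :: nat assume m: "m \<in> {0<..}"
      hence "T (real m * Re s) \<le> C * (real m * Re s) powr (- real \<nu>)" using C(2)[of "real m * Re s"] s by (simp add: T_def)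
      also have "\<dots> = (C * Re s powr (- real \<nu>)) * real m powr (- real \<nu>)" by (simp only: powr_mult mult_ac)
      finally show "T (real m * Re s) \<le> (C * Re s powr (- real \<nu>)) * real m powr (- real \<nu>)" .
    qed (use T0 in auto)
    have "v summable_on ({0<..} \<times> ({0<..} \<times> Pr))"
      by (rule summable_on_SigmaI[OF _ outer]) (use inner in \<open>auto simp: v_def\<close>)
    hence "(\<lambda>x. norm (u x)) summable_on ({0<..} \<times> ({0<..} \<times> Pr))"
    proof (rule Infinite_Sum.abs_summable_on_comparison_test')
      fix x assume "x \<in> {0::nat<..} \<times> ({0::nat<..} \<times> Pr)"
      then obtain m j p where x: "x = (m, j, p)" "m > 0" by auto
      have "norm (u x) = \<bar>c m\<bar> * v x" by (simp add: u_def v_def x norm_mult mult_ac)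
      also have "\<dots> \<le> 1 * v x" using c1[OF x(2)] by (intro mult_right_mono) (auto simp: v_def x)
      finally show "norm (u x) \<le> v x" by simp
    qed
    thus ?thesis by (rule abs_summable_summable)
  qed
  have "(u has_sum log_zeta_series \<nu> s) ({0<..} \<times> ({0<..} \<times> Pr))"
  proof (rule has_sum_SigmaI[OF _ _ usum])
    fix m :: nat assume "m \<in> {0<..}"
    hence "Re (of_nat m * s) > 0" using s by simp
    from has_sum_cmult_right[OF has_sum_primitive_exp[OF \<nu> this], of "complex_of_real (c m)"]
    show "((\<lambda>q. u (m, q)) has_sum (complex_of_real (c m) * (lattice_exp_sum \<nu> (of_nat m * s) - 1))) ({0<..} \<times> Pr)"
      by (simp add: u_def case_prod_unfold Pr_def N_def mult_ac)
  next
    have sf: "summable (\<lambda>i. norm (complex_of_real (c (Suc i)) * (lattice_exp_sum \<nu> (of_nat (Suc i) * s) - 1)))"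
      using summable_log_zeta_series[OF \<nu> s] unfolding c_def .
    have "((\<lambda>i. complex_of_real (c (Suc i)) * (lattice_exp_sum \<nu> (of_nat (Suc i) * s) - 1)) has_sum log_zeta_series \<nu> s) UNIV"
      using norm_summable_imp_has_sum[OF sf summable_sums[OF summable_norm_cancel[OF sf]]]
      unfolding log_zeta_series_def c_def .
    moreover have "((\<lambda>i. complex_of_real (c (Suc i)) * (lattice_exp_sum \<nu> (of_nat (Suc i) * s) - 1)) has_sum log_zeta_series \<nu> s) UNIV \<longleftrightarrow>
        ((\<lambda>m. complex_of_real (c m) * (lattice_exp_sum \<nu> (of_nat m * s) - 1)) has_sum log_zeta_series \<nu> s) {0<..}"
      by (rule has_sum_reindex_bij_witness[of _ "\<lambda>k. k - 1" Suc]) auto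
    ultimately show "((\<lambda>m. complex_of_real (c m) * (lattice_exp_sum \<nu> (of_nat m * s) - 1)) has_sum log_zeta_series \<nu> s) {0<..}" by simp
  qed
  moreover define D where "D = (\<lambda>k::nat. {m. m dvd k})"
  define w where "w = (\<lambda>(p, k::nat, m::nat). complex_of_real (c m) * exp (- s * of_real (real k * N p)))"
  \<comment> \<open>k = m j collects the pairs with the same exponential; D k is the set of possible
    m.\<close>
  have "(u has_sum log_zeta_series \<nu> s) ({0<..} \<times> ({0<..} \<times> Pr)) \<longleftrightarrow> (w has_sum log_zeta_series \<nu> s) (Pr \<times> Sigma {0<..} D)"
  proof (rule has_sum_reindex_bij_witness[of _ "\<lambda>(p, k, m). (m, k div m, p)" "\<lambda>(m, j, p). (p, m * j, m)"])
    fix x assume "x \<in> {0::nat<..} \<times> ({0::nat<..} \<times> Pr)"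
    then obtain m j p where x: "x = (m, j, p)" "m > 0" "j > 0" "p \<in> Pr" by auto
    show "(case (case x of (m, j, p) \<Rightarrow> (p, m * j, m)) of (p, k, m) \<Rightarrow> (m, k div m, p)) = x" using x by simp
    show "(case x of (m, j, p) \<Rightarrow> (p, m * j, m)) \<in> Pr \<times> Sigma {0<..} D" using x by (simp add: D_def)
    show "w (case x of (m, j, p) \<Rightarrow> (p, m * j, m)) = u x" using x by (simp add: u_def w_def)
  next
    fix x assume "x \<in> Pr \<times> Sigma {0<..} D"
    then obtain p k m where x: "x = (p, k, m)" "k > 0" "m dvd k" "p \<in> Pr" by (auto simp: D_def)
    have "m > 0" "k div m > 0" using x by (auto intro!: Nat.gr0I simp: dvd_div_eq_0_iff)
    thus "(case x of (p, k, m) \<Rightarrow> (m, k div m, p)) \<in> {0<..} \<times> ({0<..} \<times> Pr)" using x by simp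
    show "(case (case x of (p, k, m) \<Rightarrow> (m, k div m, p)) of (m, j, p) \<Rightarrow> (p, m * j, m)) = x" using x by simp
  qed simp
  ultimately have wsum: "(w has_sum log_zeta_series \<nu> s) (Pr \<times> Sigma {0<..} D)" by simp
  have "((\<lambda>p. - Ln (1 - exp (- s * of_real (N p)))) has_sum log_zeta_series \<nu> s) Pr"
  proof (rule has_sum_Sigma'[OF wsum])
    fix p assume p: "p \<in> Pr"
    define b where "b = exp (- s * of_real (N p))"
    have "N p > 0" using vec_norm_primitive_pos p by (simp add: N_def Pr_def)
    hence b: "norm b < 1" using s by (simp add: b_def)
    have bk: "exp (- s * of_real (real k * N p)) = b ^ k" for k
      unfolding b_def exp_of_nat_mult[symmetric] by (simp add: mult_ac)
    show "((\<lambda>y. w (p, y)) has_sum - Ln (1 - exp (- s * of_real (N p)))) (Sigma {0<..} D)"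
    proof (rule has_sum_SigmaI)
      show "((\<lambda>k::nat. b ^ k / of_nat k) has_sum - Ln (1 - exp (- s * of_real (N p)))) {0<..}"
        using has_sum_neg_Ln[OF b] by (simp add: b_def)
      show "(\<lambda>y. w (p, y)) summable_on Sigma {0<..} D"
        by (rule summable_on_SigmaD1[OF _ p, where f = "\<lambda>p y. w (p, y)"])
           (use has_sum_imp_summable[OF wsum] in \<open>simp add: case_prod_unfold\<close>)
      fix k :: nat assume k: "k \<in> {0<..}"
      have "(\<Sum>m\<in>D k. w (p, (k, m))) = of_real (\<Sum>m\<in>D k. c m) * b ^ k"
        by (simp only: w_def case_prod_conv bk of_real_sum sum_distrib_right)
      also have "(\<Sum>m\<in>D k. c m) = 1 / real k"
        using sum_rad_coeff_divisors[of k 1] k by (simp add: D_def c_def)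
      also have "of_real (1 / real k) * b ^ k = b ^ k / of_nat k" by simp
      finally have "(\<Sum>m\<in>D k. w (p, (k, m))) = b ^ k / of_nat k" .
      moreover have "finite (D k)" using k by (simp add: D_def)
      ultimately show "((\<lambda>m. w (p, (k, m))) has_sum b ^ k / of_nat k) (D k)"
        using has_sum_finite[of "D k" "\<lambda>m. w (p, (k, m))"] by simp
    qed
  qed
  thus ?thesis by (simp add: Pr_def N_def)
qed

text \<open>The exponential undoes each principal logarithm, so finite partial products are
  exponentials of finite partial sums, and by continuity the limit passes through exp along the very
  net of finite subsets that defines \<open>zeta_sqrt\<close>.\<close>

lemma zeta_sqrt_eq_exp:
  assumes \<nu>: "\<nu> \<ge> 2" and s: "Re s > 0"
  shows "zeta_sqrt \<nu> s = exp (log_zeta_series \<nu> s)"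
proof -
  define f where "f = (\<lambda>p. - Ln (1 - exp (- s * of_real (vec_norm \<nu> p))))"
  have "(sum f \<longlongrightarrow> log_zeta_series \<nu> s) (finite_subsets_at_top (primitive_vecs \<nu>))"
    using has_sum_log_zeta[OF \<nu> s] by (simp add: has_sum_def f_def)
  hence "((\<lambda>F. exp (sum f F)) \<longlongrightarrow> exp (log_zeta_series \<nu> s)) (finite_subsets_at_top (primitive_vecs \<nu>))"
    by (rule tendsto_exp)
  moreover have "\<forall>\<^sub>F F in finite_subsets_at_top (primitive_vecs \<nu>).
      exp (sum f F) = (\<Prod>p\<in>F. inverse (1 - exp (- s * complex_of_real (vec_norm \<nu> p))))"
    unfolding eventually_finite_subsets_at_top
  proof (intro exI[of _ "{}"] conjI allI impI)
    fix F assume F: "finite F \<and> {} \<subseteq> F \<and> F \<subseteq> primitive_vecs \<nu>"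
    have "exp (f p) = inverse (1 - exp (- s * complex_of_real (vec_norm \<nu> p)))" if "p \<in> F" for p
    proof -
      have "vec_norm \<nu> p > 0" using F that vec_norm_primitive_pos by blast
      hence "norm (exp (- s * complex_of_real (vec_norm \<nu> p))) < 1" using s by simp
      hence "exp (- s * complex_of_real (vec_norm \<nu> p)) \<noteq> 1" by (metis norm_one less_irrefl)
      thus ?thesis by (simp add: f_def exp_minus)
    qed
    thus "exp (sum f F) = (\<Prod>p\<in>F. inverse (1 - exp (- s * complex_of_real (vec_norm \<nu> p))))"
      using F by (simp add: Transcendental.exp_sum)
  qed auto
  ultimately have "((\<lambda>F. \<Prod>p\<in>F. inverse (1 - exp (- s * complex_of_real (vec_norm \<nu> p)))) \<longlongrightarrow> exp (log_zeta_series \<nu> s)) (finite_subsets_at_top (primitive_vecs \<nu>))"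
    by (rule Lim_transform_eventually)
  thus ?thesis unfolding zeta_sqrt_def by (intro tendsto_Lim) auto
qed

lemma lattice_exp_sum_cnj:
  assumes \<nu>: "\<nu> \<ge> 2" and s: "Re s > 0"
  shows "lattice_exp_sum \<nu> (cnj s) = cnj (lattice_exp_sum \<nu> s)"
proof -
  have "summable (\<lambda>n. norm (of_nat (rep \<nu> n) * exp (- s * complex_of_real (sqrt (real n)))))"
    using summable_rep_exp_sqrt[OF \<nu> s] by (simp add: norm_mult)
  from bounded_linear.suminf[OF bounded_linear_cnj summable_norm_cancel[OF this]]
  show ?thesis unfolding lattice_exp_sum_def by (simp add: exp_cnj)
qed

text \<open>Reflection in the real axis, which reaches boundary points with negative imaginary part
  from those with positive \<tau>.\<close>

lemma log_zeta_series_cnj: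
  assumes \<nu>: "\<nu> \<ge> 2" and s: "Re s > 0"
  shows "log_zeta_series \<nu> (cnj s) = cnj (log_zeta_series \<nu> s)"
proof -
  have "lattice_exp_sum \<nu> (of_nat (Suc i) * cnj s) = cnj (lattice_exp_sum \<nu> (of_nat (Suc i) * s))" for i
    using lattice_exp_sum_cnj[OF \<nu>, of "of_nat (Suc i) * s"] s by (simp del: of_nat_Suc)
  thus ?thesis unfolding log_zeta_series_def
    using bounded_linear.suminf[OF bounded_linear_cnj summable_norm_cancel[OF summable_log_zeta_series[OF \<nu> s]]]
    by (simp del: of_nat_Suc)
qed

section \<open>The natural boundary\<close>

text \<open>Only m = q k contribute, because \<open>rep_at_multiple\<close> vanishes otherwise; this
  substitution pulls out q^(-(nu + 1)) and leaves the series of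
  \<open>nonvanishing_coefficient\<close>.\<close>

lemma nonvanishing_radial_coefficient:
  fixes a b :: real
  assumes \<nu>: "\<nu> \<ge> 2" and ab: "0 < a" "a < b"
  shows "\<exists>j q. j > 0 \<and> q > 0 \<and> coprime j q \<and> a < real j / real q \<and> real j / real q < b \<and>
     (\<Sum>i. rad_coeff 1 (Suc i) / real (Suc i) ^ Suc \<nu> * rep_at_multiple \<nu> j q (Suc i)) \<noteq> 0"
proof -
  obtain j q where jq: "j > 0" "q > 0" "coprime j q" "a < real j / real q" "real j / real q < b"
    and nz: "(\<Sum>k. rad_coeff 1 (q * Suc k) / real (Suc k) ^ Suc \<nu> * real (rep \<nu> ((Suc k * j)\<^sup>2))) \<noteq> 0"
    using nonvanishing_coefficient[OF assms] by blast
  define f where "f = (\<lambda>i. rad_coeff 1 (Suc i) / real (Suc i) ^ Suc \<nu> * rep_at_multiple \<nu> j q (Suc i))"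
  \<comment> \<open>Both series are indexed from 0, so the multiple q * Suc k sits at position q *
    Suc k - 1.\<close>
  define g where "g = (\<lambda>k. q * Suc k - 1)"
  have Sg: "Suc (g k) = q * Suc k" for k using jq(2) by (simp add: g_def)
  have "strict_mono g" unfolding strict_mono_Suc_iff using Sg jq(2) by (metis Suc_less_eq lessI mult_less_cancel1)
  moreover have "f n = 0" if "n \<notin> range g" for n
  proof -
    have "\<not> q dvd Suc n"
    proof
      assume "q dvd Suc n"
      then obtain r where r: "Suc n = q * r" by auto
      then obtain k where "r = Suc k" by (cases r) auto
      hence "Suc (g k) = Suc n" using Sg r by simp
      thus False using that by auto
    qed
    thus ?thesis by (simp add: f_def rep_at_multiple_def)
  qed
  moreover have "f sums suminf f"
    unfolding f_def by (rule summable_sums[OF summable_rep_at_multiple[OF \<nu> jq(1,2)]])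
  ultimately have "(\<lambda>k. f (g k)) sums suminf f" by (simp add: sums_mono_reindex)
  moreover have "f (g k) = inverse (real q ^ Suc \<nu>) * (rad_coeff 1 (q * Suc k) / real (Suc k) ^ Suc \<nu> * real (rep \<nu> ((Suc k * j)\<^sup>2)))" for k
  proof -
    have "rep_at_multiple \<nu> j q (q * Suc k) = real (rep \<nu> ((Suc k * j)\<^sup>2))"
      using jq(2) by (simp add: rep_at_multiple_def del: mult_Suc mult_Suc_right)
    moreover have "real (q * Suc k) ^ Suc \<nu> = real q ^ Suc \<nu> * real (Suc k) ^ Suc \<nu>"
      by (simp only: of_nat_mult power_mult_distrib)
    ultimately show ?thesis unfolding f_def Sg by (simp only:) (simp add: divide_inverse del: power_Suc of_nat_Suc)
  qed
  ultimately have S: "(\<lambda>k. inverse (real q ^ Suc \<nu>) * (rad_coeff 1 (q * Suc k) / real (Suc k) ^ Suc \<nu> * real (rep \<nu> ((Suc k * j)\<^sup>2)))) sums suminf f"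
    by simp
  have "suminf f \<noteq> 0"
  proof
    assume "suminf f = 0"
    from sums_mult[OF S[unfolded this], of "real q ^ Suc \<nu>"]
    have "(\<lambda>k. rad_coeff 1 (q * Suc k) / real (Suc k) ^ Suc \<nu> * real (rep \<nu> ((Suc k * j)\<^sup>2))) sums 0"
      using jq(2) by (simp add: mult.assoc[symmetric] del: power_Suc of_nat_Suc mult_Suc mult_Suc_right)
    thus False using nz sums_unique by force
  qed
  thus ?thesis using jq unfolding f_def by blast
qed

text \<open>The phase i * i^(-\<alpha>) has real part sin (\<alpha> pi / 2) = sin ((nu + 1) pi / 4),
  which is zero only if 4 divides nu + 1. The real part is what counts, since only the modulus of
  zeta is compared.\<close>

lemma Re_radial_constant_nonzero:
  assumes \<nu>: "\<nu> \<in> {2, 4, 8::nat}" and x: "x > 0"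
  shows "Re (\<i> * (\<i> * complex_of_real x) powr complex_of_real (- ((real \<nu> + 1) / 2))) \<noteq> 0"
proof -
  define \<alpha> where "\<alpha> = (real \<nu> + 1) / 2"
  have "(\<i> * complex_of_real x) powr complex_of_real (- \<alpha>) = (complex_of_real x * \<i>) powr complex_of_real (- \<alpha>)"
    by (simp only: mult.commute)
  also have "\<dots> = complex_of_real x powr complex_of_real (- \<alpha>) * \<i> powr complex_of_real (- \<alpha>)"
    by (rule powr_times_real_left) (use x in auto)
  also have "complex_of_real x powr complex_of_real (- \<alpha>) = complex_of_real (x powr (- \<alpha>))"
    by (rule powr_of_real) (use x in auto)
  also have "\<i> powr complex_of_real (- \<alpha>) = cis (- (\<alpha> * pi / 2))"
    by (simp add: powr_def cis_conv_exp mult_ac)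
  finally have "Re (\<i> * (\<i> * complex_of_real x) powr complex_of_real (- \<alpha>)) = x powr (- \<alpha>) * sin (\<alpha> * pi / 2)"
    by simp
  moreover have "sin (\<alpha> * pi / 2) \<noteq> 0"
  proof
    assume "sin (\<alpha> * pi / 2) = 0"
    then obtain i :: int where "\<alpha> * pi / 2 = of_int i * pi" using sin_zero_iff_int2 by auto
    hence "\<alpha> / 2 * pi = of_int i * pi" by simp
    hence "\<alpha> / 2 = of_int i" by (simp only: mult_cancel_right pi_neq_zero simp_thms)
    hence "real \<nu> + 1 = 4 * real_of_int i" by (simp add: \<alpha>_def)
    hence "real_of_int (int \<nu> + 1) = real_of_int (4 * i)" by simp
    hence "int \<nu> + 1 = 4 * i" by (simp only: of_int_eq_iff)
    thus False using \<nu> by auto presburger+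
  qed
  ultimately show ?thesis using x by (simp add: \<alpha>_def)
qed

text \<open>Near z such a function is h w (w - z)^n with h z nonzero, so the logarithm of its
  modulus is O(|ln \<sigma>|), which every positive power of \<sigma> suppresses.\<close>

lemma meromorphic_exp_growth:
  assumes f: "f meromorphic_on {z}" and \<alpha>: "\<alpha> > 0"
    and g: "\<And>\<sigma>. \<sigma> > 0 \<Longrightarrow> norm (f (z + complex_of_real \<sigma>)) = exp (g \<sigma>)"
  shows "((\<lambda>\<sigma>. \<sigma> powr \<alpha> * g \<sigma>) \<longlongrightarrow> 0) (at_right 0)"
proof -
  have iso: "isolated_singularity_at f z" "not_essential f z"
    using f meromorphic_on_isolated_singularity meromorphic_on_not_essential by blast+
  have right: "filterlim (\<lambda>\<sigma>::real. z + complex_of_real \<sigma>) (at z) (at_right 0)"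
    unfolding filterlim_at
  proof
    show "((\<lambda>\<sigma>. z + complex_of_real \<sigma>) \<longlongrightarrow> z) (at_right 0)" by (auto intro!: tendsto_eq_intros)
    show "\<forall>\<^sub>F \<sigma> in at_right 0. z + complex_of_real \<sigma> \<in> UNIV \<and> z + complex_of_real \<sigma> \<noteq> z"
      using eventually_at_right_real[OF zero_less_one] by eventually_elim auto
  qed
  \<comment> \<open>On the ray the modulus is an exponential, so f is not identically 0 near z and
    has an order there.\<close>
  have freq: "\<exists>\<^sub>F w in at z. f w \<noteq> 0"
  proof (rule ccontr)
    assume "\<not> ?thesis"
    hence "\<forall>\<^sub>F w in at z. f w = 0" by (simp add: frequently_def)
    hence "\<forall>\<^sub>F \<sigma> in at_right 0. f (z + complex_of_real \<sigma>) = 0" using right by (rule eventually_compose_filterlim)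
    hence "\<forall>\<^sub>F \<sigma> in at_right (0::real). False"
      using eventually_at_right_real[OF zero_less_one]
    proof eventually_elim
      case (elim \<sigma>)
      thus ?case using g[of \<sigma>] by simp
    qed
    thus False by simp
  qed
  define n where "n = zorder f z"
  define h where "h = zor_poly f z"
  obtain r where r: "r > 0" "h z \<noteq> 0" "h holomorphic_on cball z r"
     "\<And>w. w \<in> cball z r - {z} \<Longrightarrow> f w = h w * (w - z) powi n \<and> h w \<noteq> 0"
    using zorder_exist[OF iso freq] unfolding n_def h_def by blast
  have "isCont h z"
    using r(1,3) by (meson centre_in_ball holomorphic_on_imp_continuous_on continuous_on_eq_continuous_at open_ball ball_subset_cball continuous_on_subset)
  hence "((\<lambda>\<sigma>. h (z + complex_of_real \<sigma>)) \<longlongrightarrow> h z) (at_right 0)"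
    by (intro isCont_tendsto_compose[of z h]) (auto intro!: tendsto_eq_intros)
  hence lnh: "((\<lambda>\<sigma>. ln (norm (h (z + complex_of_real \<sigma>)))) \<longlongrightarrow> ln (norm (h z))) (at_right 0)"
    using r(2) by (intro tendsto_intros) auto
  have p0: "((\<lambda>\<sigma>::real. \<sigma> powr \<alpha>) \<longlongrightarrow> 0) (at_right 0)" using \<alpha> by real_asymp
  have pl: "((\<lambda>\<sigma>::real. \<sigma> powr \<alpha> * ln \<sigma>) \<longlongrightarrow> 0) (at_right 0)" using \<alpha> by real_asymp
  have "((\<lambda>\<sigma>. \<sigma> powr \<alpha> * ln (norm (h (z + complex_of_real \<sigma>))) + of_int n * (\<sigma> powr \<alpha> * ln \<sigma>)) \<longlongrightarrow> 0 * ln (norm (h z)) + of_int n * 0) (at_right 0)"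
    by (intro tendsto_intros p0 pl lnh)
  moreover have "\<forall>\<^sub>F \<sigma> in at_right 0. \<sigma> powr \<alpha> * ln (norm (h (z + complex_of_real \<sigma>))) + of_int n * (\<sigma> powr \<alpha> * ln \<sigma>) = \<sigma> powr \<alpha> * g \<sigma>"
    using eventually_at_right_real[OF r(1)]
  proof eventually_elim
    case (elim \<sigma>)
    hence \<sigma>: "0 < \<sigma>" "\<sigma> < r" by auto
    hence "z + complex_of_real \<sigma> \<in> cball z r - {z}" by (auto simp: dist_norm)
    from r(4)[OF this] have e: "f (z + complex_of_real \<sigma>) = h (z + complex_of_real \<sigma>) * complex_of_real \<sigma> powi n" "h (z + complex_of_real \<sigma>) \<noteq> 0" by auto
    have "exp (g \<sigma>) = norm (h (z + complex_of_real \<sigma>)) * \<sigma> powi n"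
      using g[OF \<sigma>(1)] \<sigma> by (simp add: e norm_mult norm_power_int)
    hence "g \<sigma> = ln (norm (h (z + complex_of_real \<sigma>)) * \<sigma> powi n)" by (metis ln_exp)
    also have "\<dots> = ln (norm (h (z + complex_of_real \<sigma>))) + of_int n * ln \<sigma>"
    proof -
      have "\<sigma> powi n = \<sigma> powr of_int n" using \<sigma> by (simp add: powr_real_of_int')
      thus ?thesis using e(2) \<sigma> by (simp add: ln_mult ln_powr)
    qed
    finally show ?case by (simp add: algebra_simps)
  qed
  ultimately have "((\<lambda>\<sigma>. \<sigma> powr \<alpha> * g \<sigma>) \<longlongrightarrow> 0 * ln (norm (h z)) + of_int n * 0) (at_right 0)"
    by (rule Lim_transform_eventually)
  thus ?thesis by simp
qed

theorem mainTheorem2: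
  fixes \<nu> :: nat
  assumes "\<nu> \<in> {2, 4, 8}"
  shows "\<forall>(t0::real) (r::real). r > 0 \<longrightarrow>
           \<not> (\<exists>f. f meromorphic_on ({s. Re s > 0} \<union> ball (\<i> * complex_of_real t0) r) \<and>
                   (\<forall>s. Re s > 0 \<longrightarrow> f s = zeta_sqrt \<nu> s))"
proof (intro allI impI notI)
  fix t0 r :: real
  assume r: "r > 0" and "\<exists>f. f meromorphic_on ({s. Re s > 0} \<union> ball (\<i> * complex_of_real t0) r) \<and>
                   (\<forall>s. Re s > 0 \<longrightarrow> f s = zeta_sqrt \<nu> s)"
  then obtain f where f: "f meromorphic_on ({s. Re s > 0} \<union> ball (\<i> * complex_of_real t0) r)"
    and fz: "\<And>s. Re s > 0 \<Longrightarrow> f s = zeta_sqrt \<nu> s" by blast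
  have \<nu>: "\<nu> \<ge> 2" using assms by auto
  \<comment> \<open>With these bounds 2 pi j / q lies between |t0| + r/4 and |t0| + r/2: inside the
    disc up to sign, and positive even for t0 = 0.\<close>
  define a b where "a = (\<bar>t0\<bar> + r / 4) / (2 * pi)" and "b = (\<bar>t0\<bar> + r / 2) / (2 * pi)"
  have ab: "0 < a" "a < b" using r by (auto simp: a_def b_def intro!: divide_strict_right_mono divide_pos_pos)
  obtain j q where jq: "j > 0" "q > 0" "coprime j q" "a < real j / real q" "real j / real q < b"
    and nz: "(\<Sum>i. rad_coeff 1 (Suc i) / real (Suc i) ^ Suc \<nu> * rep_at_multiple \<nu> j q (Suc i)) \<noteq> 0"
    using nonvanishing_radial_coefficient[OF \<nu> ab] by blast
  define \<tau> where "\<tau> = real j / real q"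
  define \<alpha> where "\<alpha> = (real \<nu> + 1) / 2"
  define S where "S = (\<Sum>i. rad_coeff 1 (Suc i) / real (Suc i) ^ Suc \<nu> * rep_at_multiple \<nu> j q (Suc i))"
  have \<tau>: "\<tau> > 0" using jq by (simp add: \<tau>_def)
  have \<tau>b: "\<bar>t0\<bar> < 2 * pi * \<tau>" "2 * pi * \<tau> < \<bar>t0\<bar> + r"
    using jq(4,5) r by (auto simp: a_def b_def \<tau>_def[symmetric] field_simps)
  \<comment> \<open>For negative t0 the mirror image of 2 pi i \<tau> is taken, so that z lies on
    the same side as t0 and within the disc.\<close>
  define z where "z = \<i> * complex_of_real (if t0 \<ge> 0 then 2 * pi * \<tau> else - (2 * pi * \<tau>))"
  have "dist (\<i> * complex_of_real t0) z < r"
  proof -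
    have "dist (\<i> * complex_of_real t0) z = norm (\<i> * complex_of_real (t0 - (if t0 \<ge> 0 then 2 * pi * \<tau> else - (2 * pi * \<tau>))))"
      by (simp only: z_def dist_norm right_diff_distrib[symmetric] of_real_diff[symmetric])
    also have "\<dots> = \<bar>t0 - (if t0 \<ge> 0 then 2 * pi * \<tau> else - (2 * pi * \<tau>))\<bar>" by (simp only: norm_mult norm_of_real norm_ii mult_1)
    also have "\<dots> < r" using \<tau>b by auto
    finally show ?thesis .
  qed
  hence fm: "f meromorphic_on {z}" by (intro meromorphic_on_subset[OF f]) auto
  define s where "s = (\<lambda>\<sigma>. complex_of_real \<sigma> + \<i> * complex_of_real (2 * pi * \<tau>))"
  have growth: "((\<lambda>\<sigma>. \<sigma> powr \<alpha> * Re (log_zeta_series \<nu> (s \<sigma>))) \<longlongrightarrow> 0) (at_right 0)"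
  proof (rule meromorphic_exp_growth[OF fm])
    fix \<sigma> :: real assume \<sigma>: "\<sigma> > 0"
    have Re: "Re (s \<sigma>) > 0" using \<sigma> by (simp add: s_def)
    have "f (z + complex_of_real \<sigma>) = exp (log_zeta_series \<nu> (z + complex_of_real \<sigma>))"
      using fz zeta_sqrt_eq_exp[OF \<nu>] \<sigma> by (simp add: z_def)
    moreover have "z + complex_of_real \<sigma> = s \<sigma> \<or> z + complex_of_real \<sigma> = cnj (s \<sigma>)"
      by (auto simp: z_def s_def complex_eq_iff)
    hence "Re (log_zeta_series \<nu> (z + complex_of_real \<sigma>)) = Re (log_zeta_series \<nu> (s \<sigma>))"
      using log_zeta_series_cnj[OF \<nu> Re] by auto
    ultimately show "norm (f (z + complex_of_real \<sigma>)) = exp (Re (log_zeta_series \<nu> (s \<sigma>)))" by simp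
  qed (simp add: \<alpha>_def)
  obtain \<kappa> where \<kappa>: "\<kappa> > 0" and lim: "((\<lambda>\<sigma>. of_real (\<sigma> powr \<alpha>) * log_zeta_series \<nu> (s \<sigma>)) \<longlongrightarrow>
     of_real \<kappa> * (\<i> * of_real (2 * pi * \<tau>)) * (\<i> * of_real (4 * pi * \<tau>)) powr of_real (- \<alpha>) * of_real S) (at_right 0)"
    using log_zeta_radial_limit[OF \<nu> jq(1-3)] unfolding \<tau>_def[symmetric] \<alpha>_def[symmetric] S_def[symmetric] s_def by blast
  define R where "R = Re (\<i> * (\<i> * complex_of_real (4 * pi * \<tau>)) powr complex_of_real (- \<alpha>))"
  have R: "R \<noteq> 0" unfolding R_def \<alpha>_def by (rule Re_radial_constant_nonzero[OF assms]) (use \<tau> in simp)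
  have "of_real \<kappa> * (\<i> * of_real (2 * pi * \<tau>)) * (\<i> * of_real (4 * pi * \<tau>)) powr of_real (- \<alpha>) * of_real S
      = complex_of_real (\<kappa> * (2 * pi * \<tau>) * S) * (\<i> * (\<i> * complex_of_real (4 * pi * \<tau>)) powr complex_of_real (- \<alpha>))"
    by (simp only: of_real_mult mult_ac)
  hence "Re (of_real \<kappa> * (\<i> * of_real (2 * pi * \<tau>)) * (\<i> * of_real (4 * pi * \<tau>)) powr of_real (- \<alpha>) * of_real S) = \<kappa> * (2 * pi * \<tau>) * S * R"
    unfolding R_def by (simp only: times_complex.simps Re_complex_of_real Im_complex_of_real mult_zero_left diff_zero)
  with tendsto_Re[OF lim] have "((\<lambda>\<sigma>. \<sigma> powr \<alpha> * Re (log_zeta_series \<nu> (s \<sigma>))) \<longlongrightarrow> \<kappa> * (2 * pi * \<tau>) * S * R) (at_right 0)"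
    by (simp only: times_complex.simps Re_complex_of_real Im_complex_of_real mult_zero_left diff_zero)
  from tendsto_unique[OF _ this growth] have "\<kappa> * (2 * pi * \<tau>) * S * R = 0" by simp
  thus False using \<kappa> \<tau> R nz by (simp add: S_def)
qed

end
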